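(* Let $k$ be a field, $n\ge1$, let $T=\{1,\ldots,d\}$ ($d\geq 1$) be equipped with a partial order $\le$, let $\mathbf Q=(Q_1,\ldots,Q_d)\in k^d$, and suppose $Q^\pi=\prod_{t\in T}Q_t$ is invertible in $k$. Write $P_m^{(T)}=P_m^{(T)}(\mathbf Q)$ and $e^T=(A^n,A^n,\ldots,A^n)\in P_n^{(T)}$. Then $$e^TP_n^{(T)}e^T=P_{n-1}^{(T)}e^T\cong P_{n-1}^{(T)}$$ is an isomorphism of algebras (where $e^TP_n^{(T)}e^T$ has identity element $(Q^\pi)^{-1}e^T$), and the functor $$\mathcal G:P_{n-1}^{(T)}\text{-mod}\to P_n^{(T)}\text{-mod},\qquad M\mapsto P_n^{(T)}e^T\otimes_{P_{n-1}^{(T)}}M$$ is a full embedding of categories (i.e. fully faithful).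
   Context: Write $\underline n=\{1,\ldots,n\}$, and let $\underline n'$, $\underline n''$ be disjoint (primed, doubly primed) copies. $p_n$ is the set of partitions of $\underline n\cup\underline n'$ (identified with equivalence relations; $p_0$ has one element). For $a,b\in p_n$ let $b^{+}$ be the partition of $\underline n'\cup\underline n''$ obtained from $b$ by renaming $i\mapsto i'$, $i'\mapsto i''$; let $d_u(ab)$ be the equivalence relation on $\underline n\cup\underline n'\cup\underline n''$ generated by $a$ and $b^{+}$; $c(a,b)$ is the number of parts of $d_u(ab)$ contained in $\underline n'$; $d(ab)\in p_n$ is obtained by restricting $d_u(ab)$ to $\underline n\cup\underline n''$ and renaming $i''\mapsto i'$. $p_n^{(T)}$ is the set of tuples $a=(a_t)_{t\in T}\in\prod_{t\in T}p_n$ such that $t\le t'$ implies that $a_t$ is a refinement of $a_{t'}$ (each part of $a_{t'}$ is a union of parts of $a_t$). $P_n^{(T)}(\mathbf Q)$ is the (unital, associative) $k$-algebra with basis $p_n^{(T)}$ and product $ab=\left(\prod_tQ_t^{c(a_t,b_t)}\right)(d(a_tb_t))_{t\in T}$. In particular $P_0^{(T)}=k$. $A^n\in p_n$ is the partition with parts $\{i,i'\}$ for $i<n$ and $\{n\},\{n'\}$. One has $e^Te^T=Q^\pi e^T$. $P_{n-1}^{(T)}$ is regarded as a subalgebra of $P_n^{(T)}$ by adding to each component $a_t$ of every basis element the part $\{n,n'\}$. Every element of $P_{n-1}^{(T)}$ commutes with $e^T$, so $P_n^{(T)}e^T$ is a $(P_n^{(T)},P_{n-1}^{(T)})$-bimodule.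 For an algebra $A$, $A$-mod denotes the category of left $A$-modules. *)

theory Defs
  imports "HOL-Algebra.QuotRing" "HOL-Algebra.Generated_Groups"
    "HOL-Algebra.Free_Abelian_Groups" "HOL-Algebra.Algebraic_Closure_Type"
begin

section \<open>Partitions\<close>

text \<open>
  The point \<open>(i, s)\<close> stands for \<open>i\<close> decorated with \<open>s\<close> primes, so \<open>{1..n} \<times> {0, 1}\<close> is the
  union of the sets of unprimed and primed points. Partitions are represented by their
  equivalence relations.
\<close>

type_synonym point = "nat \<times> nat"
type_synonym prel = "(point \<times> point) set"

definition parts :: "nat \<Rightarrow> prel set" where
  "parts n = {r. equiv ({1..n} \<times> {0, 1}) r}"

definition shift_up :: "prel \<Rightarrow> prel" where
  "shift_up b = map_prod (\<lambda>(i, s). (i, Suc s)) (\<lambda>(i, s). (i, Suc s)) ` b"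

definition equiv_gen :: "'a set \<Rightarrow> ('a \<times> 'a) set \<Rightarrow> ('a \<times> 'a) set" where
  "equiv_gen B r = \<Inter>{q. equiv B q \<and> r \<subseteq> q}"

definition glue :: "nat \<Rightarrow> prel \<Rightarrow> prel \<Rightarrow> prel" where
  "glue n a b = equiv_gen ({1..n} \<times> {0, 1, 2}) (a \<union> shift_up b)"

definition loops :: "nat \<Rightarrow> prel \<Rightarrow> prel \<Rightarrow> nat" where
  "loops n a b = card {B \<in> ({1..n} \<times> {0, 1, 2}) // glue n a b. B \<subseteq> {1..n} \<times> {1}}"

definition part_comp :: "nat \<Rightarrow> prel \<Rightarrow> prel \<Rightarrow> prel" where
  "part_comp n a b =
     (let collapse = (\<lambda>(i, s). (i, if s = 2 then 1 else s))
      in map_prod collapse collapse `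
           (glue n a b \<inter> ({1..n} \<times> {0, 2}) \<times> ({1..n} \<times> {0, 2})))"

definition part_one :: "nat \<Rightarrow> prel" where
  "part_one n = {((i, s), (j, t)). i = j \<and> i \<in> {1..n} \<and> s \<in> {0, 1} \<and> t \<in> {0, 1}}"

text \<open>The partition $A^n$ with parts $\{i, i'\}$ for $i < n$, $\{n\}$ and $\{n'\}$.\<close>

definition part_A :: "nat \<Rightarrow> prel" where
  "part_A n = part_one (n - 1) \<union> {((n, 0), (n, 0)), ((n, 1), (n, 1))}"

text \<open>Adding the part $\{n, n'\}$ to a partition in \<open>parts (n - 1)\<close>.\<close>

definition part_extend :: "nat \<Rightarrow> prel \<Rightarrow> prel" where
  "part_extend n a = a \<union> ({n} \<times> {0, 1}) \<times> ({n} \<times> {0, 1})"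

definition refinement_of :: "nat \<Rightarrow> prel \<Rightarrow> prel \<Rightarrow> bool" where
  "refinement_of n a b \<longleftrightarrow>
     (\<forall>B \<in> ({1..n} \<times> {0, 1}) // b. \<exists>Y \<subseteq> ({1..n} \<times> {0, 1}) // a. B = \<Union>Y)"

text \<open>A partial order on \<open>T\<close> is a relation \<open>po\<close>, where \<open>(t, t') \<in> po\<close> means $t \le t'$.\<close>

definition part_tuples :: "nat \<Rightarrow> 't set \<Rightarrow> 't rel \<Rightarrow> ('t \<Rightarrow> prel) set" where
  "part_tuples n T po =
     {a \<in> T \<rightarrow>\<^sub>E parts n. \<forall>t\<in>T. \<forall>t'\<in>T. (t, t') \<in> po \<longrightarrow> refinement_of n (a t) (a t')}"


section \<open>The partition algebras\<close>

definition basis_vec :: "'b \<Rightarrow> 'b \<Rightarrow> 'k::field" where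
  "basis_vec a = (\<lambda>b. if b = a then 1 else 0)"

text \<open>
  The function \<open>f\<close> stands for the linear combination in which the basis element \<open>a\<close> has
  coefficient \<open>f a\<close>. The multiplication is the bilinear extension of the product
  of basis elements.
\<close>

definition part_algebra ::
    "nat \<Rightarrow> 't set \<Rightarrow> 't rel \<Rightarrow> ('t \<Rightarrow> 'k::field) \<Rightarrow> ('k, ('t \<Rightarrow> prel) \<Rightarrow> 'k) module" where
  "part_algebra n T po Q =
     \<lparr>carrier = {f. \<forall>a. a \<notin> part_tuples n T po \<longrightarrow> f a = 0},
      monoid.mult = (\<lambda>f g c. \<Sum>a\<in>part_tuples n T po. \<Sum>b\<in>part_tuples n T po.
        f a * g b * (\<Prod>t\<in>T. Q t ^ loops n (a t) (b t))
          * basis_vec (\<lambda>t\<in>T. part_comp n (a t) (b t)) c),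
      monoid.one = basis_vec (\<lambda>t\<in>T. part_one n),
      ring.zero = (\<lambda>_. 0),
      ring.add = (\<lambda>f g a. f a + g a),
      module.smult = (\<lambda>x f a. x * f a)\<rparr>"

definition eT :: "nat \<Rightarrow> 't set \<Rightarrow> ('t \<Rightarrow> prel) \<Rightarrow> 'k::field" where
  "eT n T = basis_vec (\<lambda>t\<in>T. part_A n)"

text \<open>The linear embedding of the algebra with index \<open>n - 1\<close> into the one with index \<open>n\<close>.\<close>

definition part_embed ::
    "nat \<Rightarrow> 't set \<Rightarrow> 't rel \<Rightarrow> (('t \<Rightarrow> prel) \<Rightarrow> 'k::field) \<Rightarrow> (('t \<Rightarrow> prel) \<Rightarrow> 'k)" where
  "part_embed n T po f =
     (\<lambda>c. \<Sum>a\<in>part_tuples (n - 1) T po. f a * basis_vec (\<lambda>t\<in>T. part_extend n (a t)) c)"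


section \<open>Algebras over a field\<close>

definition unital_algebra :: "('k::field, 'a) module \<Rightarrow> bool" where
  "unital_algebra A \<longleftrightarrow> ring A \<and> module (ring_of_type_algebra :: 'k ring) A \<and>
     (\<forall>c. \<forall>x\<in>carrier A. \<forall>y\<in>carrier A.
        (c \<odot>\<^bsub>A\<^esub> x) \<otimes>\<^bsub>A\<^esub> y = c \<odot>\<^bsub>A\<^esub> (x \<otimes>\<^bsub>A\<^esub> y) \<and>
        x \<otimes>\<^bsub>A\<^esub> (c \<odot>\<^bsub>A\<^esub> y) = c \<odot>\<^bsub>A\<^esub> (x \<otimes>\<^bsub>A\<^esub> y))"

definition algebra_iso :: "('k::field, 'a) module \<Rightarrow> ('k, 'b) module \<Rightarrow> ('a \<Rightarrow> 'b) set" where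
  "algebra_iso A B =
     {h \<in> ring_iso A B. \<forall>c. \<forall>x\<in>carrier A. h (c \<odot>\<^bsub>A\<^esub> x) = c \<odot>\<^bsub>B\<^esub> h x}"

text \<open>The algebra $e A e$, with \<open>u\<close> as identity element.\<close>

definition corner_algebra :: "('k, 'a) module \<Rightarrow> 'a \<Rightarrow> 'a \<Rightarrow> ('k, 'a) module" where
  "corner_algebra A e u = A\<lparr>carrier := {e \<otimes>\<^bsub>A\<^esub> x \<otimes>\<^bsub>A\<^esub> e | x. x \<in> carrier A}, monoid.one := u\<rparr>"


section \<open>Modules over noncommutative rings\<close>

text \<open>
  The library locale \<open>module\<close> requires a commutative ring. As there, the multiplicative
  fields of the record \<open>M\<close> are irrelevant.
\<close>

locale left_module = R?: ring R + M?: abelian_group M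
  for R :: "('r, 'c) ring_scheme" (structure) and M :: "('r, 'm, 'd) module_scheme" (structure) +
  assumes smult_closed:
      "\<lbrakk>a \<in> carrier R; x \<in> carrier M\<rbrakk> \<Longrightarrow> a \<odot>\<^bsub>M\<^esub> x \<in> carrier M"
    and smult_l_distr:
      "\<lbrakk>a \<in> carrier R; b \<in> carrier R; x \<in> carrier M\<rbrakk> \<Longrightarrow>
         (a \<oplus>\<^bsub>R\<^esub> b) \<odot>\<^bsub>M\<^esub> x = a \<odot>\<^bsub>M\<^esub> x \<oplus>\<^bsub>M\<^esub> b \<odot>\<^bsub>M\<^esub> x"
    and smult_r_distr:
      "\<lbrakk>a \<in> carrier R; x \<in> carrier M; y \<in> carrier M\<rbrakk> \<Longrightarrow>
         a \<odot>\<^bsub>M\<^esub> (x \<oplus>\<^bsub>M\<^esub> y) = a \<odot>\<^bsub>M\<^esub> x \<oplus>\<^bsub>M\<^esub> a \<odot>\<^bsub>M\<^esub> y"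
    and smult_assoc:
      "\<lbrakk>a \<in> carrier R; b \<in> carrier R; x \<in> carrier M\<rbrakk> \<Longrightarrow>
         (a \<otimes>\<^bsub>R\<^esub> b) \<odot>\<^bsub>M\<^esub> x = a \<odot>\<^bsub>M\<^esub> (b \<odot>\<^bsub>M\<^esub> x)"
    and smult_one:
      "x \<in> carrier M \<Longrightarrow> \<one>\<^bsub>R\<^esub> \<odot>\<^bsub>M\<^esub> x = x"

text \<open>Homomorphisms are extensional, so that equal maps on the carrier are equal.\<close>

definition left_module_hom ::
    "('r, 'c) ring_scheme \<Rightarrow> ('r, 'm) module \<Rightarrow> ('r, 'n) module \<Rightarrow> ('m \<Rightarrow> 'n) set" where
  "left_module_hom R M N =
     {f \<in> carrier M \<rightarrow>\<^sub>E carrier N.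
        (\<forall>x\<in>carrier M. \<forall>y\<in>carrier M. f (x \<oplus>\<^bsub>M\<^esub> y) = f x \<oplus>\<^bsub>N\<^esub> f y) \<and>
        (\<forall>a\<in>carrier R. \<forall>x\<in>carrier M. f (a \<odot>\<^bsub>M\<^esub> x) = a \<odot>\<^bsub>N\<^esub> f x)}"

text \<open>
  Functors from left \<open>R\<close>-modules with carrier in \<open>'m\<close> to left \<open>S\<close>-modules with carrier in
  \<open>'n\<close>; \<open>Fm M N\<close> is the action on homomorphisms from \<open>M\<close> to \<open>N\<close>.
\<close>

definition module_functor ::
    "('r, 'c) ring_scheme \<Rightarrow> ('s, 'd) ring_scheme \<Rightarrow> (('r, 'm) module \<Rightarrow> ('s, 'n) module) \<Rightarrow>
     (('r, 'm) module \<Rightarrow> ('r, 'm) module \<Rightarrow> ('m \<Rightarrow> 'm) \<Rightarrow> ('n \<Rightarrow> 'n)) \<Rightarrow> bool" where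
  "module_functor R S F Fm \<longleftrightarrow>
     (\<forall>M. left_module R M \<longrightarrow> left_module S (F M)) \<and>
     (\<forall>M N. left_module R M \<longrightarrow> left_module R N \<longrightarrow>
        (\<forall>f \<in> left_module_hom R M N. Fm M N f \<in> left_module_hom S (F M) (F N))) \<and>
     (\<forall>M. left_module R M \<longrightarrow> Fm M M (\<lambda>x\<in>carrier M. x) = (\<lambda>x\<in>carrier (F M). x)) \<and>
     (\<forall>L M N. left_module R L \<longrightarrow> left_module R M \<longrightarrow> left_module R N \<longrightarrow>
        (\<forall>f \<in> left_module_hom R L M. \<forall>g \<in> left_module_hom R M N.
           Fm L N (compose (carrier L) g f) = compose (carrier (F L)) (Fm M N g) (Fm L M f)))"

definition fully_faithful_functor ::
    "('r, 'c) ring_scheme \<Rightarrow> ('s, 'd) ring_scheme \<Rightarrow> (('r, 'm) module \<Rightarrow> ('s, 'n) module) \<Rightarrow>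
     (('r, 'm) module \<Rightarrow> ('r, 'm) module \<Rightarrow> ('m \<Rightarrow> 'm) \<Rightarrow> ('n \<Rightarrow> 'n)) \<Rightarrow> bool" where
  "fully_faithful_functor R S F Fm \<longleftrightarrow> module_functor R S F Fm \<and>
     (\<forall>M N. left_module R M \<longrightarrow> left_module R N \<longrightarrow>
        bij_betw (Fm M N) (left_module_hom R M N) (left_module_hom S (F M) (F N)))"


section \<open>Tensor products\<close>

record ('r, 's, 'x) bimodule = "('r, 'x) module" +
  rsmult :: "['x, 's] \<Rightarrow> 'x"

definition tensor_rels ::
    "('s, 'c) ring_scheme \<Rightarrow> ('r, 's, 'x) bimodule \<Rightarrow> ('s, 'm) module \<Rightarrow> ('x \<times> 'm \<Rightarrow>\<^sub>0 int) set"
where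
  "tensor_rels S B M =
     {frag_of (x \<oplus>\<^bsub>B\<^esub> y, m) - frag_of (x, m) - frag_of (y, m) | x y m.
        x \<in> carrier B \<and> y \<in> carrier B \<and> m \<in> carrier M} \<union>
     {frag_of (x, l \<oplus>\<^bsub>M\<^esub> m) - frag_of (x, l) - frag_of (x, m) | x l m.
        x \<in> carrier B \<and> l \<in> carrier M \<and> m \<in> carrier M} \<union>
     {frag_of (rsmult B x s, m) - frag_of (x, s \<odot>\<^bsub>M\<^esub> m) | x s m.
        x \<in> carrier B \<and> s \<in> carrier S \<and> m \<in> carrier M}"

definition tensor_sub ::
    "('s, 'c) ring_scheme \<Rightarrow> ('r, 's, 'x) bimodule \<Rightarrow> ('s, 'm) module \<Rightarrow> ('x \<times> 'm \<Rightarrow>\<^sub>0 int) set"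
where
  "tensor_sub S B M =
     generate (free_Abelian_group (carrier B \<times> carrier M)) (tensor_rels S B M)"

text \<open>The class of the formal combination \<open>z\<close> of pure tensors in $B \otimes_S M$.\<close>

definition tensor_class ::
    "('s, 'c) ring_scheme \<Rightarrow> ('r, 's, 'x) bimodule \<Rightarrow> ('s, 'm) module \<Rightarrow>
     ('x \<times> 'm \<Rightarrow>\<^sub>0 int) \<Rightarrow> ('x \<times> 'm \<Rightarrow>\<^sub>0 int) set"
where
  "tensor_class S B M z =
     tensor_sub S B M #>\<^bsub>free_Abelian_group (carrier B \<times> carrier M)\<^esub> z"

text \<open>
  $B \otimes_S M$ as a left module through $r (x \otimes m) = r x \otimes m$. The unions over
  the representatives of a class lift additive maps of the free abelian groups to the quotients.
\<close>

definition tensor ::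
    "('s, 'c) ring_scheme \<Rightarrow> ('r, 's, 'x) bimodule \<Rightarrow> ('s, 'm) module \<Rightarrow>
     ('r, ('x \<times> 'm \<Rightarrow>\<^sub>0 int) set) module"
where
  "tensor S B M =
     (let G = free_Abelian_group (carrier B \<times> carrier M) Mod tensor_sub S B M in
      \<lparr>carrier = carrier G,
       monoid.mult = undefined,
       monoid.one = undefined,
       ring.zero = \<one>\<^bsub>G\<^esub>,
       ring.add = monoid.mult G,
       module.smult = (\<lambda>r C. \<Union>z\<in>C. tensor_class S B M
                          (frag_extend (\<lambda>(x, m). frag_of (r \<odot>\<^bsub>B\<^esub> x, m)) z))\<rparr>)"

text \<open>The map $\mathrm{id} \otimes f$.\<close>

definition tensor_map ::
    "('s, 'c) ring_scheme \<Rightarrow> ('r, 's, 'x) bimodule \<Rightarrow> ('s, 'm) module \<Rightarrow> ('s, 'n) module \<Rightarrow>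
     ('m \<Rightarrow> 'n) \<Rightarrow> ('x \<times> 'm \<Rightarrow>\<^sub>0 int) set \<Rightarrow> ('x \<times> 'n \<Rightarrow>\<^sub>0 int) set"
where
  "tensor_map S B M N f =
     (\<lambda>C\<in>carrier (tensor S B M). \<Union>z\<in>C. tensor_class S B N
        (frag_extend (\<lambda>(x, m). frag_of (x, f m)) z))"

text \<open>
  The bimodule $P_n^{(T)} e^T$; its right action is multiplication in $P_n^{(T)}$ by elements of
  the embedded subalgebra. The multiplicative fields are irrelevant.
\<close>

definition part_bimodule ::
    "nat \<Rightarrow> 't set \<Rightarrow> 't rel \<Rightarrow> ('t \<Rightarrow> 'k::field) \<Rightarrow>
     (('t \<Rightarrow> prel) \<Rightarrow> 'k, ('t \<Rightarrow> prel) \<Rightarrow> 'k, ('t \<Rightarrow> prel) \<Rightarrow> 'k) bimodule" where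
  "part_bimodule n T po Q =
     (let P = part_algebra n T po Q in
      \<lparr>carrier = {x \<otimes>\<^bsub>P\<^esub> eT n T | x. x \<in> carrier P},
       monoid.mult = undefined,
       monoid.one = undefined,
       ring.zero = \<zero>\<^bsub>P\<^esub>,
       ring.add = ring.add P,
       module.smult = monoid.mult P,
       rsmult = (\<lambda>x y. x \<otimes>\<^bsub>P\<^esub> part_embed n T po y)\<rparr>)"

end

theory Submission
  imports Defs
begin

text \<open>
  A partition \<open>a\<close> acts on the $2$-colourings of its points: let \<open>part_mat a f g\<close> be $1$ if colouring
  the unprimed points in \<open>f\<close> and the primed points in \<open>g\<close> is constant on the parts of \<open>a\<close>, and $0$
  otherwise. A loop can be coloured freely, so the product of the matrices of \<open>a\<close> and \<open>b\<close> is
  $2^{c(a,b)}$ times the matrix of \<open>d(ab)\<close>. The matrix determines the partition, and its entry at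
  the empty colouring is $1$, so every identity between products of partitions, together with the
  matching identity of loop numbers, can be read off from matrices. This gives
  associativity, the embedding of the smaller algebra, and the products with $A^n$.

  With \<open>u\<close> the idempotent $(Q^\pi)^{-1} e^T$, the vector \<open>m\<close> is recovered from \<open>u \<otimes> m\<close> through
  $u P_n^{(T)} u \cong P_{n-1}^{(T)}$, and a homomorphism \<open>g\<close> maps \<open>x \<otimes> m = x (u \<otimes> m)\<close> to
  \<open>x g(u \<otimes> m)\<close>, where \<open>g(u \<otimes> m) = u g(u \<otimes> m)\<close> again has the form \<open>u \<otimes> m'\<close>.
\<close>

section \<open>Partitions as matrices\<close>

text \<open>Two colours suffice because the sets that are unions of parts already separate the
  parts. The counting takes place in the natural numbers, so the exponent of 2 can be recovered
  whatever the characteristic of k and the values Q_t are. The scalars enter only afterwards: the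
  loop numbers satisfy an additive cocycle identity, and taking powers of Q_t and multiplying over t
  turns it into what associativity of the twisted product requires. A direct argument would have to
  compare two iterated closures, one for each bracketing, and to keep track of components that
  disappear at different stages. Tuples are treated componentwise. Refinement becomes inclusion of
  relations, so the compatibility of a tuple with the order on T is preserved as soon as each
  operation is monotone. Invertibility of the product of the Q_t makes e^T and the idempotent u
  scalar multiples of each other. Hence P e^T = P u and e^T P e^T = u P u, and the statement about
  functors can be proved for an arbitrary ring with an idempotent whose corner is a copy of a second
  ring.\<close>

lemma equiv_equiv_gen:
  assumes "r \<subseteq> B \<times> B"
  shows "equiv B (equiv_gen B r)"
proof (rule equivI)
  have *: "equiv B (B \<times> B)"
    by (auto simp: equiv_def refl_on_def sym_def trans_def)
  show "equiv_gen B r \<subseteq> B \<times> B"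
    using * assms unfolding equiv_gen_def by blast
  show "refl_on B (equiv_gen B r)"
    unfolding equiv_gen_def refl_on_def by (auto simp: equiv_def refl_on_def)
  show "sym (equiv_gen B r)"
    unfolding equiv_gen_def sym_def by (auto simp: equiv_def sym_def)
  show "trans (equiv_gen B r)"
    unfolding equiv_gen_def equiv_def by (auto intro!: transI elim: transE)
qed

lemma equiv_gen_superset: "r \<subseteq> equiv_gen B r"
  unfolding equiv_gen_def by blast

lemma equiv_gen_least: "equiv B q \<Longrightarrow> r \<subseteq> q \<Longrightarrow> equiv_gen B r \<subseteq> q"
  unfolding equiv_gen_def by blast

text \<open>If \<open>W\<close> is closed under the symmetric relation \<open>r\<close>, then lying
  on the same side of \<open>W\<close> is an equivalence relation containing \<open>r\<close>, hence
  containing its closure. Saturation can therefore be tested on generators, which lets a colouring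
  of a glued diagram split into colourings of its two factors.\<close>

lemma equiv_gen_saturated_iff:
  assumes "r \<subseteq> B \<times> B" "sym r" "W \<subseteq> B"
  shows "equiv_gen B r `` W \<subseteq> W \<longleftrightarrow> r `` W \<subseteq> W"
proof
  assume "r `` W \<subseteq> W"
  define q where "q = {(x, y). x \<in> B \<and> y \<in> B \<and> (x \<in> W \<longleftrightarrow> y \<in> W)}"
  have "equiv B q"
    by (auto simp: q_def equiv_def refl_on_def sym_def trans_def)
  moreover have "r \<subseteq> q"
    using assms \<open>r `` W \<subseteq> W\<close> unfolding q_def sym_def by blast
  ultimately have "equiv_gen B r \<subseteq> q"
    by (rule equiv_gen_least)
  then show "equiv_gen B r `` W \<subseteq> W"
    by (auto simp: q_def)
qed (use equiv_gen_superset[of r B] in blast)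

lemma equiv_restrict:
  assumes "equiv A r" "B \<subseteq> A"
  shows "equiv B (r \<inter> B \<times> B)"
  using assms unfolding equiv_def refl_on_def sym_def trans_def by blast

lemma sym_map_prod: "sym r \<Longrightarrow> sym (map_prod h h ` r)"
  unfolding sym_def by force

lemma Image_map_prod:
  assumes "inj_on h A" "r \<subseteq> A \<times> A" "Z \<subseteq> A"
  shows "(map_prod h h ` r) `` (h ` Z) = h ` (r `` Z)"
proof (intro equalityI subsetI)
  fix y assume "y \<in> (map_prod h h ` r) `` (h ` Z)"
  then obtain z p q where "z \<in> Z" "(p, q) \<in> r" "h p = h z" "y = h q"
    by auto
  moreover from this have "p = z"
    using assms by (meson inj_onD mem_Sigma_iff subsetD)
  ultimately show "y \<in> h ` (r `` Z)"
    by blast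
next
  fix y assume "y \<in> h ` (r `` Z)"
  then obtain p q where "p \<in> Z" "(p, q) \<in> r" "y = h q"
    by blast
  then show "y \<in> (map_prod h h ` r) `` (h ` Z)"
    by (intro ImageI[of "h p"]) (auto intro: rev_image_eqI)
qed

lemma equiv_map_prod:
  assumes "equiv A r" "inj_on h A"
  shows "equiv (h ` A) (map_prod h h ` r)"
proof (rule equivI)
  have r: "r \<subseteq> A \<times> A"
    using assms by (auto simp: equiv_def)
  then show "map_prod h h ` r \<subseteq> h ` A \<times> h ` A"
    by auto
  show "refl_on (h ` A) (map_prod h h ` r)"
    using assms by (force simp: equiv_def refl_on_def)
  show "sym (map_prod h h ` r)"
    using assms(1) by (simp add: equiv_def sym_map_prod)
  show "trans (map_prod h h ` r)"
  proof (rule transI)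
    fix x y z
    assume "(x, y) \<in> map_prod h h ` r" "(y, z) \<in> map_prod h h ` r"
    then obtain a b c d where "(a, b) \<in> r" "(c, d) \<in> r" "x = h a" "y = h b" "y = h c" "z = h d"
      by auto
    moreover from this have "b = c"
      using assms(2) r by (metis inj_onD mem_Sigma_iff subsetD)
    ultimately show "(x, z) \<in> map_prod h h ` r"
      using assms(1) by (auto simp: equiv_def elim: transE)
  qed
qed

text \<open>The classes meeting \<open>V\<close> are decided by \<open>Y\<close>, while every class
  avoiding \<open>V\<close> may be included or left out freely; this gives one factor 2 for each of
  the latter. The last assumption says that \<open>Y\<close> is saturated as far as \<open>V\<close>
  can see. In the application \<open>V\<close> consists of the two outer rows, and the free classes
  are the loops.\<close>

lemma card_saturated_extensions:
  assumes "equiv U E" "finite U" "V \<subseteq> U" "Y \<subseteq> V" "E `` Y \<inter> V \<subseteq> Y"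
  shows "card {G. G \<subseteq> U - V \<and> E `` (Y \<union> G) \<subseteq> Y \<union> G} = 2 ^ card {C \<in> U // E. C \<subseteq> U - V}"
proof -
  define L where "L = {C \<in> U // E. C \<subseteq> U - V}"
  define Z where "Z = E `` Y"
  have E: "E \<subseteq> U \<times> U" "\<And>x. x \<in> U \<Longrightarrow> (x, x) \<in> E" "\<And>x y. (x, y) \<in> E \<Longrightarrow> (y, x) \<in> E"
    "\<And>x y z. (x, y) \<in> E \<Longrightarrow> (y, z) \<in> E \<Longrightarrow> (x, z) \<in> E"
    using assms(1) unfolding equiv_def
    by (simp_all add: refl_on_def) (meson symD, meson transD)
  have L_class: "C = E `` {x}" if "C \<in> L" "x \<in> C" for C x
  proof -
    obtain y where "C = E `` {y}"
      using \<open>C \<in> L\<close> unfolding L_def by (blast elim: quotientE)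
    then show ?thesis
      using equiv_class_eq[OF assms(1), of y x] \<open>x \<in> C\<close> by simp
  qed
  have Z_V: "Z \<inter> V = Y"
    using assms(3-5) E(2) unfolding Z_def by blast
  have L_Z: "C \<inter> Z = {}" if "C \<in> L" for C
  proof (rule ccontr)
    assume "C \<inter> Z \<noteq> {}"
    then obtain y z where "y \<in> Y" "(y, z) \<in> E" "z \<in> C"
      unfolding Z_def by blast
    then have "y \<in> C"
      using L_class[OF that] E(3) by blast
    then show False
      using that \<open>y \<in> Y\<close> assms(4) unfolding L_def by blast
  qed
  \<comment> \<open>\<open>Z - Y\<close> is the forced part of an extension, and \<open>S\<close> is
    the set of free classes chosen in addition.\<close>
  define \<Phi> where "\<Phi> = (\<lambda>S. (Z - Y) \<union> \<Union>S)"
  have "bij_betw \<Phi> (Pow L) {G. G \<subseteq> U - V \<and> E `` (Y \<union> G) \<subseteq> Y \<union> G}"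
  proof (rule bij_betw_imageI)
    show "inj_on \<Phi> (Pow L)"
    proof (rule inj_onI)
      \<comment> \<open>The choice \<open>S\<close> is read off from \<open>\<Phi> S\<close> as the
        set of free classes inside it: such a class is nonempty and misses \<open>Z\<close>, and two
        classes with a common point coincide.\<close>
      have *: "S = {C \<in> L. C \<subseteq> \<Phi> S}" if "S \<subseteq> L" for S
      proof
        show "{C \<in> L. C \<subseteq> \<Phi> S} \<subseteq> S"
        proof
          fix C assume C: "C \<in> {C \<in> L. C \<subseteq> \<Phi> S}"
          then have "C \<noteq> {}"
            using in_quotient_imp_non_empty[OF assms(1)] unfolding L_def by blast
          then obtain x where "x \<in> C"
            by blast
          moreover have "x \<notin> Z"
            using C \<open>x \<in> C\<close> L_Z by blast
          ultimately obtain D where D: "D \<in> S" "x \<in> D"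
            using C unfolding \<Phi>_def by blast
          then have "D = C"
            using L_class[of D x] L_class[of C x] that C \<open>x \<in> C\<close> by auto
          then show "C \<in> S"
            using D by simp
        qed
      qed (use that in \<open>auto simp: \<Phi>_def\<close>)
      fix S S' assume "S \<in> Pow L" "S' \<in> Pow L" "\<Phi> S = \<Phi> S'"
      then show "S = S'"
        using *[of S] *[of S'] by auto
    qed
    show "\<Phi> ` Pow L = {G. G \<subseteq> U - V \<and> E `` (Y \<union> G) \<subseteq> Y \<union> G}"
    proof (intro equalityI subsetI)
      fix G assume "G \<in> \<Phi> ` Pow L"
      then obtain S where S: "S \<subseteq> L" "G = \<Phi> S"
        by blast
      have "G \<subseteq> U - V"
        using S E(1) Z_V unfolding \<Phi>_def L_def Z_def by blast
      moreover have "E `` \<Union>S \<subseteq> \<Union>S"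
        using S(1) L_class by blast
      moreover have "E `` Z \<subseteq> Z"
        using E(4) unfolding Z_def by blast
      moreover have "Y \<union> G = Z \<union> \<Union>S"
        using S Z_V unfolding \<Phi>_def by blast
      ultimately show "G \<in> {G. G \<subseteq> U - V \<and> E `` (Y \<union> G) \<subseteq> Y \<union> G}"
        by auto
    next
      fix G assume "G \<in> {G. G \<subseteq> U - V \<and> E `` (Y \<union> G) \<subseteq> Y \<union> G}"
      then have G: "G \<subseteq> U - V" "E `` (Y \<union> G) \<subseteq> Y \<union> G"
        by auto
      define S where "S = {C \<in> L. C \<subseteq> G}"
      \<comment> \<open>A class through a point of \<open>G\<close> either avoids \<open>V\<close>,
        and is then one of the free classes, or meets \<open>V\<close>. In the latter case the
        meeting point lies in \<open>Y\<close>, because \<open>Y \<union> G\<close> is closed and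
        \<open>G\<close> misses \<open>V\<close>, so \<open>x\<close> is forced.\<close>
      have "x \<in> \<Phi> S" if "x \<in> G" for x
      proof (cases "E `` {x} \<subseteq> U - V")
        case True
        then have "E `` {x} \<in> S"
          using that G assms(4) unfolding S_def L_def by (auto intro: quotientI)
        then show ?thesis
          using that G(1) E(2) unfolding \<Phi>_def by blast
      next
        case False
        then obtain y where y: "(x, y) \<in> E" "y \<in> V"
          using E(1) by blast
        then have "y \<in> Y"
          using G that by blast
        then have "x \<in> Z"
          using y E(3) unfolding Z_def by blast
        then show ?thesis
          using that G(1) assms(4) unfolding \<Phi>_def by blast
      qed
      moreover have "\<Phi> S \<subseteq> G"
        using G unfolding \<Phi>_def S_def Z_def by blast
      ultimately have "G = \<Phi> S"
        by blast
      then show "G \<in> \<Phi> ` Pow L"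
        unfolding S_def by blast
    qed
  qed
  moreover have "finite L"
    using assms(1,2) E(1) unfolding L_def by (simp add: finite_quotient)
  ultimately show ?thesis
    by (simp add: bij_betw_same_card[symmetric] card_Pow flip: L_def)
qed

text \<open>A colouring is given by the sets \<open>f\<close> and \<open>g\<close> of points of the
  first colour in the two rows. Closure of this set under \<open>a\<close> is the same as being
  constant on the parts, since the relations considered are symmetric.\<close>

definition part_compat :: "prel \<Rightarrow> nat set \<Rightarrow> nat set \<Rightarrow> bool" where
  "part_compat a f g \<longleftrightarrow> a `` (f \<times> {0} \<union> g \<times> {1}) \<subseteq> f \<times> {0} \<union> g \<times> {1}"

text \<open>This is the classical action of the partition algebra with parameter 2 on a tensor power
  of a two-dimensional space, in the basis indexed by subsets. Matrices of distinct partitions may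
  be linearly dependent, but only matrices of single partitions, up to powers of 2, are ever
  compared.\<close>

definition part_mat :: "prel \<Rightarrow> nat set \<Rightarrow> nat set \<Rightarrow> nat" where
  "part_mat a f g = of_bool (part_compat a f g)"

lemma parts_subset: "a \<in> parts n \<Longrightarrow> a \<subseteq> ({1..n} \<times> {0, 1}) \<times> ({1..n} \<times> {0, 1})"
  by (auto simp: parts_def equiv_def)

lemma finite_parts: "finite (parts n)"
  by (rule finite_subset[of _ "Pow (({1..n} \<times> {0, 1}) \<times> ({1..n} \<times> {0, 1}))"])
     (use parts_subset in blast, simp)

lemma part_compat_empty: "part_compat a {} {}"
  by (simp add: part_compat_def)

lemma part_mat_empty [simp]: "part_mat a {} {} = 1"
  by (simp add: part_mat_def part_compat_empty)

text \<open>A coarser partition has fewer compatible colourings. Conversely, colour the class of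
  \<open>x\<close> under \<open>b\<close>: this is compatible with \<open>b\<close>, hence with
  \<open>a\<close>, so the class contains every point that \<open>a\<close> relates to
  \<open>x\<close>.\<close>

lemma parts_subset_iff_compat:
  assumes "a \<in> parts n" "b \<in> parts n"
  shows "a \<subseteq> b \<longleftrightarrow> (\<forall>f\<subseteq>{1..n}. \<forall>g\<subseteq>{1..n}. part_compat b f g \<longrightarrow> part_compat a f g)"
proof
  assume "a \<subseteq> b"
  then show "\<forall>f\<subseteq>{1..n}. \<forall>g\<subseteq>{1..n}. part_compat b f g \<longrightarrow> part_compat a f g"
    unfolding part_compat_def by blast
next
  assume *: "\<forall>f\<subseteq>{1..n}. \<forall>g\<subseteq>{1..n}. part_compat b f g \<longrightarrow> part_compat a f g"
  have b: "equiv ({1..n} \<times> {0, 1}) b"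
    using assms(2) by (simp add: parts_def)
  show "a \<subseteq> b"
  proof
    fix p assume "p \<in> a"
    then obtain x y where p: "p = (x, y)" "(x, y) \<in> a"
      by (cases p) auto
    define f where "f = {i. (i, 0) \<in> b `` {x}}"
    define g where "g = {i. (i, 1) \<in> b `` {x}}"
    have W: "f \<times> {0} \<union> g \<times> {1} = b `` {x}"
      using parts_subset[OF assms(2)] by (auto simp: f_def g_def)
    have "b `` (b `` {x}) \<subseteq> b `` {x}"
      using b by (auto simp: equiv_def elim: transE)
    then have "part_compat b f g"
      by (simp only: part_compat_def W)
    moreover have "f \<subseteq> {1..n}" "g \<subseteq> {1..n}"
      using parts_subset[OF assms(2)] by (auto simp: f_def g_def)
    ultimately have "part_compat a f g"
      using * by simp
    then have "a `` (b `` {x}) \<subseteq> b `` {x}"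
      by (simp only: part_compat_def W)
    moreover have "x \<in> b `` {x}"
      using b p parts_subset[OF assms(1)] by (auto simp: equiv_def refl_on_def)
    ultimately show "p \<in> b"
      using p by blast
  qed
qed

lemma parts_eqI_mat:
  assumes "a \<in> parts n" "b \<in> parts n" "\<And>f g. f \<subseteq> {1..n} \<Longrightarrow> g \<subseteq> {1..n} \<Longrightarrow> part_mat a f g = part_mat b f g"
  shows "a = b"
  using assms parts_subset_iff_compat[OF assms(1,2)] parts_subset_iff_compat[OF assms(2,1)]
  by (auto simp: part_mat_def of_bool_eq_iff)

text \<open>A block of \<open>b\<close> through \<open>x\<close> is a union of blocks of
  \<open>a\<close>, one of which contains \<open>x\<close> and therefore everything
  \<open>a\<close>-related to \<open>x\<close>. With inclusion in place of blocks, preservation of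
  refinement becomes monotonicity.\<close>

lemma refinement_of_iff:
  assumes "a \<in> parts n" "b \<in> parts n"
  shows "refinement_of n a b \<longleftrightarrow> a \<subseteq> b"
proof
  assume r: "refinement_of n a b"
  have a: "equiv ({1..n} \<times> {0, 1}) a" and b: "equiv ({1..n} \<times> {0, 1}) b"
    using assms by (simp_all add: parts_def)
  show "a \<subseteq> b"
  proof
    fix p assume "p \<in> a"
    then obtain x y where p: "p = (x, y)" "(x, y) \<in> a"
      by (cases p) auto
    then have x: "x \<in> {1..n} \<times> {0, 1}"
      using parts_subset[OF assms(1)] by blast
    obtain Y where Y: "Y \<subseteq> ({1..n} \<times> {0, 1}) // a" "b `` {x} = \<Union>Y"
      using r x unfolding refinement_of_def by (meson quotientI)
    have "x \<in> b `` {x}"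
      using x b by (auto simp: equiv_def refl_on_def)
    then obtain D where D: "D \<in> Y" "x \<in> D"
      using Y by blast
    then have "y \<in> D"
      using Y(1) p a by (meson in_mono in_quotient_imp_closed)
    then show "p \<in> b"
      using Y D p by blast
  qed
next
  assume ab: "a \<subseteq> b"
  have a: "equiv ({1..n} \<times> {0, 1}) a" and b: "equiv ({1..n} \<times> {0, 1}) b"
    using assms by (simp_all add: parts_def)
  show "refinement_of n a b"
    unfolding refinement_of_def
  proof
    fix B assume B: "B \<in> ({1..n} \<times> {0, 1}) // b"
    have BX: "B \<subseteq> {1..n} \<times> {0, 1}"
      using b B by (rule in_quotient_imp_subset)
    have "B = \<Union>((\<lambda>x. a `` {x}) ` B)"
    proof
      show "B \<subseteq> \<Union>((\<lambda>x. a `` {x}) ` B)"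
        using BX a unfolding equiv_def refl_on_def by blast
      show "\<Union>((\<lambda>x. a `` {x}) ` B) \<subseteq> B"
        using in_quotient_imp_closed[OF b B] ab by blast
    qed
    moreover have "(\<lambda>x. a `` {x}) ` B \<subseteq> ({1..n} \<times> {0, 1}) // a"
      using BX by (auto intro: quotientI)
    ultimately show "\<exists>Y \<subseteq> ({1..n} \<times> {0, 1}) // a. B = \<Union>Y"
      by blast
  qed
qed

section \<open>Gluing two partitions and counting the colourings of the middle row\<close>

context
  fixes n :: nat and a b :: prel
  assumes a: "a \<in> parts n" and b: "b \<in> parts n"
begin

lemma glue_generators: "a \<union> shift_up b \<subseteq> ({1..n} \<times> {0, 1, 2}) \<times> ({1..n} \<times> {0, 1, 2})"
proof -
  have "shift_up b \<subseteq> ({1..n} \<times> {0, 1, 2}) \<times> ({1..n} \<times> {0, 1, 2})"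
    using parts_subset[OF b] by (auto simp: shift_up_def)
  then show ?thesis
    using parts_subset[OF a] by blast
qed

lemma equiv_glue: "equiv ({1..n} \<times> {0, 1, 2}) (glue n a b)"
  unfolding glue_def using glue_generators by (rule equiv_equiv_gen)

lemma part_comp_in_parts: "part_comp n a b \<in> parts n"
proof -
  let ?h = "\<lambda>(i::nat, s::nat). (i, if s = 2 then 1 else s)"
  have "equiv ({1..n} \<times> {0, 2}) (glue n a b \<inter> ({1..n} \<times> {0, 2}) \<times> ({1..n} \<times> {0, 2}))"
    by (rule equiv_restrict[OF equiv_glue]) auto
  then have "equiv (?h ` ({1..n} \<times> {0, 2})) (part_comp n a b)"
    unfolding part_comp_def Let_def by (rule equiv_map_prod) (auto simp: inj_on_def)
  moreover have "?h ` ({1..n} \<times> {0, 2}) = {1..n} \<times> {0, 1}"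
  proof
    show "{1..n} \<times> {0, 1} \<subseteq> ?h ` ({1..n} \<times> {0, 2})"
    proof
      fix p assume "p \<in> {1..n} \<times> {0, 1::nat}"
      then show "p \<in> ?h ` ({1..n} \<times> {0, 2})"
        \<comment> \<open>Collapsing fixes row 0 and sends row 2 to row 1, so a point in row s comes
          from row 2 s.\<close>
        by (intro image_eqI[of _ _ "(fst p, 2 * snd p)"]) auto
    qed
  qed auto
  ultimately show ?thesis
    by (simp add: parts_def)
qed

text \<open>By \<open>equiv_gen_saturated_iff\<close> only generators matter: \<open>a\<close> sees
  rows 0 and 1, and the shifted \<open>b\<close> sees rows 1 and 2. The outer rows stand first in
  the union so that it has the shape of an extension of the outer colouring by a colouring of the
  middle row.\<close>

lemma glue_saturated_iff:
  assumes "f \<subseteq> {1..n}" "g \<subseteq> {1..n}" "h \<subseteq> {1..n}"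
  shows "glue n a b `` (f \<times> {0} \<union> h \<times> {2} \<union> g \<times> {1}) \<subseteq> f \<times> {0} \<union> h \<times> {2} \<union> g \<times> {1}
    \<longleftrightarrow> part_compat a f g \<and> part_compat b g h"
  (is "glue n a b `` ?W \<subseteq> ?W \<longleftrightarrow> _")
proof -
  have "sym a" "sym b"
    using a b by (auto simp: parts_def equiv_def)
  from this(2) have "sym (shift_up b)"
    unfolding shift_up_def by (rule sym_map_prod)
  with \<open>sym a\<close> have "sym (a \<union> shift_up b)"
    by (rule sym_Un)
  then have "glue n a b `` ?W \<subseteq> ?W \<longleftrightarrow> (a \<union> shift_up b) `` ?W \<subseteq> ?W"
    unfolding glue_def by (intro equiv_gen_saturated_iff glue_generators) (use assms in auto)
  moreover have "a `` ?W \<subseteq> ?W \<longleftrightarrow> part_compat a f g"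
  proof -
    define V where "V = {1..n} \<times> {0, 1::nat}"
    have "a \<subseteq> V \<times> V"
      using parts_subset[OF a] by (simp add: V_def)
    moreover have "?W \<inter> V = f \<times> {0} \<union> g \<times> {1}"
      using assms by (auto simp: V_def)
    ultimately show ?thesis
      unfolding part_compat_def by blast
  qed
  moreover have "shift_up b `` ?W \<subseteq> ?W \<longleftrightarrow> part_compat b g h"
  proof -
    define \<sigma> where "\<sigma> = (\<lambda>(i::nat, s). (i, Suc s))"
    have inj: "inj \<sigma>"
      by (auto simp: \<sigma>_def inj_on_def)
    have W: "?W = \<sigma> ` (g \<times> {0} \<union> h \<times> {1}) \<union> f \<times> {0}"
    proof -
      have "\<sigma> ` (g \<times> {0}) = g \<times> {1}" "\<sigma> ` (h \<times> {1}) = h \<times> {2}"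
        by (force simp: \<sigma>_def)+
      then show ?thesis
        by (simp only: image_Un) blast
    qed
    have sb: "shift_up b = map_prod \<sigma> \<sigma> ` b"
      by (simp add: shift_up_def \<sigma>_def)
    have 1: "shift_up b `` (\<sigma> ` Z) = \<sigma> ` (b `` Z)" for Z
      unfolding sb using inj by (rule Image_map_prod) auto
    have 2: "shift_up b `` (f \<times> {0}) = {}"
      unfolding shift_up_def by auto
    have 3: "\<sigma> ` S \<subseteq> \<sigma> ` (g \<times> {0} \<union> h \<times> {1}) \<union> f \<times> {0} \<longleftrightarrow> S \<subseteq> g \<times> {0} \<union> h \<times> {1}" for S
    proof -
      have "\<sigma> ` S \<inter> f \<times> {0} = {}"
        by (auto simp: \<sigma>_def)
      then show ?thesis
        using inj_image_subset_iff[OF inj] by blast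
    qed
    show ?thesis
      unfolding part_compat_def W Image_Un 1 2 using 3 by (simp add: Image_Un image_Un)
  qed
  ultimately show ?thesis
    by (simp only: Un_Image Un_subset_iff)
qed

text \<open>The composite is the glued relation on the outer rows, transported by a map that is
  injective there. The right-hand side is the partial saturation required by
  \<open>card_saturated_extensions\<close>.\<close>

lemma part_compat_part_comp:
  assumes "f \<subseteq> {1..n}" "h \<subseteq> {1..n}"
  shows "part_compat (part_comp n a b) f h \<longleftrightarrow>
    glue n a b `` (f \<times> {0} \<union> h \<times> {2}) \<inter> {1..n} \<times> {0, 2} \<subseteq> f \<times> {0} \<union> h \<times> {2}"
proof -
  define \<sigma> where "\<sigma> = (\<lambda>(i::nat, s::nat). (i, if s = 2 then 1 else s))"
  let ?V = "{1..n} \<times> {0, 2::nat}" and ?Y = "f \<times> {0} \<union> h \<times> {2}"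
  let ?r = "glue n a b \<inter> ?V \<times> ?V"
  have inj: "inj_on \<sigma> ?V"
    by (auto simp: inj_on_def \<sigma>_def)
  have Y: "?Y \<subseteq> ?V"
    using assms by auto
  have "f \<times> {0} \<union> h \<times> {1} = \<sigma> ` ?Y"
    by (force simp: \<sigma>_def)
  moreover have "part_comp n a b = map_prod \<sigma> \<sigma> ` ?r"
    by (simp add: part_comp_def \<sigma>_def Let_def)
  ultimately have "part_compat (part_comp n a b) f h \<longleftrightarrow> (map_prod \<sigma> \<sigma> ` ?r) `` (\<sigma> ` ?Y) \<subseteq> \<sigma> ` ?Y"
    by (simp add: part_compat_def)
  also have "(map_prod \<sigma> \<sigma> ` ?r) `` (\<sigma> ` ?Y) = \<sigma> ` (?r `` ?Y)"
    by (rule Image_map_prod[OF inj]) (use Y in auto)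
  also have "\<sigma> ` (?r `` ?Y) \<subseteq> \<sigma> ` ?Y \<longleftrightarrow> ?r `` ?Y \<subseteq> ?Y"
    using inj_on_image_mem_iff[OF inj, of _ "?Y"] Y by blast
  also have "?r `` ?Y = glue n a b `` ?Y \<inter> ?V"
    using Y by blast
  finally show ?thesis .
qed

text \<open>If the outer colouring is compatible with the composite, the count of saturated
  extensions applies, and the classes inside the middle row are the loops. Otherwise some glued
  class contains outer points of both colours, and no colouring of the middle row can repair
  this.\<close>

lemma card_compat:
  assumes "f \<subseteq> {1..n}" "h \<subseteq> {1..n}"
  shows "card {g. g \<subseteq> {1..n} \<and> part_compat a f g \<and> part_compat b g h} =
    (if part_compat (part_comp n a b) f h then 2 ^ loops n a b else 0)"
proof -
  let ?U = "{1..n} \<times> {0, 1, 2::nat}" and ?V = "{1..n} \<times> {0, 2::nat}"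
  let ?Y = "f \<times> {0} \<union> h \<times> {2}" and ?E = "glue n a b"
  have Y: "?Y \<subseteq> ?V" and UV: "?U - ?V = {1..n} \<times> {1}"
    using assms by auto
  define A where "A = {g. g \<subseteq> {1..n} \<and> part_compat a f g \<and> part_compat b g h}"
  have A: "A = {g. g \<subseteq> {1..n} \<and> ?E `` (?Y \<union> g \<times> {1}) \<subseteq> ?Y \<union> g \<times> {1}}"
    unfolding A_def using glue_saturated_iff[OF assms(1) _ assms(2)] by blast
  show ?thesis
  proof (cases "part_compat (part_comp n a b) f h")
    case True
    then have "?E `` ?Y \<inter> ?V \<subseteq> ?Y"
      using part_compat_part_comp[OF assms] by blast
    then have "card {G. G \<subseteq> ?U - ?V \<and> ?E `` (?Y \<union> G) \<subseteq> ?Y \<union> G} =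
        2 ^ card {C \<in> ?U // ?E. C \<subseteq> ?U - ?V}"
      by (intro card_saturated_extensions equiv_glue Y) auto
    also have "\<dots> = 2 ^ loops n a b"
      unfolding UV loops_def ..
    also have "{G. G \<subseteq> ?U - ?V \<and> ?E `` (?Y \<union> G) \<subseteq> ?Y \<union> G} = (\<lambda>g. g \<times> {1}) ` A"
    proof (intro equalityI subsetI)
      fix G assume "G \<in> {G. G \<subseteq> ?U - ?V \<and> ?E `` (?Y \<union> G) \<subseteq> ?Y \<union> G}"
      then have G: "G \<subseteq> {1..n} \<times> {1}" "?E `` (?Y \<union> G) \<subseteq> ?Y \<union> G"
        unfolding UV by auto
      then have "G = (fst ` G) \<times> {1}"
        by force
      moreover have "fst ` G \<subseteq> {1..n}"
        using G(1) by auto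
      ultimately show "G \<in> (\<lambda>g. g \<times> {1}) ` A"
        using G(2) unfolding A by blast
    next
      fix G assume "G \<in> (\<lambda>g. g \<times> {1::nat}) ` A"
      then show "G \<in> {G. G \<subseteq> ?U - ?V \<and> ?E `` (?Y \<union> G) \<subseteq> ?Y \<union> G}"
        unfolding UV A by auto
    qed
    also have "card ((\<lambda>g. g \<times> {1::nat}) ` A) = card A"
      by (rule card_image) (auto simp: inj_on_def)
    finally show ?thesis
      using True by (simp add: A_def)
  next
    case False
    then obtain x y where xy: "x \<in> ?Y" "(x, y) \<in> ?E" "y \<in> ?V" "y \<notin> ?Y"
      using part_compat_part_comp[OF assms] by blast
    have "A = {}"
    proof (rule ccontr)
      assume "A \<noteq> {}"
      then obtain g where g: "?E `` (?Y \<union> g \<times> {1}) \<subseteq> ?Y \<union> g \<times> {1}"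
        unfolding A by blast
      have "y \<in> ?Y \<union> g \<times> {1}"
        using g xy by blast
      then show False
        using xy by auto
    qed
    then show ?thesis
      using False by (simp add: A_def)
  qed
qed

lemma sum_mat_mult:
  assumes "f \<subseteq> {1..n}" "h \<subseteq> {1..n}"
  shows "(\<Sum>g\<in>Pow {1..n}. part_mat a f g * part_mat b g h) = 2 ^ loops n a b * part_mat (part_comp n a b) f h"
proof -
  have "(\<Sum>g\<in>Pow {1..n}. part_mat a f g * part_mat b g h)
      = (\<Sum>g\<in>Pow {1..n}. if part_compat a f g \<and> part_compat b g h then 1 else 0)"
    by (intro sum.cong refl) (simp add: part_mat_def)
  also have "\<dots> = (\<Sum>g\<in>{g \<in> Pow {1..n}. part_compat a f g \<and> part_compat b g h}. 1)"
    by (rule sum.inter_filter[symmetric]) simp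
  also have "\<dots> = card {g. g \<subseteq> {1..n} \<and> part_compat a f g \<and> part_compat b g h}"
    by simp
  finally show ?thesis
    using card_compat[OF assms] by (simp add: part_mat_def)
qed

lemma part_comp_eqI:
  assumes "c \<in> parts n"
    and "\<And>f h. f \<subseteq> {1..n} \<Longrightarrow> h \<subseteq> {1..n} \<Longrightarrow>
      (\<Sum>g\<in>Pow {1..n}. part_mat a f g * part_mat b g h) = 2 ^ l * part_mat c f h"
  shows "loops n a b = l" and "part_comp n a b = c"
proof -
  show l: "loops n a b = l"
    using assms(2)[of "{}" "{}"] sum_mat_mult[of "{}" "{}"] by simp
  show "part_comp n a b = c"
    by (rule parts_eqI_mat[OF part_comp_in_parts assms(1)])
       (use assms(2) sum_mat_mult l in auto)
qed

end

text \<open>More generators give a larger closure. This is what makes the componentwise product of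
  two tuples a tuple again.\<close>

lemma part_comp_mono:
  assumes "a \<in> parts n" "b \<in> parts n" "a' \<in> parts n" "b' \<in> parts n" "a \<subseteq> a'" "b \<subseteq> b'"
  shows "part_comp n a b \<subseteq> part_comp n a' b'"
proof -
  have "glue n a b \<subseteq> glue n a' b'"
    unfolding glue_def
  proof (rule equiv_gen_least)
    show "equiv ({1..n} \<times> {0, 1, 2}) (equiv_gen ({1..n} \<times> {0, 1, 2}) (a' \<union> shift_up b'))"
      using equiv_glue[OF assms(3,4)] unfolding glue_def .
    have "shift_up b \<subseteq> shift_up b'"
      unfolding shift_up_def using assms(6) by (rule image_mono)
    with assms(5) have "a \<union> shift_up b \<subseteq> a' \<union> shift_up b'"
      by blast
    then show "a \<union> shift_up b \<subseteq> equiv_gen ({1..n} \<times> {0, 1, 2}) (a' \<union> shift_up b')"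
      using equiv_gen_superset by (rule order_trans)
  qed
  then show ?thesis
    unfolding part_comp_def Let_def by blast
qed

text \<open>Both bracketings evaluate the same double sum over the two middle rows. They remove
  loops at different stages, so that only the total numbers agree; the empty colouring yields this
  total, and cancelling the power of 2 then identifies the partitions.\<close>

lemma
  assumes a: "a \<in> parts n" and b: "b \<in> parts n" and c: "c \<in> parts n"
  shows loops_cocycle: "loops n a b + loops n (part_comp n a b) c = loops n b c + loops n a (part_comp n b c)"
    and part_comp_assoc: "part_comp n (part_comp n a b) c = part_comp n a (part_comp n b c)"
proof -
  let ?P = "Pow {1..n}"
  have *: "2 ^ (loops n a b + loops n (part_comp n a b) c) * part_mat (part_comp n (part_comp n a b) c) f k
      = 2 ^ (loops n b c + loops n a (part_comp n b c)) * part_mat (part_comp n a (part_comp n b c)) f k"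
    if f: "f \<subseteq> {1..n}" and k: "k \<subseteq> {1..n}" for f k
  proof -
    have "2 ^ (loops n a b + loops n (part_comp n a b) c) * part_mat (part_comp n (part_comp n a b) c) f k
        = 2 ^ loops n a b * (\<Sum>h\<in>?P. part_mat (part_comp n a b) f h * part_mat c h k)"
      by (simp add: sum_mat_mult part_comp_in_parts assms f k power_add del: One_nat_def)
    also have "\<dots> = (\<Sum>h\<in>?P. (2 ^ loops n a b * part_mat (part_comp n a b) f h) * part_mat c h k)"
      by (simp add: sum_distrib_left mult.assoc)
    also have "\<dots> = (\<Sum>h\<in>?P. (\<Sum>g\<in>?P. part_mat a f g * part_mat b g h) * part_mat c h k)"
      by (intro sum.cong refl) (simp add: sum_mat_mult assms f del: One_nat_def)
    also have "\<dots> = (\<Sum>h\<in>?P. \<Sum>g\<in>?P. part_mat a f g * (part_mat b g h * part_mat c h k))"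
      by (simp add: sum_distrib_right mult.assoc)
    also have "\<dots> = (\<Sum>g\<in>?P. \<Sum>h\<in>?P. part_mat a f g * (part_mat b g h * part_mat c h k))"
      by (rule sum.swap)
    also have "\<dots> = (\<Sum>g\<in>?P. part_mat a f g * (\<Sum>h\<in>?P. part_mat b g h * part_mat c h k))"
      by (simp add: sum_distrib_left)
    also have "\<dots> = (\<Sum>g\<in>?P. part_mat a f g * (2 ^ loops n b c * part_mat (part_comp n b c) g k))"
      by (intro sum.cong refl) (simp add: sum_mat_mult assms k del: One_nat_def)
    also have "\<dots> = 2 ^ loops n b c * (\<Sum>g\<in>?P. part_mat a f g * part_mat (part_comp n b c) g k)"
      by (simp add: sum_distrib_left mult.left_commute)
    also have "\<dots> = 2 ^ (loops n b c + loops n a (part_comp n b c)) *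
        part_mat (part_comp n a (part_comp n b c)) f k"
      by (simp add: sum_mat_mult part_comp_in_parts assms f k power_add del: One_nat_def)
    finally show ?thesis .
  qed
  show l: "loops n a b + loops n (part_comp n a b) c = loops n b c + loops n a (part_comp n b c)"
    using *[of "{}" "{}"] by simp
  show "part_comp n (part_comp n a b) c = part_comp n a (part_comp n b c)"
    by (rule parts_eqI_mat[of _ n]) (use * l assms in \<open>auto simp: part_comp_in_parts\<close>)
qed

section \<open>Products with extended and split partitions\<close>

lemma part_one_in_parts: "part_one n \<in> parts n"
  by (auto simp: parts_def part_one_def equiv_def refl_on_def sym_def trans_def)

lemma part_mat_part_one:
  assumes "f \<subseteq> {1..n}" "g \<subseteq> {1..n}"
  shows "part_mat (part_one n) f g = of_bool (f = g)"
proof -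
  have "part_one n `` (f \<times> {0} \<union> g \<times> {1}) = (f \<union> g) \<times> {0, 1}"
    using assms by (fastforce simp: part_one_def)
  then have "part_compat (part_one n) f g \<longleftrightarrow> f = g"
    by (auto simp: part_compat_def)
  then show ?thesis
    by (simp add: part_mat_def)
qed

text \<open>The matrix of \<open>part_one n\<close> is the identity matrix, so each sum collapses to
  one term and no factor 2 appears.\<close>

lemma part_one_comp:
  assumes "a \<in> parts n"
  shows "loops n (part_one n) a = 0" "part_comp n (part_one n) a = a"
    "loops n a (part_one n) = 0" "part_comp n a (part_one n) = a"
proof -
  have *: "(\<Sum>g\<in>Pow {1..n}. part_mat (part_one n) f g * part_mat a g h) = 2 ^ 0 * part_mat a f h"
    if "f \<subseteq> {1..n}" for f h
  proof -
    have "(\<Sum>g\<in>Pow {1..n}. part_mat (part_one n) f g * part_mat a g h)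
        = (\<Sum>g\<in>Pow {1..n}. if f = g then part_mat a g h else 0)"
      using that by (intro sum.cong refl) (simp add: part_mat_part_one)
    then show ?thesis
      using that by simp
  qed
  have **: "(\<Sum>g\<in>Pow {1..n}. part_mat a f g * part_mat (part_one n) g h) = 2 ^ 0 * part_mat a f h"
    if "h \<subseteq> {1..n}" for f h
  proof -
    have "(\<Sum>g\<in>Pow {1..n}. part_mat a f g * part_mat (part_one n) g h)
        = (\<Sum>g\<in>Pow {1..n}. if g = h then part_mat a f g else 0)"
      using that by (intro sum.cong refl) (simp add: part_mat_part_one)
    then show ?thesis
      using that by simp
  qed
  show "loops n (part_one n) a = 0" "part_comp n (part_one n) a = a"
    using part_comp_eqI[OF part_one_in_parts assms assms *] by auto
  show "loops n a (part_one n) = 0" "part_comp n a (part_one n) = a"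
    using part_comp_eqI[OF assms part_one_in_parts assms **] by auto
qed

text \<open>The counterpart of \<open>part_extend\<close>: the two new points become singletons
  instead of a common part. An extended partition turns into the split one on multiplication by
  $A^n$, and $A^n$ itself is the split identity.\<close>

definition part_split :: "nat \<Rightarrow> prel \<Rightarrow> prel" where
  "part_split n a = a \<union> {((n, 0), (n, 0)), ((n, 1), (n, 1))}"

lemma part_A_eq: "part_A (Suc m) = part_split (Suc m) (part_one m)"
  by (simp add: part_A_def part_split_def)

lemma equiv_Un_disjoint:
  assumes "equiv A r" "equiv B s" "A \<inter> B = {}"
  shows "equiv (A \<union> B) (r \<union> s)"
proof (rule equivI)
  have rs: "r \<subseteq> A \<times> A" "s \<subseteq> B \<times> B"
    using assms by (simp_all add: equiv_def)
  then show "r \<union> s \<subseteq> (A \<union> B) \<times> (A \<union> B)"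
    by blast
  show "refl_on (A \<union> B) (r \<union> s)"
    using assms by (auto simp: equiv_def refl_on_def)
  show "sym (r \<union> s)"
    using assms by (simp add: equiv_def sym_Un)
  show "trans (r \<union> s)"
    using rs assms(3) assms(1,2)[unfolded equiv_def] by (intro transI) (blast elim: transE)
qed

lemma points_Suc: "{1..Suc m} \<times> {0, 1} = {1..m} \<times> {0, 1::nat} \<union> {Suc m} \<times> {0, 1}"
  by auto

lemma part_extend_in_parts:
  assumes "a \<in> parts m"
  shows "part_extend (Suc m) a \<in> parts (Suc m)"
  using assms unfolding parts_def part_extend_def mem_Collect_eq points_Suc
  by (intro equiv_Un_disjoint) (auto intro!: equivI refl_onI symI transI)

lemma part_split_in_parts:
  assumes "a \<in> parts m"
  shows "part_split (Suc m) a \<in> parts (Suc m)"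
  using assms unfolding parts_def part_split_def mem_Collect_eq points_Suc
  by (intro equiv_Un_disjoint) (auto intro!: equivI refl_onI symI transI)

text \<open>Old and new points are not related to each other, so compatibility decouples and the
  matrix is a Kronecker product. The 2 by 2 factor of the new points is the identity matrix for
  \<open>part_extend\<close> and the all-ones matrix for \<open>part_split\<close>.\<close>

lemma part_mat_Un_Suc:
  assumes "a \<in> parts m" "s \<subseteq> ({Suc m} \<times> {0, 1}) \<times> ({Suc m} \<times> {0, 1})"
  shows "part_mat (a \<union> s) f g =
    part_mat a (f - {Suc m}) (g - {Suc m}) * of_bool (part_compat s (f \<inter> {Suc m}) (g \<inter> {Suc m}))"
proof -
  define V where "V = {1..m} \<times> {0, 1::nat}"
  define V' where "V' = {Suc m} \<times> {0, 1::nat}"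
  define W where "W = f \<times> {0} \<union> g \<times> {1::nat}"
  have W1: "(f - {Suc m}) \<times> {0} \<union> (g - {Suc m}) \<times> {1} = W - V'"
    by (auto simp: W_def V'_def)
  have W2: "(f \<inter> {Suc m}) \<times> {0} \<union> (g \<inter> {Suc m}) \<times> {1} = W \<inter> V'"
    by (auto simp: W_def V'_def)
  have "V \<inter> V' = {}" "a \<subseteq> V \<times> V" "s \<subseteq> V' \<times> V'"
    using parts_subset[OF assms(1)] assms(2) by (auto simp: V_def V'_def)
  then have "part_compat (a \<union> s) f g \<longleftrightarrow>
      part_compat a (f - {Suc m}) (g - {Suc m}) \<and> part_compat s (f \<inter> {Suc m}) (g \<inter> {Suc m})"
    unfolding part_compat_def W1 W2 unfolding W_def[symmetric] by blast
  then show ?thesis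
    by (simp add: part_mat_def)
qed

lemma part_mat_part_extend:
  assumes "a \<in> parts m"
  shows "part_mat (part_extend (Suc m) a) f g =
    part_mat a (f - {Suc m}) (g - {Suc m}) * of_bool (Suc m \<in> f \<longleftrightarrow> Suc m \<in> g)"
proof -
  have "part_compat (({Suc m} \<times> {0, 1}) \<times> ({Suc m} \<times> {0, 1})) (f \<inter> {Suc m}) (g \<inter> {Suc m})
      \<longleftrightarrow> (Suc m \<in> f \<longleftrightarrow> Suc m \<in> g)"
    by (auto simp: part_compat_def)
  then show ?thesis
    unfolding part_extend_def by (subst part_mat_Un_Suc[OF assms]) simp_all
qed

lemma part_mat_part_split:
  assumes "a \<in> parts m"
  shows "part_mat (part_split (Suc m) a) f g = part_mat a (f - {Suc m}) (g - {Suc m})"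
proof -
  have "part_compat {((Suc m, 0), (Suc m, 0)), ((Suc m, 1), (Suc m, 1))}
      (f \<inter> {Suc m}) (g \<inter> {Suc m})"
    by (auto simp: part_compat_def)
  then show ?thesis
    unfolding part_split_def by (subst part_mat_Un_Suc[OF assms]) auto
qed

text \<open>A subset of the larger set is a subset of the smaller one together with a truth value
  for the new point; \<open>F\<close> is a function of this pair, so that the new coordinate can be
  summed separately.\<close>

lemma sum_Pow_Suc:
  fixes F :: "nat set \<Rightarrow> bool \<Rightarrow> 'a::comm_monoid_add"
  shows "(\<Sum>g\<in>Pow {1..Suc m}. F (g - {Suc m}) (Suc m \<in> g))
    = (\<Sum>g\<in>Pow {1..m}. F g False + F g True)"
proof -
  have Pow: "Pow {1..Suc m} = Pow {1..m} \<union> insert (Suc m) ` Pow {1..m}"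
    by (simp add: atLeastAtMostSuc_conv Pow_insert)
  have nin: "Suc m \<notin> g" if "g \<in> Pow {1..m}" for g
    using that by auto
  have inj: "inj_on (insert (Suc m)) (Pow {1..m})"
  proof (rule inj_onI)
    fix g h assume "g \<in> Pow {1..m}" "h \<in> Pow {1..m}" "insert (Suc m) g = insert (Suc m) h"
    then show "g = h"
      using nin by (metis insert_ident)
  qed
  have "(\<Sum>g\<in>Pow {1..Suc m}. F (g - {Suc m}) (Suc m \<in> g)) =
      (\<Sum>g\<in>Pow {1..m}. F (g - {Suc m}) (Suc m \<in> g)) +
      (\<Sum>g\<in>insert (Suc m) ` Pow {1..m}. F (g - {Suc m}) (Suc m \<in> g))"
    unfolding Pow by (rule sum.union_disjoint) auto
  also have "(\<Sum>g\<in>Pow {1..m}. F (g - {Suc m}) (Suc m \<in> g)) = (\<Sum>g\<in>Pow {1..m}. F g False)"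
    by (intro sum.cong refl) (use nin in auto)
  also have "(\<Sum>g\<in>insert (Suc m) ` Pow {1..m}. F (g - {Suc m}) (Suc m \<in> g)) =
      (\<Sum>g\<in>Pow {1..m}. F g True)"
    unfolding sum.reindex[OF inj] by (intro sum.cong refl) (use nin in auto)
  finally show ?thesis
    by (simp add: sum.distrib)
qed

lemma Diff_Suc_subset: "f \<subseteq> {1..Suc m} \<Longrightarrow> f - {Suc m} \<subseteq> {1..m}"
  by (auto simp: atLeastAtMostSuc_conv)

section \<open>Products of partitions enlarged by one pair of points\<close>

context
  fixes m :: nat and a b :: prel
  assumes a: "a \<in> parts m" and b: "b \<in> parts m"
begin

text \<open>For fixed \<open>f\<close> and \<open>h\<close>, the functions \<open>u\<close> and
  \<open>v\<close> are a row and a column of the 2 by 2 factors belonging to the new points. The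
  last factor is an entry of the product of these two matrices, and it alone distinguishes the four
  cases below.\<close>

lemma sum_mat_mult_Suc:
  assumes "f \<subseteq> {1..Suc m}" "h \<subseteq> {1..Suc m}"
    and "\<And>g. part_mat a' f g = part_mat a (f - {Suc m}) (g - {Suc m}) * u (Suc m \<in> g)"
    and "\<And>g. part_mat b' g h = part_mat b (g - {Suc m}) (h - {Suc m}) * v (Suc m \<in> g)"
  shows "(\<Sum>g\<in>Pow {1..Suc m}. part_mat a' f g * part_mat b' g h) =
    2 ^ loops m a b * part_mat (part_comp m a b) (f - {Suc m}) (h - {Suc m})
      * (u False * v False + u True * v True)"
proof -
  let ?f = "f - {Suc m}" and ?h = "h - {Suc m}"
  have "(\<Sum>g\<in>Pow {1..Suc m}. part_mat a' f g * part_mat b' g h) =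
      (\<Sum>g\<in>Pow {1..Suc m}. (\<lambda>g c. part_mat a ?f g * part_mat b g ?h * (u c * v c)) (g - {Suc m}) (Suc m \<in> g))"
    by (simp add: assms(3,4) ac_simps)
  also have "\<dots> = (\<Sum>g\<in>Pow {1..m}. part_mat a ?f g * part_mat b g ?h * (u False * v False) +
      part_mat a ?f g * part_mat b g ?h * (u True * v True))"
    by (rule sum_Pow_Suc)
  also have "\<dots> = (\<Sum>g\<in>Pow {1..m}. part_mat a ?f g * part_mat b g ?h) *
      (u False * v False + u True * v True)"
    by (simp add: sum_distrib_right sum.distrib distrib_left)
  also have "(\<Sum>g\<in>Pow {1..m}. part_mat a ?f g * part_mat b g ?h) =
      2 ^ loops m a b * part_mat (part_comp m a b) ?f ?h"
    using assms(1,2) by (intro sum_mat_mult a b Diff_Suc_subset)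
  finally show ?thesis .
qed

lemma part_comp_extend_extend:
  "loops (Suc m) (part_extend (Suc m) a) (part_extend (Suc m) b) = loops m a b"
  "part_comp (Suc m) (part_extend (Suc m) a) (part_extend (Suc m) b) =
     part_extend (Suc m) (part_comp m a b)"
proof -
  have *: "(\<Sum>g\<in>Pow {1..Suc m}. part_mat (part_extend (Suc m) a) f g * part_mat (part_extend (Suc m) b) g h)
      = 2 ^ loops m a b * part_mat (part_extend (Suc m) (part_comp m a b)) f h"
    if "f \<subseteq> {1..Suc m}" "h \<subseteq> {1..Suc m}" for f h
    by (subst sum_mat_mult_Suc[OF that, of _ "\<lambda>c. of_bool ((Suc m \<in> f) = c)" _ "\<lambda>c. of_bool (c = (Suc m \<in> h))"])
       (use that in \<open>auto simp: part_mat_part_extend a b part_comp_in_parts\<close>)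
  show "loops (Suc m) (part_extend (Suc m) a) (part_extend (Suc m) b) = loops m a b"
    "part_comp (Suc m) (part_extend (Suc m) a) (part_extend (Suc m) b) =
     part_extend (Suc m) (part_comp m a b)"
    using part_comp_eqI[OF part_extend_in_parts[OF a] part_extend_in_parts[OF b]
        part_extend_in_parts[OF part_comp_in_parts[OF a b]] *] by auto
qed

lemma part_comp_extend_split:
  "loops (Suc m) (part_extend (Suc m) a) (part_split (Suc m) b) = loops m a b"
  "part_comp (Suc m) (part_extend (Suc m) a) (part_split (Suc m) b) =
     part_split (Suc m) (part_comp m a b)"
proof -
  have *: "(\<Sum>g\<in>Pow {1..Suc m}. part_mat (part_extend (Suc m) a) f g * part_mat (part_split (Suc m) b) g h)
      = 2 ^ loops m a b * part_mat (part_split (Suc m) (part_comp m a b)) f h"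
    if "f \<subseteq> {1..Suc m}" "h \<subseteq> {1..Suc m}" for f h
    by (subst sum_mat_mult_Suc[OF that, of _ "\<lambda>c. of_bool ((Suc m \<in> f) = c)" _ "\<lambda>c. 1"])
       (use that in \<open>auto simp: part_mat_part_extend part_mat_part_split a b part_comp_in_parts\<close>)
  show "loops (Suc m) (part_extend (Suc m) a) (part_split (Suc m) b) = loops m a b"
    "part_comp (Suc m) (part_extend (Suc m) a) (part_split (Suc m) b) =
     part_split (Suc m) (part_comp m a b)"
    using part_comp_eqI[OF part_extend_in_parts[OF a] part_split_in_parts[OF b]
        part_split_in_parts[OF part_comp_in_parts[OF a b]] *] by auto
qed

lemma part_comp_split_extend:
  "loops (Suc m) (part_split (Suc m) a) (part_extend (Suc m) b) = loops m a b"
  "part_comp (Suc m) (part_split (Suc m) a) (part_extend (Suc m) b) =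
     part_split (Suc m) (part_comp m a b)"
proof -
  have *: "(\<Sum>g\<in>Pow {1..Suc m}. part_mat (part_split (Suc m) a) f g * part_mat (part_extend (Suc m) b) g h)
      = 2 ^ loops m a b * part_mat (part_split (Suc m) (part_comp m a b)) f h"
    if "f \<subseteq> {1..Suc m}" "h \<subseteq> {1..Suc m}" for f h
    by (subst sum_mat_mult_Suc[OF that, of _ "\<lambda>c. 1" _ "\<lambda>c. of_bool (c = (Suc m \<in> h))"])
       (use that in \<open>auto simp: part_mat_part_extend part_mat_part_split a b part_comp_in_parts\<close>)
  show "loops (Suc m) (part_split (Suc m) a) (part_extend (Suc m) b) = loops m a b"
    "part_comp (Suc m) (part_split (Suc m) a) (part_extend (Suc m) b) =
     part_split (Suc m) (part_comp m a b)"
    using part_comp_eqI[OF part_split_in_parts[OF a] part_extend_in_parts[OF b]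
        part_split_in_parts[OF part_comp_in_parts[OF a b]] *] by auto
qed

lemma part_comp_split_split:
  "loops (Suc m) (part_split (Suc m) a) (part_split (Suc m) b) = Suc (loops m a b)"
  "part_comp (Suc m) (part_split (Suc m) a) (part_split (Suc m) b) =
     part_split (Suc m) (part_comp m a b)"
proof -
  have *: "(\<Sum>g\<in>Pow {1..Suc m}. part_mat (part_split (Suc m) a) f g * part_mat (part_split (Suc m) b) g h)
      = 2 ^ Suc (loops m a b) * part_mat (part_split (Suc m) (part_comp m a b)) f h"
    if "f \<subseteq> {1..Suc m}" "h \<subseteq> {1..Suc m}" for f h
    \<comment> \<open>The middle copy of the new point is isolated and takes either colour: 1 + 1 =
      2 accounts for the additional loop.\<close>
    by (subst sum_mat_mult_Suc[OF that, of _ "\<lambda>c. 1" _ "\<lambda>c. 1"])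
       (use that in \<open>auto simp: part_mat_part_split a b part_comp_in_parts\<close>)
  show "loops (Suc m) (part_split (Suc m) a) (part_split (Suc m) b) = Suc (loops m a b)"
    "part_comp (Suc m) (part_split (Suc m) a) (part_split (Suc m) b) =
     part_split (Suc m) (part_comp m a b)"
    using part_comp_eqI[OF part_split_in_parts[OF a] part_split_in_parts[OF b]
        part_split_in_parts[OF part_comp_in_parts[OF a b]] *] by auto
qed

end

section \<open>Products with the partition $A^n$\<close>

lemma part_A_in_parts: "part_A (Suc m) \<in> parts (Suc m)"
  unfolding part_A_eq by (intro part_split_in_parts part_one_in_parts)

lemma part_comp_extend_A:
  assumes "a \<in> parts m"
  shows "loops (Suc m) (part_extend (Suc m) a) (part_A (Suc m)) = 0"
    "part_comp (Suc m) (part_extend (Suc m) a) (part_A (Suc m)) = part_split (Suc m) a"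
    "loops (Suc m) (part_A (Suc m)) (part_extend (Suc m) a) = 0"
    "part_comp (Suc m) (part_A (Suc m)) (part_extend (Suc m) a) = part_split (Suc m) a"
  using assms by (simp_all add: part_A_eq part_comp_extend_split part_comp_split_extend part_one_comp
      part_one_in_parts)

text \<open>The one loop contributes a factor Q_t in each component, which is the origin of the
  product of the Q_t in the square of e^T.\<close>

lemma part_comp_A_A:
  "loops (Suc m) (part_A (Suc m)) (part_A (Suc m)) = 1"
  "part_comp (Suc m) (part_A (Suc m)) (part_A (Suc m)) = part_A (Suc m)"
  by (simp_all add: part_A_eq part_comp_split_split part_one_comp part_one_in_parts)

lemma part_mat_eq_1_iff: "part_mat a f g = Suc 0 \<longleftrightarrow> part_compat a f g"
  by (simp add: part_mat_def)

text \<open>The matrix of $A^n$ does not depend on the colours of the new points. Hence colouring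
  only the last primed point of x A changes none of the summands for the empty colouring, where the
  entry is 1; so this colouring is compatible and the point is a part by itself. The case of A x is
  dual.\<close>

lemma image_part_comp_A:
  assumes "x \<in> parts (Suc m)"
  shows "part_comp (Suc m) x (part_A (Suc m)) `` {(Suc m, 1)} \<subseteq> {(Suc m, 1)}"
    and "part_comp (Suc m) (part_A (Suc m)) x `` {(Suc m, 0)} \<subseteq> {(Suc m, 0)}"
proof -
  let ?P = "Pow {1..Suc m}" and ?A = "part_A (Suc m)" and ?s = "{Suc m}"
  have mat: "part_mat ?A g ?s = part_mat ?A g {}" "part_mat ?A ?s g = part_mat ?A {} g" for g
    by (simp_all add: part_A_eq part_mat_part_split part_one_in_parts)
  have sub: "?s \<subseteq> {1..Suc m}" "{} \<subseteq> {1..Suc m}"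
    by auto
  have "part_mat (part_comp (Suc m) x ?A) {} ?s = 1"
    using sum_mat_mult[OF assms part_A_in_parts sub(2,1)] sum_mat_mult[OF assms part_A_in_parts sub(2,2)]
    by (simp add: mat)
  then show "part_comp (Suc m) x ?A `` {(Suc m, 1)} \<subseteq> {(Suc m, 1)}"
    by (simp add: part_mat_eq_1_iff part_compat_def)
  have "part_mat (part_comp (Suc m) ?A x) ?s {} = 1"
    using sum_mat_mult[OF part_A_in_parts assms sub] sum_mat_mult[OF part_A_in_parts assms sub(2,2)]
    by (simp add: mat)
  then show "part_comp (Suc m) ?A x `` {(Suc m, 0)} \<subseteq> {(Suc m, 0)}"
    by (simp add: part_mat_eq_1_iff part_compat_def)
qed

text \<open>A left inverse of splitting. It is also a right inverse on those partitions in which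
  both last points are singletons.\<close>

definition part_core :: "nat \<Rightarrow> prel \<Rightarrow> prel" where
  "part_core m a = a \<inter> ({1..m} \<times> {0, 1}) \<times> ({1..m} \<times> {0, 1})"

lemma part_core_in_parts: "a \<in> parts (Suc m) \<Longrightarrow> part_core m a \<in> parts m"
  unfolding parts_def part_core_def mem_Collect_eq by (erule equiv_restrict) auto

text \<open>Both last points of A a A are singletons, so passing to the core loses nothing. This is
  why e^T P e^T is no larger than the image of the smaller algebra times e^T.\<close>

lemma part_comp_A_both:
  assumes "a \<in> parts (Suc m)"
  defines "c \<equiv> part_comp (Suc m) (part_comp (Suc m) (part_A (Suc m)) a) (part_A (Suc m))"
  shows "c = part_split (Suc m) (part_core m c)"
proof -
  have c: "equiv ({1..Suc m} \<times> {0, 1}) c"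
    using assms part_comp_in_parts part_A_in_parts unfolding parts_def by blast
  have p1: "c `` {(Suc m, 1)} \<subseteq> {(Suc m, 1)}"
    unfolding c_def by (intro image_part_comp_A part_comp_in_parts part_A_in_parts assms)
  have p0: "c `` {(Suc m, 0)} \<subseteq> {(Suc m, 0)}"
    \<comment> \<open>The statement about the unprimed point needs $A^n$ as the left factor of the
      whole product, so A a A is bracketed as A (a A).\<close>
    unfolding c_def part_comp_assoc[OF part_A_in_parts assms(1) part_A_in_parts]
    by (intro image_part_comp_A part_comp_in_parts part_A_in_parts assms)
  have refl: "((Suc m, 0), (Suc m, 0)) \<in> c" "((Suc m, 1), (Suc m, 1)) \<in> c"
    using c by (auto simp: equiv_def refl_on_def)
  show ?thesis
  proof (intro equalityI subrelI)
    fix x y assume xy: "(x, y) \<in> c"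
    then have yx: "(y, x) \<in> c"
      using c by (meson equiv_def symD)
    have "x \<in> {1..Suc m} \<times> {0, 1}" "y \<in> {1..Suc m} \<times> {0, 1}"
      using xy c by (auto simp: equiv_def)
    then consider "x \<in> {1..m} \<times> {0, 1}" "y \<in> {1..m} \<times> {0, 1}"
      | "x = (Suc m, 0)" | "x = (Suc m, 1)" | "y = (Suc m, 0)" | "y = (Suc m, 1)"
      unfolding points_Suc by auto
    then show "(x, y) \<in> part_split (Suc m) (part_core m c)"
      using xy yx p0 p1 by cases (auto simp: part_split_def part_core_def)
  qed (use refl in \<open>auto simp: part_split_def part_core_def\<close>)
qed

lemma part_core_mono: "a \<subseteq> b \<Longrightarrow> part_core m a \<subseteq> part_core m b"
  unfolding part_core_def by blast

section \<open>Twisted monoid algebras\<close>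

lemma sum_basis_vec:
  assumes "finite B" "y \<in> B"
  shows "(\<Sum>x\<in>B. basis_vec y x * F x) = (F y :: 'k::field)"
proof -
  have "(\<Sum>x\<in>B. basis_vec y x * F x) = (\<Sum>x\<in>B. if x = y then F x else 0)"
    by (intro sum.cong refl) (simp add: basis_vec_def)
  then show ?thesis
    using assms by simp
qed

text \<open>The linear map determined by \<open>F\<close> on basis elements, in other words the
  push-forward of coefficient functions along \<open>F\<close>. The embedding
  \<open>part_embed\<close> has this form, and so has the product, with the multiplication of basis
  elements as \<open>F\<close>.\<close>

definition lin_ext :: "'a set \<Rightarrow> ('a \<Rightarrow> 'b) \<Rightarrow> ('a \<Rightarrow> 'k::field) \<Rightarrow> 'b \<Rightarrow> 'k" where
  "lin_ext A F f = (\<lambda>c. \<Sum>a\<in>A. f a * basis_vec (F a) c)"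

text \<open>Change of variables for the push-forward: summing against \<open>G\<close> after pushing
  forward is summing against \<open>G\<close> composed with \<open>F\<close>. Computations with
  linear combinations are reduced to basis elements in this way.\<close>

lemma sum_lin_ext:
  assumes "finite B" "F ` A \<subseteq> B"
  shows "(\<Sum>x\<in>B. lin_ext A F f x * G x) = (\<Sum>a\<in>A. f a * G (F a))"
proof -
  have "(\<Sum>x\<in>B. lin_ext A F f x * G x) = (\<Sum>x\<in>B. \<Sum>a\<in>A. f a * (basis_vec (F a) x * G x))"
    by (simp add: lin_ext_def sum_distrib_right mult.assoc)
  also have "\<dots> = (\<Sum>a\<in>A. \<Sum>x\<in>B. f a * (basis_vec (F a) x * G x))"
    by (rule sum.swap)
  also have "\<dots> = (\<Sum>a\<in>A. f a * (\<Sum>x\<in>B. basis_vec (F a) x * G x))"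
    by (simp add: sum_distrib_left)
  also have "\<dots> = (\<Sum>a\<in>A. f a * G (F a))"
    using assms by (intro sum.cong refl) (simp add: sum_basis_vec image_subset_iff)
  finally show ?thesis .
qed

lemma lin_ext_lin_ext:
  assumes "finite B" "F ` A \<subseteq> B"
  shows "lin_ext B G (lin_ext A F f) = lin_ext A (G \<circ> F) f"
  using sum_lin_ext[OF assms] by (auto simp: lin_ext_def fun_eq_iff)

lemma lin_ext_inj:
  assumes "finite A" "inj_on F A" "a \<in> A"
  shows "lin_ext A F f (F a) = f a"
proof -
  have "lin_ext A F f (F a) = (\<Sum>b\<in>A. if b = a then f b else 0)"
    unfolding lin_ext_def using assms by (intro sum.cong refl) (auto simp: basis_vec_def inj_on_eq_iff)
  then show ?thesis
    using assms by simp
qed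

lemma lin_ext_outside: "c \<notin> F ` A \<Longrightarrow> lin_ext A F f c = 0"
  unfolding lin_ext_def by (intro sum.neutral) (auto simp: basis_vec_def)

text \<open>A finite monoid algebra twisted by a normalised 2-cocycle \<open>w\<close>. The record
  \<open>P\<close> is a parameter pinned down by an equation, so that the results apply to
  \<open>part_algebra\<close> itself, once for each of the two indices.\<close>

locale twisted_algebra =
  fixes B :: "'b set" and op :: "'b \<Rightarrow> 'b \<Rightarrow> 'b" and w :: "'b \<Rightarrow> 'b \<Rightarrow> 'k::field" and one :: 'b
    and P :: "('k, 'b \<Rightarrow> 'k) module"
  assumes P_def: "P = \<lparr>carrier = {f. \<forall>a. a \<notin> B \<longrightarrow> f a = 0},
      monoid.mult = (\<lambda>f g c. \<Sum>a\<in>B. \<Sum>b\<in>B. f a * g b * w a b * basis_vec (op a b) c),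
      monoid.one = basis_vec one,
      ring.zero = (\<lambda>_. 0),
      ring.add = (\<lambda>f g a. f a + g a),
      module.smult = (\<lambda>x f a. x * f a)\<rparr>"
    and finite_B: "finite B"
    and op_closed: "a \<in> B \<Longrightarrow> b \<in> B \<Longrightarrow> op a b \<in> B"
    and one_closed: "one \<in> B"
    and op_assoc: "a \<in> B \<Longrightarrow> b \<in> B \<Longrightarrow> c \<in> B \<Longrightarrow> op (op a b) c = op a (op b c)"
    and w_cocycle: "a \<in> B \<Longrightarrow> b \<in> B \<Longrightarrow> c \<in> B \<Longrightarrow> w a b * w (op a b) c = w b c * w a (op b c)"
    and op_one: "a \<in> B \<Longrightarrow> op one a = a" "a \<in> B \<Longrightarrow> op a one = a"
    and w_one: "a \<in> B \<Longrightarrow> w one a = 1" "a \<in> B \<Longrightarrow> w a one = 1"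
begin

lemma carrier_P: "carrier P = {f. \<forall>a. a \<notin> B \<longrightarrow> f a = 0}"
  by (simp add: P_def)

lemma mult_P: "f \<otimes>\<^bsub>P\<^esub> g = (\<lambda>c. \<Sum>a\<in>B. \<Sum>b\<in>B. f a * g b * w a b * basis_vec (op a b) c)"
  by (simp add: P_def)

lemma P_simps: "\<one>\<^bsub>P\<^esub> = basis_vec one" "\<zero>\<^bsub>P\<^esub> = (\<lambda>_. 0)" "f \<oplus>\<^bsub>P\<^esub> g = (\<lambda>a. f a + g a)"
  "x \<odot>\<^bsub>P\<^esub> f = (\<lambda>a. x * f a)"
  by (simp_all add: P_def)

lemma basis_vec_closed: "a \<in> B \<Longrightarrow> basis_vec a \<in> carrier P"
  by (auto simp: carrier_P basis_vec_def)

lemma lin_ext_closed: "F ` A \<subseteq> B \<Longrightarrow> lin_ext A F f \<in> carrier P"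
  by (auto simp: carrier_P intro: lin_ext_outside)

lemma lin_ext_id:
  assumes "f \<in> carrier P"
  shows "lin_ext B (\<lambda>a. a) f = f"
proof
  fix c
  show "lin_ext B (\<lambda>a. a) f c = f c"
  proof (cases "c \<in> B")
    case True
    then show ?thesis
      using lin_ext_inj[of B "\<lambda>a. a" c f] finite_B by simp
  next
    case False
    then have "f c = 0" "c \<notin> (\<lambda>a. a) ` B"
      using assms by (simp_all add: carrier_P)
    from lin_ext_outside[OF this(2)] this(1) show ?thesis
      by simp
  qed
qed

lemma mult_closed: "f \<otimes>\<^bsub>P\<^esub> g \<in> carrier P"
  by (auto simp: carrier_P mult_P basis_vec_def op_closed intro!: sum.neutral)

lemma sum_mult_P: "(\<Sum>x\<in>B. (f \<otimes>\<^bsub>P\<^esub> g) x * F x) = (\<Sum>a\<in>B. \<Sum>b\<in>B. f a * g b * w a b * F (op a b))"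
proof -
  \<comment> \<open>The product is the push-forward of the weighted coefficients on pairs along
    \<open>op\<close>.\<close>
  have "f \<otimes>\<^bsub>P\<^esub> g = lin_ext (B \<times> B) (\<lambda>(a, b). op a b) (\<lambda>(a, b). f a * g b * w a b)"
    by (simp add: mult_P lin_ext_def sum.cartesian_product case_prod_unfold)
  moreover have "(\<lambda>(a, b). op a b) ` (B \<times> B) \<subseteq> B"
    using op_closed by auto
  ultimately show ?thesis
    by (simp add: sum_lin_ext[OF finite_B] sum.cartesian_product case_prod_unfold)
qed

lemma mult_assoc_P: "(f \<otimes>\<^bsub>P\<^esub> g) \<otimes>\<^bsub>P\<^esub> h = f \<otimes>\<^bsub>P\<^esub> (g \<otimes>\<^bsub>P\<^esub> h)"
proof
  fix c
  have "((f \<otimes>\<^bsub>P\<^esub> g) \<otimes>\<^bsub>P\<^esub> h) c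
      = (\<Sum>x\<in>B. (f \<otimes>\<^bsub>P\<^esub> g) x * (\<Sum>d\<in>B. h d * w x d * basis_vec (op x d) c))"
    unfolding mult_P[of "f \<otimes>\<^bsub>P\<^esub> g"] by (simp add: sum_distrib_left mult.assoc)
  also have "\<dots> = (\<Sum>a\<in>B. \<Sum>b\<in>B. f a * g b * w a b *
      (\<Sum>d\<in>B. h d * w (op a b) d * basis_vec (op (op a b) d) c))"
    by (rule sum_mult_P)
  also have "\<dots> = (\<Sum>a\<in>B. \<Sum>b\<in>B. \<Sum>d\<in>B. f a * g b * h d * (w a b * w (op a b) d) *
      basis_vec (op (op a b) d) c)"
    by (simp add: sum_distrib_left ac_simps)
  also have "\<dots> = (\<Sum>a\<in>B. \<Sum>b\<in>B. \<Sum>d\<in>B. f a * g b * h d * (w b d * w a (op b d)) *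
      basis_vec (op a (op b d)) c)"
    by (intro sum.cong refl) (simp add: w_cocycle op_assoc)
  also have "\<dots> = (\<Sum>a\<in>B. f a * (\<Sum>b\<in>B. \<Sum>d\<in>B. g b * h d * w b d * (w a (op b d) *
      basis_vec (op a (op b d)) c)))"
    by (simp add: sum_distrib_left ac_simps)
  also have "\<dots> = (\<Sum>a\<in>B. f a * (\<Sum>y\<in>B. (g \<otimes>\<^bsub>P\<^esub> h) y * (w a y * basis_vec (op a y) c)))"
    by (simp add: sum_mult_P)
  also have "\<dots> = (f \<otimes>\<^bsub>P\<^esub> (g \<otimes>\<^bsub>P\<^esub> h)) c"
    unfolding mult_P[of f] by (simp add: sum_distrib_left mult.assoc)
  finally show "((f \<otimes>\<^bsub>P\<^esub> g) \<otimes>\<^bsub>P\<^esub> h) c = (f \<otimes>\<^bsub>P\<^esub> (g \<otimes>\<^bsub>P\<^esub> h)) c" .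
qed

lemma lin_ext_mult_basis_vec:
  assumes "F ` A \<subseteq> B" "e \<in> B"
  shows "lin_ext A F f \<otimes>\<^bsub>P\<^esub> basis_vec e = lin_ext A (\<lambda>a. op (F a) e) (\<lambda>a. f a * w (F a) e)"
proof
  fix c
  have "(lin_ext A F f \<otimes>\<^bsub>P\<^esub> basis_vec e) c
      = (\<Sum>x\<in>B. lin_ext A F f x * (\<Sum>y\<in>B. basis_vec e y * (w x y * basis_vec (op x y) c)))"
    by (simp add: mult_P sum_distrib_left mult.assoc)
  then show "(lin_ext A F f \<otimes>\<^bsub>P\<^esub> basis_vec e) c
      = lin_ext A (\<lambda>a. op (F a) e) (\<lambda>a. f a * w (F a) e) c"
    by (simp add: sum_basis_vec finite_B assms(2) sum_lin_ext[OF finite_B assms(1)])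
       (simp add: lin_ext_def mult.assoc)
qed

lemma basis_vec_mult_lin_ext:
  assumes "F ` A \<subseteq> B" "e \<in> B"
  shows "basis_vec e \<otimes>\<^bsub>P\<^esub> lin_ext A F f = lin_ext A (\<lambda>a. op e (F a)) (\<lambda>a. f a * w e (F a))"
proof
  fix c
  have "(basis_vec e \<otimes>\<^bsub>P\<^esub> lin_ext A F f) c
      = (\<Sum>x\<in>B. basis_vec e x * (\<Sum>y\<in>B. lin_ext A F f y * (w x y * basis_vec (op x y) c)))"
    by (simp add: mult_P sum_distrib_left mult.assoc)
  then show "(basis_vec e \<otimes>\<^bsub>P\<^esub> lin_ext A F f) c
      = lin_ext A (\<lambda>a. op e (F a)) (\<lambda>a. f a * w e (F a)) c"
    by (simp add: sum_basis_vec finite_B assms(2) sum_lin_ext[OF finite_B assms(1)])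
       (simp add: lin_ext_def mult.assoc)
qed

lemma basis_vec_mult:
  assumes "a \<in> B" "b \<in> B"
  shows "basis_vec a \<otimes>\<^bsub>P\<^esub> basis_vec b = w a b \<odot>\<^bsub>P\<^esub> basis_vec (op a b)"
proof -
  have "basis_vec b = lin_ext {b} (\<lambda>x. x) (\<lambda>_. 1 :: 'k)"
    by (simp add: lin_ext_def)
  then show ?thesis
    using basis_vec_mult_lin_ext[of "\<lambda>x. x" "{b}" a "\<lambda>_. 1"] assms
    by (simp add: lin_ext_def P_simps)
qed

lemma mult_one_P:
  assumes "f \<in> carrier P"
  shows "basis_vec one \<otimes>\<^bsub>P\<^esub> f = f" "f \<otimes>\<^bsub>P\<^esub> basis_vec one = f"
proof -
  have "lin_ext B (\<lambda>a. op one a) (\<lambda>a. f a * w one a) = lin_ext B (\<lambda>a. a) f"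
    "lin_ext B (\<lambda>a. op a one) (\<lambda>a. f a * w a one) = lin_ext B (\<lambda>a. a) f"
    unfolding lin_ext_def by (simp_all add: op_one w_one cong: sum.cong)
  then show "basis_vec one \<otimes>\<^bsub>P\<^esub> f = f" "f \<otimes>\<^bsub>P\<^esub> basis_vec one = f"
    using basis_vec_mult_lin_ext[of "\<lambda>a. a" B one f] lin_ext_mult_basis_vec[of "\<lambda>a. a" B one f]
    by (simp_all add: lin_ext_id assms one_closed)
qed

lemma abelian_group_P: "abelian_group P"
proof (rule abelian_groupI)
  fix x assume "x \<in> carrier P"
  then show "\<exists>y\<in>carrier P. y \<oplus>\<^bsub>P\<^esub> x = \<zero>\<^bsub>P\<^esub>"
    by (intro bexI[of _ "\<lambda>a. - x a"]) (auto simp: P_simps carrier_P)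
qed (auto simp: P_simps carrier_P add.assoc add.commute)

lemma smult_mult_P:
  "(c \<odot>\<^bsub>P\<^esub> x) \<otimes>\<^bsub>P\<^esub> y = c \<odot>\<^bsub>P\<^esub> (x \<otimes>\<^bsub>P\<^esub> y)" "x \<otimes>\<^bsub>P\<^esub> (c \<odot>\<^bsub>P\<^esub> y) = c \<odot>\<^bsub>P\<^esub> (x \<otimes>\<^bsub>P\<^esub> y)"
  by (simp_all add: P_simps mult_P sum_distrib_left ac_simps)

lemma ring_P: "ring P"
proof (rule ringI[OF abelian_group_P])
  show "monoid P"
    by (rule monoidI)
       (simp_all add: mult_closed P_simps(1) basis_vec_closed one_closed mult_assoc_P mult_one_P)
qed (simp_all add: P_simps mult_P sum.distrib distrib_right distrib_left)

lemma unital_algebra_P: "unital_algebra P"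
proof -
  have "cring (ring_of_type_algebra :: 'k ring)"
    by (rule cring_from_type_algebra)
  then have "module (ring_of_type_algebra :: 'k ring) P"
    by (rule moduleI[OF _ abelian_group_P])
       (auto simp: ring_of_type_algebra_def P_simps carrier_P algebra_simps)
  then show ?thesis
    unfolding unital_algebra_def using ring_P smult_mult_P by blast
qed

end

lemma twisted_algebra_lin_ext_mult:
  assumes P: "twisted_algebra B op w i P" and P': "twisted_algebra B' op' w' i' P'"
    and F: "F ` B' \<subseteq> B"
    and op: "\<And>a b. a \<in> B' \<Longrightarrow> b \<in> B' \<Longrightarrow> op (F a) (F b) = F (op' a b)"
    and w: "\<And>a b. a \<in> B' \<Longrightarrow> b \<in> B' \<Longrightarrow> w (F a) (F b) = w' a b"
  shows "lin_ext B' F f \<otimes>\<^bsub>P\<^esub> lin_ext B' F g = lin_ext B' F (f \<otimes>\<^bsub>P'\<^esub> g)"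
proof
  fix c
  interpret P: twisted_algebra B op w i P by (rule P)
  interpret P': twisted_algebra B' op' w' i' P' by (rule P')
  note sum = sum_lin_ext[OF P.finite_B F]
  have "(lin_ext B' F f \<otimes>\<^bsub>P\<^esub> lin_ext B' F g) c
      = (\<Sum>x\<in>B. lin_ext B' F f x * (\<Sum>y\<in>B. lin_ext B' F g y * (w x y * basis_vec (op x y) c)))"
    by (simp add: P.mult_P sum_distrib_left mult.assoc)
  also have "\<dots> = (\<Sum>a\<in>B'. f a * (\<Sum>b\<in>B'. g b * (w (F a) (F b) * basis_vec (op (F a) (F b)) c)))"
    by (simp add: sum)
  also have "\<dots> = (\<Sum>a\<in>B'. \<Sum>b\<in>B'. f a * g b * w' a b * basis_vec (F (op' a b)) c)"
    by (simp add: sum_distrib_left op w mult.assoc)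
  also have "\<dots> = lin_ext B' F (f \<otimes>\<^bsub>P'\<^esub> g) c"
    by (simp add: lin_ext_def P'.sum_mult_P)
  finally show "(lin_ext B' F f \<otimes>\<^bsub>P\<^esub> lin_ext B' F g) c = lin_ext B' F (f \<otimes>\<^bsub>P'\<^esub> g) c" .
qed

lemma lin_ext_add: "lin_ext A F (\<lambda>a. f a + g a) = (\<lambda>c. lin_ext A F f c + lin_ext A F g c)"
  by (simp add: lin_ext_def distrib_right sum.distrib)

lemma lin_ext_smult: "lin_ext A F (\<lambda>a. x * f a) = (\<lambda>c. x * lin_ext A F f c)"
  by (simp add: lin_ext_def sum_distrib_left mult.assoc)

lemma lin_ext_basis_vec:
  assumes "finite A" "a \<in> A"
  shows "lin_ext A F (basis_vec a) = basis_vec (F a)"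
  by (simp add: lin_ext_def fun_eq_iff sum_basis_vec[OF assms])

section \<open>Corner algebras\<close>

lemma corner_algebra_simps:
  "carrier (corner_algebra A e u) = {e \<otimes>\<^bsub>A\<^esub> x \<otimes>\<^bsub>A\<^esub> e | x. x \<in> carrier A}"
  "monoid.mult (corner_algebra A e u) = monoid.mult A" "\<one>\<^bsub>corner_algebra A e u\<^esub> = u"
  "add (corner_algebra A e u) = add A" "\<zero>\<^bsub>corner_algebra A e u\<^esub> = \<zero>\<^bsub>A\<^esub>"
  "module.smult (corner_algebra A e u) = module.smult A"
  by (simp_all add: corner_algebra_def)

text \<open>This is the Peirce description of the corner of an idempotent. Since \<open>e\<close>
  and \<open>u\<close> are multiples of each other, \<open>u\<close> fixes \<open>e\<close> on both
  sides, and membership becomes a pair of equations from which the ring axioms are easily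
  inherited.\<close>

lemma in_corner_iff:
  fixes A :: "('k::field, 'a) module"
  assumes A: "unital_algebra A" and e: "e \<in> carrier A" and u: "u = c \<odot>\<^bsub>A\<^esub> e" "e = c' \<odot>\<^bsub>A\<^esub> u"
    and idem: "u \<otimes>\<^bsub>A\<^esub> u = u"
  shows "x \<in> carrier (corner_algebra A e u) \<longleftrightarrow> x \<in> carrier A \<and> u \<otimes>\<^bsub>A\<^esub> x = x \<and> x \<otimes>\<^bsub>A\<^esub> u = x"
proof -
  interpret A: ring A
    using A by (simp add: unital_algebra_def)
  interpret K: module "ring_of_type_algebra :: 'k ring" A
    using A by (simp add: unital_algebra_def)
  have K: "a \<in> carrier (ring_of_type_algebra :: 'k ring)" for a
    by (simp add: ring_of_type_algebra_def)
  have smult: "(a \<odot>\<^bsub>A\<^esub> x) \<otimes>\<^bsub>A\<^esub> y = a \<odot>\<^bsub>A\<^esub> (x \<otimes>\<^bsub>A\<^esub> y)" "x \<otimes>\<^bsub>A\<^esub> (a \<odot>\<^bsub>A\<^esub> y) = a \<odot>\<^bsub>A\<^esub> (x \<otimes>\<^bsub>A\<^esub> y)"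
    if "x \<in> carrier A" "y \<in> carrier A" for a x y
    using A that by (simp_all add: unital_algebra_def)
  have uA: "u \<in> carrier A"
    using e u(1) K by simp
  have ue: "u \<otimes>\<^bsub>A\<^esub> e = e" "e \<otimes>\<^bsub>A\<^esub> u = e"
    unfolding u(2) using uA idem by (simp_all add: smult)
  show ?thesis
  proof
    assume "x \<in> carrier (corner_algebra A e u)"
    then obtain y where y: "y \<in> carrier A" "x = e \<otimes>\<^bsub>A\<^esub> y \<otimes>\<^bsub>A\<^esub> e"
      by (auto simp: corner_algebra_simps)
    have "u \<otimes>\<^bsub>A\<^esub> x = (u \<otimes>\<^bsub>A\<^esub> e) \<otimes>\<^bsub>A\<^esub> y \<otimes>\<^bsub>A\<^esub> e" "x \<otimes>\<^bsub>A\<^esub> u = e \<otimes>\<^bsub>A\<^esub> y \<otimes>\<^bsub>A\<^esub> (e \<otimes>\<^bsub>A\<^esub> u)"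
      using y e uA by (simp_all add: A.m_assoc)
    then show "x \<in> carrier A \<and> u \<otimes>\<^bsub>A\<^esub> x = x \<and> x \<otimes>\<^bsub>A\<^esub> u = x"
      using y e by (simp add: ue)
  next
    assume x: "x \<in> carrier A \<and> u \<otimes>\<^bsub>A\<^esub> x = x \<and> x \<otimes>\<^bsub>A\<^esub> u = x"
    then have "x \<in> carrier A"
      by simp
    \<comment> \<open>Replacing both factors \<open>u\<close> by \<open>e\<close> costs the scalar
      \<open>c\<close> twice, which is moved onto the middle factor.\<close>
    then have "u \<otimes>\<^bsub>A\<^esub> x \<otimes>\<^bsub>A\<^esub> u = e \<otimes>\<^bsub>A\<^esub> (c \<odot>\<^bsub>A\<^esub> (c \<odot>\<^bsub>A\<^esub> x)) \<otimes>\<^bsub>A\<^esub> e"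
      using e K by (simp add: u(1) smult)
    moreover have "u \<otimes>\<^bsub>A\<^esub> x \<otimes>\<^bsub>A\<^esub> u = x"
      using x by simp
    ultimately have "\<exists>y. x = e \<otimes>\<^bsub>A\<^esub> y \<otimes>\<^bsub>A\<^esub> e \<and> y \<in> carrier A"
      using x K by (intro exI[of _ "c \<odot>\<^bsub>A\<^esub> (c \<odot>\<^bsub>A\<^esub> x)"]) simp
    then show "x \<in> carrier (corner_algebra A e u)"
      by (simp add: corner_algebra_simps)
  qed
qed

lemma unital_algebra_corner:
  fixes A :: "('k::field, 'a) module"
  assumes A: "unital_algebra A" and e: "e \<in> carrier A" and u: "u = c \<odot>\<^bsub>A\<^esub> e" "e = c' \<odot>\<^bsub>A\<^esub> u"
    and idem: "u \<otimes>\<^bsub>A\<^esub> u = u"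
  shows "unital_algebra (corner_algebra A e u)"
proof -
  let ?C = "corner_algebra A e u"
  interpret A: ring A
    using A by (simp add: unital_algebra_def)
  interpret K: module "ring_of_type_algebra :: 'k ring" A
    using A by (simp add: unital_algebra_def)
  have K: "a \<in> carrier (ring_of_type_algebra :: 'k ring)" for a
    by (simp add: ring_of_type_algebra_def)
  have smult: "(a \<odot>\<^bsub>A\<^esub> x) \<otimes>\<^bsub>A\<^esub> y = a \<odot>\<^bsub>A\<^esub> (x \<otimes>\<^bsub>A\<^esub> y)" "x \<otimes>\<^bsub>A\<^esub> (a \<odot>\<^bsub>A\<^esub> y) = a \<odot>\<^bsub>A\<^esub> (x \<otimes>\<^bsub>A\<^esub> y)"
    if "x \<in> carrier A" "y \<in> carrier A" for a x y
    using A that by (simp_all add: unital_algebra_def)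
  note iff = in_corner_iff[OF assms]
  have uA: "u \<in> carrier A"
    using e u(1) K by simp
  have ab: "abelian_group ?C"
  proof (rule abelian_groupI)
    fix x assume x: "x \<in> carrier ?C"
    then show "\<exists>y\<in>carrier ?C. y \<oplus>\<^bsub>?C\<^esub> x = \<zero>\<^bsub>?C\<^esub>"
      using uA by (intro bexI[of _ "\<ominus>\<^bsub>A\<^esub> x"])
        (auto simp: iff corner_algebra_simps(2-) A.l_neg A.r_minus A.l_minus)
  qed (use uA in \<open>auto simp: iff corner_algebra_simps(2-) A.a_ac A.l_distr A.r_distr\<close>)
  have ring: "ring ?C"
  proof (rule ringI[OF ab])
    have "u \<otimes>\<^bsub>A\<^esub> (x \<otimes>\<^bsub>A\<^esub> y) = x \<otimes>\<^bsub>A\<^esub> y" "x \<otimes>\<^bsub>A\<^esub> y \<otimes>\<^bsub>A\<^esub> u = x \<otimes>\<^bsub>A\<^esub> y"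
      if "x \<in> carrier ?C" "y \<in> carrier ?C" for x y
      using that uA by (auto simp: iff A.m_assoc) (simp flip: A.m_assoc)
    then show "Group.monoid ?C"
      by (intro monoidI) (auto simp: iff corner_algebra_simps(2-) A.m_assoc uA idem)
  qed (auto simp: iff corner_algebra_simps(2-) A.l_distr A.r_distr)
  have "module (ring_of_type_algebra :: 'k ring) ?C"
    by (rule moduleI[OF K.R.is_cring ab])
       (auto simp: iff corner_algebra_simps(2-) K smult uA K.smult_l_distr K.smult_r_distr K.smult_assoc1)
  then show ?thesis
    unfolding unital_algebra_def using ring
    by (auto simp: iff corner_algebra_simps(2-) smult)
qed

section \<open>Tensor products\<close>

definition pure_tensor ::
    "('s, 'c) ring_scheme \<Rightarrow> ('r, 's, 'x) bimodule \<Rightarrow> ('s, 'm) module \<Rightarrow> 'x \<Rightarrow> 'm \<Rightarrow>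
     ('x \<times> 'm \<Rightarrow>\<^sub>0 int) set" where
  "pure_tensor S B M x m = tensor_class S B M (frag_of (x, m))"

text \<open>The three identities mirror the three families in \<open>tensor_rels\<close>; of
  \<open>H\<close> only the additive structure is involved.\<close>

definition balanced ::
    "('s, 'c) ring_scheme \<Rightarrow> ('r, 's, 'x) bimodule \<Rightarrow> ('s, 'm) module \<Rightarrow> ('t, 'h, 'e) module_scheme \<Rightarrow>
     ('x \<Rightarrow> 'm \<Rightarrow> 'h) \<Rightarrow> bool" where
  "balanced S B M H \<beta> \<longleftrightarrow>
     (\<forall>x\<in>carrier B. \<forall>m\<in>carrier M. \<beta> x m \<in> carrier H) \<and>
     (\<forall>x\<in>carrier B. \<forall>y\<in>carrier B. \<forall>m\<in>carrier M. \<beta> (x \<oplus>\<^bsub>B\<^esub> y) m = \<beta> x m \<oplus>\<^bsub>H\<^esub> \<beta> y m) \<and>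
     (\<forall>x\<in>carrier B. \<forall>l\<in>carrier M. \<forall>m\<in>carrier M. \<beta> x (l \<oplus>\<^bsub>M\<^esub> m) = \<beta> x l \<oplus>\<^bsub>H\<^esub> \<beta> x m) \<and>
     (\<forall>x\<in>carrier B. \<forall>s\<in>carrier S. \<forall>m\<in>carrier M. \<beta> (rsmult B x s) m = \<beta> x (s \<odot>\<^bsub>M\<^esub> m))"

locale tensor_product =
  fixes S :: "('s, 'c) ring_scheme" and B :: "('r, 's, 'x) bimodule" and M :: "('s, 'm) module"
  assumes left_module_M: "left_module S M"
    and B_add_closed: "\<lbrakk>x \<in> carrier B; y \<in> carrier B\<rbrakk> \<Longrightarrow> x \<oplus>\<^bsub>B\<^esub> y \<in> carrier B"
    and B_rsmult_closed: "\<lbrakk>x \<in> carrier B; s \<in> carrier S\<rbrakk> \<Longrightarrow> rsmult B x s \<in> carrier B"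
begin

abbreviation "FG \<equiv> free_Abelian_group (carrier B \<times> carrier M)"
abbreviation "T \<equiv> tensor S B M"
abbreviation "cls \<equiv> tensor_class S B M"
abbreviation "pure \<equiv> pure_tensor S B M"

lemma M_closed:
  "\<lbrakk>x \<in> carrier M; y \<in> carrier M\<rbrakk> \<Longrightarrow> x \<oplus>\<^bsub>M\<^esub> y \<in> carrier M"
  "\<lbrakk>s \<in> carrier S; x \<in> carrier M\<rbrakk> \<Longrightarrow> s \<odot>\<^bsub>M\<^esub> x \<in> carrier M"
proof -
  interpret left_module S M
    by (rule left_module_M)
  show "\<lbrakk>x \<in> carrier M; y \<in> carrier M\<rbrakk> \<Longrightarrow> x \<oplus>\<^bsub>M\<^esub> y \<in> carrier M"
    "\<lbrakk>s \<in> carrier S; x \<in> carrier M\<rbrakk> \<Longrightarrow> s \<odot>\<^bsub>M\<^esub> x \<in> carrier M"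
    by (simp_all add: smult_closed)
qed

lemma FG_diff: "a \<in> carrier FG \<Longrightarrow> b \<in> carrier FG \<Longrightarrow> a - b \<in> carrier FG"
  using keys_diff[of a b] by auto

lemma frag_of_FG: "x \<in> carrier B \<Longrightarrow> m \<in> carrier M \<Longrightarrow> frag_of (x, m) \<in> carrier FG"
  by simp

lemma tensor_rels_subset: "tensor_rels S B M \<subseteq> carrier FG"
  unfolding tensor_rels_def
  by (intro Un_least subsetI; elim CollectE exE conjE; hypsubst)
     (intro FG_diff frag_of_FG B_add_closed B_rsmult_closed M_closed; assumption)+

lemma subgroup_tensor_sub: "subgroup (tensor_sub S B M) FG"
  unfolding tensor_sub_def by (rule group.generate_is_subgroup) (simp_all add: tensor_rels_subset del: carrier_free_Abelian_group_iff)

lemma normal_tensor_sub: "tensor_sub S B M \<lhd> FG"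
  using abelian_free_Abelian_group subgroup_tensor_sub by (rule comm_group.subgroup_imp_normal)

lemma carrier_tensor: "carrier T = cls ` carrier FG"
  by (simp add: tensor_def carrier_FactGroup tensor_class_def)

lemma cls_closed: "z \<in> carrier FG \<Longrightarrow> cls z \<in> carrier T"
  by (simp add: carrier_tensor)

lemma tensor_simps:
  "carrier T = carrier (FG Mod tensor_sub S B M)" "add T = monoid.mult (FG Mod tensor_sub S B M)"
  "\<zero>\<^bsub>T\<^esub> = \<one>\<^bsub>FG Mod tensor_sub S B M\<^esub>"
  by (simp_all add: tensor_def)

lemma abelian_group_tensor: "abelian_group T"
proof -
  interpret G: comm_group "FG Mod tensor_sub S B M"
    by (intro comm_group.abelian_FactGroup abelian_free_Abelian_group subgroup_tensor_sub)
  show ?thesis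
    by (rule abelian_groupI)
       (simp_all add: tensor_simps G.m_ac G.l_inv_ex del: one_FactGroup mult_FactGroup)
qed

lemma hom_tensor_iff: "f \<in> hom (add_monoid T) G \<longleftrightarrow> f \<in> hom (FG Mod tensor_sub S B M) G"
  by (simp add: hom_def tensor_simps)

lemma hom_cls: "cls \<in> hom FG (add_monoid T)"
proof -
  have "cls = r_coset FG (tensor_sub S B M)"
    by (simp add: fun_eq_iff tensor_class_def)
  then show ?thesis
    using normal.r_coset_hom_Mod[OF normal_tensor_sub] by (simp add: hom_def tensor_simps)
qed

lemma cls_add:
  "\<lbrakk>a \<in> carrier FG; b \<in> carrier FG\<rbrakk> \<Longrightarrow> cls (a + b) = cls a \<oplus>\<^bsub>T\<^esub> cls b"
  using hom_mult[OF hom_cls] by simp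

lemma in_cls_iff:
  assumes "z \<in> carrier FG"
  shows "z' \<in> cls z \<longleftrightarrow> (\<exists>k \<in> tensor_sub S B M. z' = k + z)"
  by (simp add: tensor_class_def r_coset_def)

lemma cls_self: "z \<in> carrier FG \<Longrightarrow> z \<in> cls z"
  using subgroup.one_closed[OF subgroup_tensor_sub] by (auto simp: in_cls_iff)

lemma pure_closed: "x \<in> carrier B \<Longrightarrow> m \<in> carrier M \<Longrightarrow> pure x m \<in> carrier T"
  by (simp add: pure_tensor_def cls_closed)

text \<open>Pure tensors generate the tensor product, so additive maps agreeing on them are equal.
  The induction on the free abelian group proceeds by differences, whence the passage through
  inverses.\<close>

lemma tensor_hom_eqI:
  assumes "abelian_group H" "f \<in> hom (add_monoid T) (add_monoid H)" "g \<in> hom (add_monoid T) (add_monoid H)"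
    and "\<And>x m. x \<in> carrier B \<Longrightarrow> m \<in> carrier M \<Longrightarrow> f (pure x m) = g (pure x m)"
    and "C \<in> carrier T"
  shows "f C = g C"
proof -
  interpret H: abelian_group H
    by (rule assms(1))
  have FG: "group FG" "group (add_monoid H)"
    by (simp_all add: H.a_group)
  have "f \<circ> cls \<in> hom FG (add_monoid H)" "g \<circ> cls \<in> hom FG (add_monoid H)"
    using hom_cls assms(2,3) hom_compose by blast+
  then interpret f: group_hom FG "add_monoid H" "f \<circ> cls" + g: group_hom FG "add_monoid H" "g \<circ> cls"
    using FG by (auto intro!: group_hom.intro group_hom_axioms.intro)
  have "f (cls z) = g (cls z)" if "Poly_Mapping.keys z \<subseteq> carrier B \<times> carrier M" for z
    using that
  proof (rule free_Abelian_group_induct[where P = "\<lambda>z. f (cls z) = g (cls z)"])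
    show "f (cls 0) = g (cls 0)"
      using f.hom_one g.hom_one by simp
  next
    fix x y
    assume xy: "Poly_Mapping.keys x \<subseteq> carrier B \<times> carrier M" "Poly_Mapping.keys y \<subseteq> carrier B \<times> carrier M"
      "f (cls x) = g (cls x)" "f (cls y) = g (cls y)"
    have "x - y = x \<otimes>\<^bsub>FG\<^esub> inv\<^bsub>FG\<^esub> y"
      using xy by simp
    moreover have "x \<in> carrier FG" "y \<in> carrier FG" "inv\<^bsub>FG\<^esub> y \<in> carrier FG"
      using xy by auto
    ultimately show "f (cls (x - y)) = g (cls (x - y))"
      using xy f.hom_mult[of x "inv\<^bsub>FG\<^esub> y"] g.hom_mult[of x "inv\<^bsub>FG\<^esub> y"] f.hom_inv[of y] g.hom_inv[of y]
      by simp
  next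
    fix a assume "a \<in> carrier B \<times> carrier M"
    then show "f (cls (frag_of a)) = g (cls (frag_of a))"
      using assms(4) by (auto simp: pure_tensor_def)
  qed
  then show ?thesis
    using assms(5) by (auto simp: carrier_tensor)
qed

text \<open>On generators \<open>h\<close> is the balanced map, so each defining relation is sent to
  zero, and therefore so is the subgroup they generate. Consequently \<open>h\<close> is constant on
  cosets, as both constructions of maps out of the tensor product require.\<close>

lemma hom_trivial_on_sub:
  assumes H: "abelian_group H" and h: "h \<in> hom FG (add_monoid H)"
    and \<beta>: "balanced S B M H \<beta>"
    and pure: "\<And>x m. x \<in> carrier B \<Longrightarrow> m \<in> carrier M \<Longrightarrow> h (frag_of (x, m)) = \<beta> x m"
    and k: "k \<in> tensor_sub S B M"
  shows "h k = \<zero>\<^bsub>H\<^esub>"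
proof -
  interpret H: abelian_group H
    by (rule H)
  interpret h: group_hom FG "add_monoid H" h
    using h by (auto intro!: group_hom.intro group_hom_axioms.intro simp: H.a_group)
  have diff: "h (a - b) = h a \<ominus>\<^bsub>H\<^esub> h b" "h a \<in> carrier H" if "a \<in> carrier FG" "b \<in> carrier FG" for a b
  proof -
    have "a - b = a \<otimes>\<^bsub>FG\<^esub> inv\<^bsub>FG\<^esub> b" "inv\<^bsub>FG\<^esub> b \<in> carrier FG"
      using that by auto
    then have "h (a - b) = h a \<oplus>\<^bsub>H\<^esub> h (inv\<^bsub>FG\<^esub> b)"
      using h.hom_mult[of a "inv\<^bsub>FG\<^esub> b"] that by (metis monoid.select_convs(1))
    then show "h (a - b) = h a \<ominus>\<^bsub>H\<^esub> h b"
      using h.hom_inv[OF that(2)] by (simp only: a_minus_def a_inv_def)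
    show "h a \<in> carrier H"
      using that h.hom_closed[of a] by simp
  qed
  have minus: "(a \<oplus>\<^bsub>H\<^esub> b) \<ominus>\<^bsub>H\<^esub> a \<ominus>\<^bsub>H\<^esub> b = \<zero>\<^bsub>H\<^esub>" if "a \<in> carrier H" "b \<in> carrier H" for a b
    using that by (simp add: a_minus_def H.a_comm[of a b] H.a_assoc H.r_neg)
  have rel: "h r = \<zero>\<^bsub>H\<^esub>" if "r \<in> tensor_rels S B M" for r
    using that unfolding tensor_rels_def Un_iff
  proof (elim disjE CollectE exE conjE)
    fix x y m
    assume r: "r = frag_of (x \<oplus>\<^bsub>B\<^esub> y, m) - frag_of (x, m) - frag_of (y, m)"
      and *: "x \<in> carrier B" "y \<in> carrier B" "m \<in> carrier M"
    have "h r = \<beta> (x \<oplus>\<^bsub>B\<^esub> y) m \<ominus>\<^bsub>H\<^esub> \<beta> x m \<ominus>\<^bsub>H\<^esub> \<beta> y m"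
      unfolding r using * by (simp add: diff FG_diff frag_of_FG pure B_add_closed del: carrier_free_Abelian_group_iff)
    then show ?thesis
      using * \<beta> by (simp add: balanced_def minus)
  next
    fix x l m
    assume r: "r = frag_of (x, l \<oplus>\<^bsub>M\<^esub> m) - frag_of (x, l) - frag_of (x, m)"
      and *: "x \<in> carrier B" "l \<in> carrier M" "m \<in> carrier M"
    have "h r = \<beta> x (l \<oplus>\<^bsub>M\<^esub> m) \<ominus>\<^bsub>H\<^esub> \<beta> x l \<ominus>\<^bsub>H\<^esub> \<beta> x m"
      unfolding r using * by (simp add: diff FG_diff frag_of_FG pure M_closed del: carrier_free_Abelian_group_iff)
    then show ?thesis
      using * \<beta> by (simp add: balanced_def minus)
  next
    fix x s m
    assume r: "r = frag_of (rsmult B x s, m) - frag_of (x, s \<odot>\<^bsub>M\<^esub> m)"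
      and *: "x \<in> carrier B" "s \<in> carrier S" "m \<in> carrier M"
    have "h r = \<beta> (rsmult B x s) m \<ominus>\<^bsub>H\<^esub> \<beta> x (s \<odot>\<^bsub>M\<^esub> m)"
      unfolding r using *
      by (simp add: diff FG_diff frag_of_FG pure M_closed B_rsmult_closed del: carrier_free_Abelian_group_iff)
    then show ?thesis
      using * \<beta> by (simp add: balanced_def M_closed a_minus_def H.r_neg)
  qed
  have "k \<in> generate FG (tensor_rels S B M)"
    using k by (simp add: tensor_sub_def)
  then have "k \<in> carrier FG \<and> h k = \<zero>\<^bsub>H\<^esub>"
  proof induction
    case one
    then show ?case
      using h.hom_one by simp
  next
    case (incl r)
    then show ?case
      using rel tensor_rels_subset by blast
  next
    case (inv r)
    then have r: "r \<in> carrier FG"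
      using tensor_rels_subset by blast
    then have "h (inv\<^bsub>FG\<^esub> r) = inv\<^bsub>add_monoid H\<^esub> (h r)"
      by (rule h.hom_inv)
    then show ?case
      using rel[OF inv] r monoid.inv_one[OF H.a_monoid] group.inv_closed[OF group_free_Abelian_group r]
      by (metis monoid.select_convs(2))
  next
    case (eng a b)
    have "a + b \<in> carrier FG"
      using eng.IH keys_add[of a b] by auto
    moreover have "h (a + b) = h a \<oplus>\<^bsub>H\<^esub> h b"
      using h.hom_mult[of a b] eng.IH by simp
    ultimately show ?case
      using eng.IH by simp
  qed
  then show ?thesis
    by simp
qed

lemma hom_const_on_cls:
  assumes "abelian_group H" "h \<in> hom FG (add_monoid H)" "balanced S B M H \<beta>"
    and "\<And>x m. x \<in> carrier B \<Longrightarrow> m \<in> carrier M \<Longrightarrow> h (frag_of (x, m)) = \<beta> x m"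
    and z: "z \<in> carrier FG" and "z' \<in> cls z"
  shows "h z' = h z"
proof -
  interpret H: abelian_group H
    by (rule assms(1))
  obtain k where k: "k \<in> tensor_sub S B M" "z' = k + z"
    using assms(6) in_cls_iff[OF z] by blast
  have "k \<in> carrier FG"
    using k subgroup.subset[OF subgroup_tensor_sub] by blast
  then have "h z' = h k \<oplus>\<^bsub>H\<^esub> h z"
    using hom_mult[OF assms(2), of k z] z k(2) by simp
  also have "h k = \<zero>\<^bsub>H\<^esub>"
    by (rule hom_trivial_on_sub[OF assms(1-4) k(1)])
  finally show ?thesis
    using hom_in_carrier[OF assms(2) z] by simp
qed

text \<open>In contrast to \<open>tensor_lift\<close>, the target is an arbitrary abelian group; the
  retraction onto a module is constructed from this.\<close>

lemma tensor_universal: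
  assumes "abelian_group H" "balanced S B M H \<beta>"
  obtains f where "f \<in> hom (add_monoid T) (add_monoid H)"
    "\<And>x m. x \<in> carrier B \<Longrightarrow> m \<in> carrier M \<Longrightarrow> f (pure x m) = \<beta> x m"
proof -
  interpret H: abelian_group H
    by (rule assms(1))
  have "comm_group (add_monoid H)"
    by (rule H.a_comm_group)
  moreover have "case_prod \<beta> ` (carrier B \<times> carrier M) \<subseteq> carrier (add_monoid H)"
    using assms(2) by (auto simp: balanced_def)
  ultimately obtain h where h: "h \<in> hom FG (add_monoid H)"
      "\<And>p. p \<in> carrier B \<times> carrier M \<Longrightarrow> h (frag_of p) = case_prod \<beta> p"
    by (rule comm_group.free_Abelian_group_universal) blast
  have const: "h z' = h z" if "z \<in> carrier FG" "z' \<in> cls z" for z z'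
    by (rule hom_const_on_cls[OF assms(1) h(1) assms(2) _ that]) (simp add: h(2))
  have "h z = h z'"
    if "z \<in> carrier FG" "z' \<in> carrier FG" "r_coset FG (tensor_sub S B M) z = r_coset FG (tensor_sub S B M) z'" for z z'
    using const[OF that(2), of z] cls_self[OF that(1)] that(3) by (simp add: tensor_class_def)
  then obtain f where f: "f \<in> hom (FG Mod tensor_sub S B M) (add_monoid H)"
      "\<And>z. z \<in> carrier FG \<Longrightarrow> f (r_coset FG (tensor_sub S B M) z) = h z"
    using FactGroup_universal[OF h(1) normal_tensor_sub] by metis
  show thesis
  proof
    show "f \<in> hom (add_monoid T) (add_monoid H)"
      using f(1) by (simp only: hom_tensor_iff)
    show "f (pure x m) = \<beta> x m" if "x \<in> carrier B" "m \<in> carrier M" for x m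
      using f(2)[of "frag_of (x, m)"] h(2)[of "(x, m)"] that by (simp add: pure_tensor_def tensor_class_def)
  qed
qed

lemma cls_eqI:
  assumes "a - b \<in> tensor_sub S B M" "b \<in> carrier FG"
  shows "cls a = cls b"
proof -
  have "a \<in> cls b"
    using assms by (subst in_cls_iff) (auto intro: bexI[of _ "a - b"])
  then show ?thesis
    using group.repr_independence[OF group_free_Abelian_group _ assms(2) subgroup_tensor_sub]
    by (simp add: tensor_class_def)
qed

lemma balanced_pure: "balanced S B M T pure"
proof -
  have *: "cls (a + b) = cls a \<oplus>\<^bsub>T\<^esub> cls b" "a + b \<in> carrier FG" if "a \<in> carrier FG" "b \<in> carrier FG" for a b
    using that cls_add keys_add[of a b] by auto
  have add_left: "pure (x \<oplus>\<^bsub>B\<^esub> y) m = pure x m \<oplus>\<^bsub>T\<^esub> pure y m"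
    if "x \<in> carrier B" "y \<in> carrier B" "m \<in> carrier M" for x y m
  proof -
    have "frag_of (x \<oplus>\<^bsub>B\<^esub> y, m) - (frag_of (x, m) + frag_of (y, m)) \<in> tensor_sub S B M"
      unfolding tensor_sub_def diff_diff_eq[symmetric]
      by (rule generate.incl) (use that in \<open>auto simp: tensor_rels_def\<close>)
    from cls_eqI[OF this] show ?thesis
      using * that frag_of_FG by (simp add: pure_tensor_def del: carrier_free_Abelian_group_iff)
  qed
  have add_right: "pure x (l \<oplus>\<^bsub>M\<^esub> m) = pure x l \<oplus>\<^bsub>T\<^esub> pure x m"
    if "x \<in> carrier B" "l \<in> carrier M" "m \<in> carrier M" for x l m
  proof -
    have "frag_of (x, l \<oplus>\<^bsub>M\<^esub> m) - (frag_of (x, l) + frag_of (x, m)) \<in> tensor_sub S B M"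
      unfolding tensor_sub_def diff_diff_eq[symmetric]
      by (rule generate.incl) (use that in \<open>auto simp: tensor_rels_def\<close>)
    from cls_eqI[OF this] show ?thesis
      using * that frag_of_FG by (simp add: pure_tensor_def del: carrier_free_Abelian_group_iff)
  qed
  have smult: "pure (rsmult B x s) m = pure x (s \<odot>\<^bsub>M\<^esub> m)"
    if "x \<in> carrier B" "s \<in> carrier S" "m \<in> carrier M" for x s m
  proof -
    have "frag_of (rsmult B x s, m) - frag_of (x, s \<odot>\<^bsub>M\<^esub> m) \<in> tensor_sub S B M"
      unfolding tensor_sub_def
      by (rule generate.incl) (use that in \<open>auto simp: tensor_rels_def\<close>)
    from cls_eqI[OF this] show ?thesis
      using that frag_of_FG M_closed by (simp add: pure_tensor_def del: carrier_free_Abelian_group_iff)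
  qed
  show ?thesis
    unfolding balanced_def using pure_closed add_left add_right smult by blast
qed

lemmas pure_add_left = balanced_pure[unfolded balanced_def, THEN conjunct2, THEN conjunct1, rule_format]
  and pure_add_right = balanced_pure[unfolded balanced_def, THEN conjunct2, THEN conjunct2, THEN conjunct1, rule_format]
  and pure_smult = balanced_pure[unfolded balanced_def, THEN conjunct2, THEN conjunct2, THEN conjunct2, rule_format]

text \<open>The class of the image does not depend on the representative, so the union over a coset
  is a union of copies of a single coset. The action of a ring element (\<open>q\<close> the
  identity) and the map induced by a homomorphism (\<open>p\<close> the identity) are the two
  instances.\<close>

lemma tensor_lift:
  assumes H: "tensor_product S' B' N"
    and \<beta>: "balanced S B M (tensor S' B' N) (\<lambda>x m. pure_tensor S' B' N (p x) (q m))"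
    and p: "\<And>x. x \<in> carrier B \<Longrightarrow> p x \<in> carrier B'" and q: "\<And>m. m \<in> carrier M \<Longrightarrow> q m \<in> carrier N"
  defines "g \<equiv> \<lambda>C. \<Union>z\<in>C. tensor_class S' B' N (frag_extend (\<lambda>(x, m). frag_of (p x, q m)) z)"
  shows "g \<in> hom (add_monoid T) (add_monoid (tensor S' B' N))"
    and "\<And>x m. x \<in> carrier B \<Longrightarrow> m \<in> carrier M \<Longrightarrow> g (pure x m) = pure_tensor S' B' N (p x) (q m)"
proof -
  interpret N: tensor_product S' B' N
    by (rule H)
  let ?\<phi> = "\<lambda>(x, m). frag_of (p x, q m)"
  have \<phi>: "frag_extend ?\<phi> z \<in> carrier N.FG" if "z \<in> carrier FG" for z
  proof -
    have "Poly_Mapping.keys (?\<phi> y) \<subseteq> carrier B' \<times> carrier N" if "y \<in> Poly_Mapping.keys z" for y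
    proof -
      have "y \<in> carrier B \<times> carrier M"
        using \<open>z \<in> carrier FG\<close> that by auto
      then show ?thesis
        using p q by auto
    qed
    then have "(\<Union>y\<in>Poly_Mapping.keys z. Poly_Mapping.keys (?\<phi> y)) \<subseteq> carrier B' \<times> carrier N"
      by (rule UN_least)
    then show ?thesis
      using keys_frag_extend[of ?\<phi> z] unfolding carrier_free_Abelian_group_iff by (rule order_trans[rotated])
  qed
  have "frag_extend ?\<phi> \<in> hom FG N.FG"
    using \<phi> by (auto simp: hom_def frag_extend_add)
  then have h: "N.cls \<circ> frag_extend ?\<phi> \<in> hom FG (add_monoid N.T)"
    using N.hom_cls by (rule hom_compose)
  have g: "g (cls z) = N.cls (frag_extend ?\<phi> z)" if z: "z \<in> carrier FG" for z
  proof -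
    have "(N.cls \<circ> frag_extend ?\<phi>) z' = (N.cls \<circ> frag_extend ?\<phi>) z" if "z' \<in> cls z" for z'
      by (rule hom_const_on_cls[OF N.abelian_group_tensor h \<beta> _ z that]) (simp add: pure_tensor_def)
    then have "g (cls z) = (\<Union>z'\<in>cls z. N.cls (frag_extend ?\<phi> z))"
      unfolding g_def by (intro SUP_cong refl) (simp only: comp_def)
    also have "\<dots> = N.cls (frag_extend ?\<phi> z)"
      \<comment> \<open>The union of a constant family is that constant because \<open>cls z\<close>
        is nonempty.\<close>
      using cls_self[OF z] by (subst UN_constant) (metis empty_iff)
    finally show ?thesis .
  qed
  show "g \<in> hom (add_monoid T) (add_monoid (tensor S' B' N))"
  proof (rule homI)
    fix C D assume "C \<in> carrier (add_monoid T)" "D \<in> carrier (add_monoid T)"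
    then obtain a b where ab: "a \<in> carrier FG" "b \<in> carrier FG" "C = cls a" "D = cls b"
      by (auto simp: carrier_tensor)
    have "a + b \<in> carrier FG"
      using ab(1,2) keys_add[of a b] by (meson Un_least carrier_free_Abelian_group_iff order_trans)
    then have "g (cls (a + b)) = N.cls (frag_extend ?\<phi> a + frag_extend ?\<phi> b)"
      by (simp only: g frag_extend_add)
    also have "\<dots> = g C \<oplus>\<^bsub>N.T\<^esub> g D"
      unfolding ab(3,4) g[OF ab(1)] g[OF ab(2)] by (rule N.cls_add[OF \<phi>[OF ab(1)] \<phi>[OF ab(2)]])
    finally have "g (C \<oplus>\<^bsub>T\<^esub> D) = g C \<oplus>\<^bsub>N.T\<^esub> g D"
      unfolding ab(3,4) cls_add[OF ab(1,2)] .
    then show "g (C \<otimes>\<^bsub>add_monoid T\<^esub> D) = g C \<otimes>\<^bsub>add_monoid N.T\<^esub> g D"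
      by simp
  next
    fix C assume "C \<in> carrier (add_monoid T)"
    then show "g C \<in> carrier (add_monoid N.T)"
      using g \<phi> N.cls_closed by (auto simp: carrier_tensor simp del: carrier_free_Abelian_group_iff)
  qed
  show "g (pure x m) = pure_tensor S' B' N (p x) (q m)" if "x \<in> carrier B" "m \<in> carrier M" for x m
    using g[OF frag_of_FG[OF that]] by (simp add: pure_tensor_def)
qed

end

section \<open>Bimodules of idempotents\<close>

lemma left_module_hom_imp_hom:
  "f \<in> left_module_hom R' M N \<Longrightarrow> f \<in> hom (add_monoid M) (add_monoid N)"
  by (auto simp: left_module_hom_def hom_def)

lemma left_module_hom_id:
  "left_module R' M \<Longrightarrow> (\<lambda>x\<in>carrier M. x) \<in> left_module_hom R' M M"
proof -
  assume "left_module R' M"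
  then interpret left_module R' M .
  show ?thesis
    by (auto simp: left_module_hom_def smult_closed)
qed

lemma left_module_hom_compose:
  assumes L: "left_module R' L" and f: "f \<in> left_module_hom R' L M" and g: "g \<in> left_module_hom R' M N"
  shows "compose (carrier L) g f \<in> left_module_hom R' L N"
proof -
  interpret left_module R' L
    by (rule L)
  have "f x \<in> carrier M" if "x \<in> carrier L" for x
    using f that by (auto simp: left_module_hom_def)
  then show ?thesis
    using f g by (auto simp: left_module_hom_def compose_def smult_closed)
qed

text \<open>Here \<open>R\<close> and \<open>S\<close> stand for the larger and the smaller algebra,
  and \<open>B\<close> is R u. The assumptions on the corner, together with the commutation of
  \<open>u\<close> with the image of \<open>\<phi>\<close>, say that s \<mapsto> \<phi>(s) u is a
  bijection from \<open>S\<close> onto u R u.\<close>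

locale idempotent_bimodule = R?: ring R + S?: ring S
  for R :: "('r, 'c) ring_scheme" and S :: "('s, 'd) ring_scheme" +
  fixes \<phi> :: "'s \<Rightarrow> 'r" and u :: 'r and B :: "('r, 's, 'r) bimodule"
  assumes \<phi>_hom: "\<phi> \<in> ring_hom S R"
    and u_closed: "u \<in> carrier R" and u_idem: "u \<otimes>\<^bsub>R\<^esub> u = u"
    and \<phi>_comm: "s \<in> carrier S \<Longrightarrow> \<phi> s \<otimes>\<^bsub>R\<^esub> u = u \<otimes>\<^bsub>R\<^esub> \<phi> s"
    and corner: "x \<in> carrier R \<Longrightarrow> \<exists>s\<in>carrier S. u \<otimes>\<^bsub>R\<^esub> x \<otimes>\<^bsub>R\<^esub> u = \<phi> s \<otimes>\<^bsub>R\<^esub> u"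
    and \<phi>_u_inj: "\<lbrakk>s \<in> carrier S; t \<in> carrier S; \<phi> s \<otimes>\<^bsub>R\<^esub> u = \<phi> t \<otimes>\<^bsub>R\<^esub> u\<rbrakk> \<Longrightarrow> s = t"
    and carrier_B: "carrier B = {x \<otimes>\<^bsub>R\<^esub> u | x. x \<in> carrier R}"
    and B_simps: "add B = add R" "module.smult B = monoid.mult R" "rsmult B x s = x \<otimes>\<^bsub>R\<^esub> \<phi> s"
begin

lemma \<phi>_closed: "s \<in> carrier S \<Longrightarrow> \<phi> s \<in> carrier R"
  using \<phi>_hom by (rule ring_hom_closed)

lemma in_carrier_B_iff: "x \<in> carrier B \<longleftrightarrow> x \<in> carrier R \<and> x \<otimes>\<^bsub>R\<^esub> u = x"
  using u_closed u_idem by (auto simp: carrier_B R.m_assoc) metis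

lemma u_in_B: "u \<in> carrier B"
  using u_closed u_idem by (simp add: in_carrier_B_iff)

lemma B_closed:
  "\<lbrakk>x \<in> carrier B; y \<in> carrier B\<rbrakk> \<Longrightarrow> x \<oplus>\<^bsub>R\<^esub> y \<in> carrier B"
  "\<lbrakk>r \<in> carrier R; x \<in> carrier B\<rbrakk> \<Longrightarrow> r \<otimes>\<^bsub>R\<^esub> x \<in> carrier B"
  "\<lbrakk>x \<in> carrier B; s \<in> carrier S\<rbrakk> \<Longrightarrow> x \<otimes>\<^bsub>R\<^esub> \<phi> s \<in> carrier B"
proof -
  show "x \<oplus>\<^bsub>R\<^esub> y \<in> carrier B" if "x \<in> carrier B" "y \<in> carrier B"
    using that u_closed by (simp add: in_carrier_B_iff R.l_distr)
  show "r \<otimes>\<^bsub>R\<^esub> x \<in> carrier B" if "r \<in> carrier R" "x \<in> carrier B"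
    using that u_closed by (simp add: in_carrier_B_iff R.m_assoc)
  show "x \<otimes>\<^bsub>R\<^esub> \<phi> s \<in> carrier B" if "x \<in> carrier B" "s \<in> carrier S"
    using that u_closed \<phi>_closed[OF that(2)] \<phi>_comm[OF that(2)]
    by (simp add: in_carrier_B_iff R.m_assoc) (simp flip: R.m_assoc)
qed

lemma tensor_product: "left_module S M \<Longrightarrow> tensor_product S B M"
  by (rule tensor_product.intro) (simp_all add: B_simps B_closed)

context
  fixes M :: "('s, 'm) module"
  assumes M: "left_module S M"
begin

interpretation M: left_module S M by (rule M)

interpretation T: tensor_product S B M using M by (rule tensor_product)

interpretation T: abelian_group T.T by (rule T.abelian_group_tensor)

text \<open>Left multiplication commutes with the right action by associativity in \<open>R\<close>,
  so it induces a balanced map and \<open>tensor_lift\<close> applies.\<close>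

lemma tensor_smult:
  assumes "r \<in> carrier R"
  shows "(\<lambda>C. r \<odot>\<^bsub>T.T\<^esub> C) \<in> hom (add_monoid T.T) (add_monoid T.T)"
    and "\<And>x m. x \<in> carrier B \<Longrightarrow> m \<in> carrier M \<Longrightarrow> r \<odot>\<^bsub>T.T\<^esub> T.pure x m = T.pure (r \<otimes>\<^bsub>R\<^esub> x) m"
proof -
  have "x \<in> carrier R" if "x \<in> carrier B" for x
    using that by (simp add: in_carrier_B_iff)
  then have "balanced S B M T.T (\<lambda>x m. T.pure (r \<otimes>\<^bsub>R\<^esub> x) m)"
    using assms unfolding balanced_def B_simps
    by (simp add: T.pure_closed B_closed R.r_distr T.pure_add_left[unfolded B_simps] T.pure_add_right \<phi>_closed
        T.pure_smult[unfolded B_simps, symmetric] flip: R.m_assoc)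
  note lift = T.tensor_lift[OF T.tensor_product_axioms this]
  show "(\<lambda>C. r \<odot>\<^bsub>T.T\<^esub> C) \<in> hom (add_monoid T.T) (add_monoid T.T)"
    using lift(1) assms by (simp add: B_closed tensor_def B_simps)
  show "r \<odot>\<^bsub>T.T\<^esub> T.pure x m = T.pure (r \<otimes>\<^bsub>R\<^esub> x) m" if "x \<in> carrier B" "m \<in> carrier M" for x m
    using lift(2)[OF _ _ that] assms by (simp add: B_closed tensor_def B_simps)
qed

lemma hom_add_pointwise:
  assumes "f \<in> hom (add_monoid T.T) (add_monoid T.T)" "g \<in> hom (add_monoid T.T) (add_monoid T.T)"
  shows "(\<lambda>C. f C \<oplus>\<^bsub>T.T\<^esub> g C) \<in> hom (add_monoid T.T) (add_monoid T.T)"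
proof -
  have "f C \<in> carrier T.T" "g C \<in> carrier T.T" if "C \<in> carrier T.T" for C
    using assms that by (auto simp: hom_def)
  then show ?thesis
    using assms by (auto simp: hom_def T.a_ac)
qed

text \<open>Both sides of each remaining law are additive in the tensor, so it is enough to compare
  them on pure tensors.\<close>

lemma left_module_tensor: "left_module R T.T"
proof -
  have B_R: "x \<in> carrier R" if "x \<in> carrier B" for x
    using that by (simp add: in_carrier_B_iff)
  have closed: "a \<odot>\<^bsub>T.T\<^esub> C \<in> carrier T.T" if "a \<in> carrier R" "C \<in> carrier T.T" for a C
    using tensor_smult(1)[OF that(1)] that(2) by (auto simp: hom_def)
  have add: "a \<odot>\<^bsub>T.T\<^esub> (C \<oplus>\<^bsub>T.T\<^esub> D) = a \<odot>\<^bsub>T.T\<^esub> C \<oplus>\<^bsub>T.T\<^esub> a \<odot>\<^bsub>T.T\<^esub> D"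
    if "a \<in> carrier R" "C \<in> carrier T.T" "D \<in> carrier T.T" for a C D
    using tensor_smult(1)[OF that(1)] that(2,3) by (auto simp: hom_def)
  note eqI = T.tensor_hom_eqI[OF T.abelian_group_tensor]
  show ?thesis
  proof (intro left_module.intro left_module_axioms.intro R.ring_axioms T.abelian_group_tensor closed add)
    fix a b C
    assume *: "a \<in> carrier R" "b \<in> carrier R" "C \<in> carrier T.T"
    show "(a \<oplus>\<^bsub>R\<^esub> b) \<odot>\<^bsub>T.T\<^esub> C = a \<odot>\<^bsub>T.T\<^esub> C \<oplus>\<^bsub>T.T\<^esub> b \<odot>\<^bsub>T.T\<^esub> C"
      by (rule eqI[where f = "\<lambda>C. (a \<oplus>\<^bsub>R\<^esub> b) \<odot>\<^bsub>T.T\<^esub> C", OF _ hom_add_pointwise])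
         (use * in \<open>simp_all add: tensor_smult B_R R.l_distr B_closed T.pure_add_left[unfolded B_simps]\<close>)
    have "(\<lambda>C. a \<odot>\<^bsub>T.T\<^esub> (b \<odot>\<^bsub>T.T\<^esub> C)) \<in> hom (add_monoid T.T) (add_monoid T.T)"
      using hom_compose[OF tensor_smult(1)[OF *(2)] tensor_smult(1)[OF *(1)]] by (simp add: comp_def)
    then show "(a \<otimes>\<^bsub>R\<^esub> b) \<odot>\<^bsub>T.T\<^esub> C = a \<odot>\<^bsub>T.T\<^esub> (b \<odot>\<^bsub>T.T\<^esub> C)"
      by (rule eqI[where f = "\<lambda>C. (a \<otimes>\<^bsub>R\<^esub> b) \<odot>\<^bsub>T.T\<^esub> C", rotated])
         (use * in \<open>simp_all add: tensor_smult B_R R.m_assoc B_closed\<close>)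
  next
    fix C assume "C \<in> carrier T.T"
    show "\<one>\<^bsub>R\<^esub> \<odot>\<^bsub>T.T\<^esub> C = C"
      by (rule eqI[OF tensor_smult(1)[OF R.one_closed], where g = "\<lambda>C. C"])
         (use \<open>C \<in> carrier T.T\<close> in \<open>simp_all add: tensor_smult(2) B_R hom_def\<close>)
  qed
qed

end

section \<open>Functoriality of the tensor product\<close>

lemma tensor_map_hom:
  assumes M: "left_module S M" and N: "left_module S N" and f: "f \<in> left_module_hom S M N"
  shows "tensor_map S B M N f \<in> left_module_hom R (tensor S B M) (tensor S B N)"
    and "\<And>x m. x \<in> carrier B \<Longrightarrow> m \<in> carrier M \<Longrightarrow>
      tensor_map S B M N f (pure_tensor S B M x m) = pure_tensor S B N x (f m)"
proof -
  interpret M: tensor_product S B M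
    using M by (rule tensor_product)
  interpret N: tensor_product S B N
    using N by (rule tensor_product)
  interpret TM: left_module R M.T
    using M by (rule left_module_tensor)
  interpret TN: left_module R N.T
    using N by (rule left_module_tensor)
  have fN: "f m \<in> carrier N" if "m \<in> carrier M" for m
    using f that by (auto simp: left_module_hom_def)
  let ?g = "\<lambda>C. \<Union>z\<in>C. N.cls (frag_extend (\<lambda>(x, m). frag_of (x, f m)) z)"
  have "balanced S B M N.T (\<lambda>x m. N.pure x (f m))"
    using f fN unfolding balanced_def left_module_hom_def
    by (simp add: N.pure_closed N.pure_add_left N.pure_add_right N.pure_smult)
  note lift = M.tensor_lift[OF N.tensor_product_axioms this]
  have hom: "?g \<in> hom (add_monoid M.T) (add_monoid N.T)"
    and pure: "\<And>x m. x \<in> carrier B \<Longrightarrow> m \<in> carrier M \<Longrightarrow> ?g (M.pure x m) = N.pure x (f m)"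
    using lift fN by simp_all
  have tm: "tensor_map S B M N f C = ?g C" if "C \<in> carrier M.T" for C
    using that by (simp add: tensor_map_def)
  show "tensor_map S B M N f (M.pure x m) = N.pure x (f m)" if "x \<in> carrier B" "m \<in> carrier M" for x m
    using that by (simp only: tm M.pure_closed pure)
  have g_closed: "?g C \<in> carrier N.T" if "C \<in> carrier M.T" for C
    using hom that by (auto simp: hom_def Pi_iff)
  have g_add: "?g (C \<oplus>\<^bsub>M.T\<^esub> D) = ?g C \<oplus>\<^bsub>N.T\<^esub> ?g D" if "C \<in> carrier M.T" "D \<in> carrier M.T" for C D
    using hom_mult[OF hom] that by simp
  have g_smult: "?g (r \<odot>\<^bsub>M.T\<^esub> C) = r \<odot>\<^bsub>N.T\<^esub> ?g C" if "r \<in> carrier R" "C \<in> carrier M.T" for r C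
  proof (rule M.tensor_hom_eqI[OF N.abelian_group_tensor _ _ _ that(2)])
    show "(\<lambda>C. ?g (r \<odot>\<^bsub>M.T\<^esub> C)) \<in> hom (add_monoid M.T) (add_monoid N.T)"
      using hom_compose[OF tensor_smult(1)[OF M that(1)] hom] by (simp only: comp_def)
    show "(\<lambda>C. r \<odot>\<^bsub>N.T\<^esub> ?g C) \<in> hom (add_monoid M.T) (add_monoid N.T)"
      using hom_compose[OF hom tensor_smult(1)[OF N that(1)]] by (simp only: comp_def)
    fix x m assume "x \<in> carrier B" "m \<in> carrier M"
    then show "?g (r \<odot>\<^bsub>M.T\<^esub> M.pure x m) = r \<odot>\<^bsub>N.T\<^esub> ?g (M.pure x m)"
      using that(1) fN by (simp only: tensor_smult(2)[OF M] tensor_smult(2)[OF N] pure B_closed)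
  qed
  show "tensor_map S B M N f \<in> left_module_hom R M.T N.T"
    unfolding left_module_hom_def
  proof (intro CollectI conjI ballI PiE_I)
    fix C assume "C \<in> carrier M.T"
    then show "tensor_map S B M N f C \<in> carrier N.T"
      by (simp only: tm g_closed)
  next
    fix C assume "C \<notin> carrier M.T"
    then show "tensor_map S B M N f C = undefined"
      by (simp add: tensor_map_def)
  next
    fix C D assume "C \<in> carrier M.T" "D \<in> carrier M.T"
    then show "tensor_map S B M N f (C \<oplus>\<^bsub>M.T\<^esub> D) = tensor_map S B M N f C \<oplus>\<^bsub>N.T\<^esub> tensor_map S B M N f D"
      by (simp only: tm g_add TM.add.m_closed)
  next
    fix r C assume "r \<in> carrier R" "C \<in> carrier M.T"
    then show "tensor_map S B M N f (r \<odot>\<^bsub>M.T\<^esub> C) = r \<odot>\<^bsub>N.T\<^esub> tensor_map S B M N f C"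
      by (simp only: tm g_smult TM.smult_closed)
  qed
qed

lemma left_module_hom_tensor_eqI:
  assumes "left_module S M" "left_module S N"
    and f: "f \<in> left_module_hom R (tensor S B M) (tensor S B N)"
    and g: "g \<in> left_module_hom R (tensor S B M) (tensor S B N)"
    and "\<And>x m. x \<in> carrier B \<Longrightarrow> m \<in> carrier M \<Longrightarrow> f (pure_tensor S B M x m) = g (pure_tensor S B M x m)"
  shows "f = g"
proof
  interpret M: tensor_product S B M
    using assms(1) by (rule tensor_product)
  interpret N: tensor_product S B N
    using assms(2) by (rule tensor_product)
  fix C show "f C = g C"
  proof (cases "C \<in> carrier M.T")
    case True
    show ?thesis
      by (rule M.tensor_hom_eqI[OF N.abelian_group_tensor _ _ _ True])
         (use assms left_module_hom_imp_hom in blast)+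
  next
    case False
    then show ?thesis
      using f g by (auto simp: left_module_hom_def PiE_def extensional_def)
  qed
qed

lemma module_functor_tensor:
  "module_functor S R (\<lambda>M :: ('s, 'm) module. tensor S B M) (tensor_map S B)"
  unfolding module_functor_def
proof (intro conjI allI impI ballI)
  fix M :: "('s, 'm) module" assume M: "left_module S M"
  show "left_module R (tensor S B M)"
    by (rule left_module_tensor[OF M])
  show "tensor_map S B M M (\<lambda>x\<in>carrier M. x) = (\<lambda>x\<in>carrier (tensor S B M). x)"
    by (rule left_module_hom_tensor_eqI[OF M M])
       (simp_all add: M tensor_map_hom left_module_hom_id left_module_tensor
        tensor_product.pure_closed[OF tensor_product[OF M]])
  fix N :: "('s, 'm) module" assume N: "left_module S N"
  show "tensor_map S B M N f \<in> left_module_hom R (tensor S B M) (tensor S B N)"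
    if "f \<in> left_module_hom S M N" for f
    by (rule tensor_map_hom(1)[OF M N that])
next
  fix L M N :: "('s, 'm) module" and f g
  assume L: "left_module S L" and M: "left_module S M" and N: "left_module S N"
    and f: "f \<in> left_module_hom S L M" and g: "g \<in> left_module_hom S M N"
  have gf: "compose (carrier L) g f \<in> left_module_hom S L N"
    by (rule left_module_hom_compose[OF L f g])
  have "f m \<in> carrier M" if "m \<in> carrier L" for m
    using f that by (auto simp: left_module_hom_def)
  then show "tensor_map S B L N (compose (carrier L) g f) =
      compose (carrier (tensor S B L)) (tensor_map S B M N g) (tensor_map S B L M f)"
    by (intro left_module_hom_tensor_eqI[OF L N])
       (simp_all add: tensor_map_hom[OF L N gf] tensor_map_hom[OF L M f] tensor_map_hom[OF M N g]
         left_module_hom_compose[OF left_module_tensor[OF L] tensor_map_hom(1)[OF L M f] tensor_map_hom(1)[OF M N g]]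
         compose_eq tensor_product.pure_closed[OF tensor_product[OF L]])
qed

text \<open>For \<open>x\<close> in \<open>B\<close> one has u x = u x u, an element of the corner,
  and \<open>\<pi> x\<close> is its unique coordinate in \<open>S\<close>. The lemmas below show
  that this is a map of \<open>S\<close>-bimodules from \<open>B\<close> to \<open>S\<close> with
  value 1 at \<open>u\<close>.\<close>

definition \<pi> :: "'r \<Rightarrow> 's" where
  "\<pi> x = (THE s. s \<in> carrier S \<and> u \<otimes>\<^bsub>R\<^esub> x = \<phi> s \<otimes>\<^bsub>R\<^esub> u)"

lemma \<pi>_eqI:
  assumes "s \<in> carrier S" "u \<otimes>\<^bsub>R\<^esub> x = \<phi> s \<otimes>\<^bsub>R\<^esub> u"
  shows "\<pi> x = s"
  unfolding \<pi>_def using assms \<phi>_u_inj by (intro the_equality) auto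

lemma \<pi>:
  assumes "x \<in> carrier B"
  shows "\<pi> x \<in> carrier S" "u \<otimes>\<^bsub>R\<^esub> x = \<phi> (\<pi> x) \<otimes>\<^bsub>R\<^esub> u"
proof -
  obtain s where s: "s \<in> carrier S" "u \<otimes>\<^bsub>R\<^esub> x \<otimes>\<^bsub>R\<^esub> u = \<phi> s \<otimes>\<^bsub>R\<^esub> u"
    using corner assms in_carrier_B_iff by blast
  then have "u \<otimes>\<^bsub>R\<^esub> x = \<phi> s \<otimes>\<^bsub>R\<^esub> u"
    using assms u_closed by (simp add: in_carrier_B_iff R.m_assoc)
  then show "\<pi> x \<in> carrier S" "u \<otimes>\<^bsub>R\<^esub> x = \<phi> (\<pi> x) \<otimes>\<^bsub>R\<^esub> u"
    using s(1) \<pi>_eqI by simp_all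
qed

lemma \<pi>_add:
  assumes "x \<in> carrier B" "y \<in> carrier B"
  shows "\<pi> (x \<oplus>\<^bsub>R\<^esub> y) = \<pi> x \<oplus>\<^bsub>S\<^esub> \<pi> y"
  using assms \<pi>[OF assms(1)] \<pi>[OF assms(2)]
  by (intro \<pi>_eqI) (simp_all add: in_carrier_B_iff u_closed R.r_distr R.l_distr \<phi>_closed ring_hom_add[OF \<phi>_hom])

lemma \<pi>_right:
  assumes "x \<in> carrier B" "s \<in> carrier S"
  shows "\<pi> (x \<otimes>\<^bsub>R\<^esub> \<phi> s) = \<pi> x \<otimes>\<^bsub>S\<^esub> s"
proof (rule \<pi>_eqI)
  show "\<pi> x \<otimes>\<^bsub>S\<^esub> s \<in> carrier S"
    using \<pi>(1)[OF assms(1)] assms(2) by simp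
  have "u \<otimes>\<^bsub>R\<^esub> (x \<otimes>\<^bsub>R\<^esub> \<phi> s) = (u \<otimes>\<^bsub>R\<^esub> x) \<otimes>\<^bsub>R\<^esub> \<phi> s"
    using assms u_closed \<phi>_closed by (simp add: in_carrier_B_iff R.m_assoc)
  also have "\<dots> = \<phi> (\<pi> x) \<otimes>\<^bsub>R\<^esub> (u \<otimes>\<^bsub>R\<^esub> \<phi> s)"
    using assms \<pi>[OF assms(1)] u_closed \<phi>_closed by (simp add: R.m_assoc)
  also have "\<dots> = \<phi> (\<pi> x \<otimes>\<^bsub>S\<^esub> s) \<otimes>\<^bsub>R\<^esub> u"
    using assms \<pi>(1)[OF assms(1)] u_closed \<phi>_closed
    by (simp add: R.m_assoc ring_hom_mult[OF \<phi>_hom] flip: \<phi>_comm)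
  finally show "u \<otimes>\<^bsub>R\<^esub> (x \<otimes>\<^bsub>R\<^esub> \<phi> s) = \<phi> (\<pi> x \<otimes>\<^bsub>S\<^esub> s) \<otimes>\<^bsub>R\<^esub> u" .
qed

lemma \<pi>_left:
  assumes "x \<in> carrier B" "s \<in> carrier S"
  shows "\<pi> (\<phi> s \<otimes>\<^bsub>R\<^esub> x) = s \<otimes>\<^bsub>S\<^esub> \<pi> x"
proof (rule \<pi>_eqI)
  show "s \<otimes>\<^bsub>S\<^esub> \<pi> x \<in> carrier S"
    using \<pi>(1)[OF assms(1)] assms(2) by simp
  have "u \<otimes>\<^bsub>R\<^esub> (\<phi> s \<otimes>\<^bsub>R\<^esub> x) = (\<phi> s \<otimes>\<^bsub>R\<^esub> u) \<otimes>\<^bsub>R\<^esub> x"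
    using assms u_closed \<phi>_closed by (simp add: in_carrier_B_iff R.m_assoc \<phi>_comm)
  also have "\<dots> = \<phi> s \<otimes>\<^bsub>R\<^esub> (\<phi> (\<pi> x) \<otimes>\<^bsub>R\<^esub> u)"
    using assms u_closed \<phi>_closed by (simp add: in_carrier_B_iff R.m_assoc \<pi>(2)[OF assms(1), symmetric])
  also have "\<dots> = \<phi> (s \<otimes>\<^bsub>S\<^esub> \<pi> x) \<otimes>\<^bsub>R\<^esub> u"
    using assms \<pi>(1)[OF assms(1)] u_closed \<phi>_closed by (simp add: R.m_assoc ring_hom_mult[OF \<phi>_hom])
  finally show "u \<otimes>\<^bsub>R\<^esub> (\<phi> s \<otimes>\<^bsub>R\<^esub> x) = \<phi> (s \<otimes>\<^bsub>S\<^esub> \<pi> x) \<otimes>\<^bsub>R\<^esub> u" .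
qed

lemma \<pi>_u: "\<pi> u = \<one>\<^bsub>S\<^esub>"
  by (rule \<pi>_eqI) (simp_all add: u_idem u_closed ring_hom_one[OF \<phi>_hom])

section \<open>Recovering a module from its induced module\<close>

context
  fixes N :: "('s, 'm) module"
  assumes N: "left_module S N"
begin

interpretation N: left_module S N by (rule N)

interpretation T: tensor_product S B N using N by (rule tensor_product)

interpretation T: left_module R T.T using N by (rule left_module_tensor)

text \<open>The map is x \<otimes> m \<mapsto> \<pi>(x) m. It inverts m \<mapsto> u \<otimes> m on
  the summand u (B \<otimes> N) and absorbs the projection C \<mapsto> u C elsewhere. The second
  property yields faithfulness, the last two yield fullness.\<close>

lemma tensor_retraction:
  obtains \<psi> where "\<psi> \<in> hom (add_monoid T.T) (add_monoid N)"
    and "\<And>m. m \<in> carrier N \<Longrightarrow> \<psi> (T.pure u m) = m"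
    and "\<And>s C. s \<in> carrier S \<Longrightarrow> C \<in> carrier T.T \<Longrightarrow> \<psi> (\<phi> s \<odot>\<^bsub>T.T\<^esub> C) = s \<odot>\<^bsub>N\<^esub> \<psi> C"
    and "\<And>C. C \<in> carrier T.T \<Longrightarrow> T.pure u (\<psi> C) = u \<odot>\<^bsub>T.T\<^esub> C"
proof -
  have "balanced S B N N (\<lambda>x m. \<pi> x \<odot>\<^bsub>N\<^esub> m)"
    unfolding balanced_def B_simps
    by (simp add: \<pi> \<pi>_add \<pi>_right N.smult_closed N.smult_l_distr N.smult_r_distr N.smult_assoc)
  then obtain \<psi> where \<psi>: "\<psi> \<in> hom (add_monoid T.T) (add_monoid N)"
      "\<And>x m. x \<in> carrier B \<Longrightarrow> m \<in> carrier N \<Longrightarrow> \<psi> (T.pure x m) = \<pi> x \<odot>\<^bsub>N\<^esub> m"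
    using T.tensor_universal[OF N.abelian_group_axioms] by blast
  show thesis
  proof (rule that[OF \<psi>(1)])
    show "\<psi> (T.pure u m) = m" if "m \<in> carrier N" for m
      using \<psi>(2)[OF u_in_B that] that by (simp add: \<pi>_u N.smult_one)
    show "\<psi> (\<phi> s \<odot>\<^bsub>T.T\<^esub> C) = s \<odot>\<^bsub>N\<^esub> \<psi> C" if s: "s \<in> carrier S" and C: "C \<in> carrier T.T" for s C
    proof (rule T.tensor_hom_eqI[OF N.abelian_group_axioms _ _ _ C])
      show "(\<lambda>C. \<psi> (\<phi> s \<odot>\<^bsub>T.T\<^esub> C)) \<in> hom (add_monoid T.T) (add_monoid N)"
        using hom_compose[OF tensor_smult(1)[OF N \<phi>_closed[OF s]] \<psi>(1)] by (simp only: comp_def)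
      show "(\<lambda>C. s \<odot>\<^bsub>N\<^esub> \<psi> C) \<in> hom (add_monoid T.T) (add_monoid N)"
        using \<psi>(1) s by (auto simp: hom_def N.smult_closed N.smult_r_distr Pi_iff)
      fix x m assume "x \<in> carrier B" "m \<in> carrier N"
      then show "\<psi> (\<phi> s \<odot>\<^bsub>T.T\<^esub> T.pure x m) = s \<odot>\<^bsub>N\<^esub> \<psi> (T.pure x m)"
        using s by (simp add: tensor_smult(2)[OF N] \<psi>(2) B_closed \<phi>_closed \<pi>_left \<pi> N.smult_assoc)
    qed
    show "T.pure u (\<psi> C) = u \<odot>\<^bsub>T.T\<^esub> C" if C: "C \<in> carrier T.T" for C
    proof (rule T.tensor_hom_eqI[OF T.abelian_group_tensor _ _ _ C])
      show "(\<lambda>C. T.pure u (\<psi> C)) \<in> hom (add_monoid T.T) (add_monoid T.T)"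
        using \<psi>(1) u_in_B by (auto simp: hom_def T.pure_closed T.pure_add_right Pi_iff)
      show "(\<lambda>C. u \<odot>\<^bsub>T.T\<^esub> C) \<in> hom (add_monoid T.T) (add_monoid T.T)"
        by (rule tensor_smult(1)[OF N u_closed])
      fix x m assume *: "x \<in> carrier B" "m \<in> carrier N"
      \<comment> \<open>Moving \<open>\<pi> x\<close> across the tensor sign gives u \<phi>(\<pi> x)
        \<otimes> m, and u \<phi>(\<pi> x) = \<phi>(\<pi> x) u = u x.\<close>
      have "T.pure u (\<psi> (T.pure x m)) = T.pure (u \<otimes>\<^bsub>R\<^esub> \<phi> (\<pi> x)) m"
        using * T.pure_smult[OF u_in_B \<pi>(1)[OF *(1)] *(2)] by (simp add: \<psi>(2) B_simps)
      then show "T.pure u (\<psi> (T.pure x m)) = u \<odot>\<^bsub>T.T\<^esub> T.pure x m"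
        using * by (simp add: tensor_smult(2)[OF N u_closed] \<pi> \<phi>_comm)
    qed
  qed
qed

end

text \<open>
  The inverse of the action on homomorphisms: \<open>m \<mapsto> u \<otimes> m\<close> identifies \<open>M\<close> with \<open>u (B \<otimes> M)\<close>, which
  every homomorphism of \<open>R\<close>-modules respects.
\<close>

lemma tensor_map_surj:
  assumes M: "left_module S M" and N: "left_module S N"
    and g: "g \<in> left_module_hom R (tensor S B M) (tensor S B N)"
  shows "\<exists>f \<in> left_module_hom S M N. tensor_map S B M N f = g"
proof -
  interpret M: tensor_product S B M
    using M by (rule tensor_product)
  interpret N: tensor_product S B N
    using N by (rule tensor_product)
  interpret LM: left_module S M
    by (rule M)
  interpret TM: left_module R M.T
    using M by (rule left_module_tensor)
  interpret TN: left_module R N.T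
    using N by (rule left_module_tensor)
  obtain \<psi> where \<psi>: "\<psi> \<in> hom (add_monoid N.T) (add_monoid N)"
    "\<And>s C. s \<in> carrier S \<Longrightarrow> C \<in> carrier N.T \<Longrightarrow> \<psi> (\<phi> s \<odot>\<^bsub>N.T\<^esub> C) = s \<odot>\<^bsub>N\<^esub> \<psi> C"
    "\<And>C. C \<in> carrier N.T \<Longrightarrow> N.pure u (\<psi> C) = u \<odot>\<^bsub>N.T\<^esub> C"
    using tensor_retraction[OF N] by metis
  have g_closed: "g C \<in> carrier N.T" if "C \<in> carrier M.T" for C
    using g that by (auto simp: left_module_hom_def)
  have g_add: "g (C \<oplus>\<^bsub>M.T\<^esub> D) = g C \<oplus>\<^bsub>N.T\<^esub> g D" if "C \<in> carrier M.T" "D \<in> carrier M.T" for C D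
    using g that by (auto simp: left_module_hom_def)
  have g_smult: "g (r \<odot>\<^bsub>M.T\<^esub> C) = r \<odot>\<^bsub>N.T\<^esub> g C" if "r \<in> carrier R" "C \<in> carrier M.T" for r C
    using g that by (auto simp: left_module_hom_def)
  have \<psi>_closed: "\<psi> C \<in> carrier N" if "C \<in> carrier N.T" for C
    using \<psi>(1) that by (auto simp: hom_def)
  have \<psi>_add: "\<psi> (C \<oplus>\<^bsub>N.T\<^esub> D) = \<psi> C \<oplus>\<^bsub>N\<^esub> \<psi> D" if "C \<in> carrier N.T" "D \<in> carrier N.T" for C D
    using \<psi>(1) that by (auto simp: hom_def)
  define f where "f = (\<lambda>m\<in>carrier M. \<psi> (g (M.pure u m)))"
  \<comment> \<open>The action of s on m becomes the action of \<phi>(s) on u \<otimes> m, because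
    \<phi>(s) commutes with u. Hence \<open>R\<close>-linearity of \<open>g\<close> gives
    \<open>S\<close>-linearity of \<open>f\<close>.\<close>
  have pure_u: "M.pure u (s \<odot>\<^bsub>M\<^esub> m) = \<phi> s \<odot>\<^bsub>M.T\<^esub> M.pure u m" if "s \<in> carrier S" "m \<in> carrier M" for s m
    using M.pure_smult[OF u_in_B that] that
    by (simp add: B_simps tensor_smult(2)[OF M] \<phi>_closed u_in_B \<phi>_comm)
  have f: "f \<in> left_module_hom S M N"
    unfolding left_module_hom_def f_def
    using u_in_B by (auto simp: M.pure_closed g_closed \<psi>_closed LM.smult_closed M.pure_add_right g_add \<psi>_add
        pure_u g_smult \<phi>_closed \<psi>(2))
  have "tensor_map S B M N f = g"
  proof (rule left_module_hom_tensor_eqI[OF M N tensor_map_hom(1)[OF M N f] g])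
    fix x m assume *: "x \<in> carrier B" "m \<in> carrier M"
    then have x: "x \<in> carrier R" "x \<otimes>\<^bsub>R\<^esub> u = x"
      by (simp_all add: in_carrier_B_iff)
    have m: "M.pure u m \<in> carrier M.T" "f m \<in> carrier N"
      using * f u_in_B by (auto simp: M.pure_closed left_module_hom_def)
    have "tensor_map S B M N f (M.pure x m) = N.pure x (f m)"
      by (rule tensor_map_hom(2)[OF M N f *])
    also have "\<dots> = x \<odot>\<^bsub>N.T\<^esub> N.pure u (f m)"
      using m x by (simp add: tensor_smult(2)[OF N] u_in_B)
    also have "N.pure u (f m) = g (u \<odot>\<^bsub>M.T\<^esub> M.pure u m)"
      using * m by (simp add: f_def \<psi>(3) g_closed g_smult u_closed)
    also have "u \<odot>\<^bsub>M.T\<^esub> M.pure u m = M.pure u m"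
      using * by (simp add: tensor_smult(2)[OF M] u_in_B u_closed u_idem)
    also have "x \<odot>\<^bsub>N.T\<^esub> g (M.pure u m) = g (x \<odot>\<^bsub>M.T\<^esub> M.pure u m)"
      using m x by (simp add: g_smult)
    also have "x \<odot>\<^bsub>M.T\<^esub> M.pure u m = M.pure x m"
      using * x by (simp add: tensor_smult(2)[OF M] u_in_B)
    finally show "tensor_map S B M N f (M.pure x m) = g (M.pure x m)" .
  qed
  with f show ?thesis
    by blast
qed

text \<open>The induced map sends u \<otimes> m to u \<otimes> f(m), from which the retraction
  recovers f(m).\<close>

lemma tensor_map_inj:
  assumes M: "left_module S M" and N: "left_module S N"
  shows "inj_on (tensor_map S B M N) (left_module_hom S M N)"
proof (rule inj_onI)
  interpret N: tensor_product S B N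
    using N by (rule tensor_product)
  obtain \<psi> where \<psi>: "\<And>m. m \<in> carrier N \<Longrightarrow> \<psi> (N.pure u m) = m"
    using tensor_retraction[OF N] by metis
  fix f g
  assume fg: "f \<in> left_module_hom S M N" "g \<in> left_module_hom S M N"
    "tensor_map S B M N f = tensor_map S B M N g"
  have "f \<in> carrier M \<rightarrow>\<^sub>E carrier N" "g \<in> carrier M \<rightarrow>\<^sub>E carrier N"
    using fg by (simp_all add: left_module_hom_def)
  then show "f = g"
  proof (rule PiE_ext)
    fix m assume m: "m \<in> carrier M"
    then have "f m \<in> carrier N" "g m \<in> carrier N"
      using fg by (auto simp: left_module_hom_def)
    moreover have "N.pure u (f m) = N.pure u (g m)"
      using tensor_map_hom(2)[OF M N fg(1) u_in_B m] tensor_map_hom(2)[OF M N fg(2) u_in_B m] fg(3) by simp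
    ultimately show "f m = g m"
      using \<psi> by metis
  qed
qed

theorem fully_faithful_functor_tensor:
  "fully_faithful_functor S R (\<lambda>M :: ('s, 'm) module. tensor S B M) (tensor_map S B)"
  unfolding fully_faithful_functor_def
proof (intro conjI allI impI module_functor_tensor)
  fix M N :: "('s, 'm) module" assume MN: "left_module S M" "left_module S N"
  show "bij_betw (tensor_map S B M N) (left_module_hom S M N) (left_module_hom R (tensor S B M) (tensor S B N))"
    using tensor_map_inj[OF MN] tensor_map_surj[OF MN] tensor_map_hom(1)[OF MN]
    by (auto simp: bij_betw_def image_iff)
qed

end

section \<open>Partition algebras\<close>

lemma part_tuples_iff:
  "a \<in> part_tuples n T po \<longleftrightarrow>
     a \<in> T \<rightarrow>\<^sub>E parts n \<and> (\<forall>t\<in>T. \<forall>t'\<in>T. (t, t') \<in> po \<longrightarrow> a t \<subseteq> a t')"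
  unfolding part_tuples_def by (auto simp: refinement_of_iff PiE_mem) (meson PiE_mem refinement_of_iff subsetD)+

lemma finite_part_tuples: "finite T \<Longrightarrow> finite (part_tuples n T po)"
  by (rule finite_subset[of _ "T \<rightarrow>\<^sub>E parts n"])
     (simp_all add: part_tuples_def subset_iff finite_PiE finite_parts)

lemma part_tuples_parts: "a \<in> part_tuples n T po \<Longrightarrow> t \<in> T \<Longrightarrow> a t \<in> parts n"
  by (auto simp: part_tuples_iff PiE_mem)

lemma part_tuples_mono: "a \<in> part_tuples n T po \<Longrightarrow> t \<in> T \<Longrightarrow> t' \<in> T \<Longrightarrow> (t, t') \<in> po \<Longrightarrow> a t \<subseteq> a t'"
  by (simp add: part_tuples_iff)

lemma part_tuplesI:
  assumes "\<And>t. t \<in> T \<Longrightarrow> a t \<in> parts n"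
    and "\<And>t t'. t \<in> T \<Longrightarrow> t' \<in> T \<Longrightarrow> (t, t') \<in> po \<Longrightarrow> a t \<subseteq> a t'"
  shows "(\<lambda>t\<in>T. a t) \<in> part_tuples n T po"
  using assms by (simp add: part_tuples_iff)

lemma part_tuples_map:
  assumes "a \<in> part_tuples m T po" "\<And>x. x \<in> parts m \<Longrightarrow> F x \<in> parts n"
    and "\<And>x y. x \<subseteq> y \<Longrightarrow> F x \<subseteq> F y"
  shows "(\<lambda>t\<in>T. F (a t)) \<in> part_tuples n T po"
  by (intro part_tuplesI assms(2,3) part_tuples_parts[OF assms(1)] part_tuples_mono[OF assms(1)])

lemma part_tuples_const: "c \<in> parts n \<Longrightarrow> (\<lambda>t\<in>T. c) \<in> part_tuples n T po"
  by (auto simp: part_tuples_iff)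

lemma part_tuples_restrict: "a \<in> part_tuples n T po \<Longrightarrow> (\<lambda>t\<in>T. a t) = a"
  by (metis PiE_restrict part_tuples_iff)

abbreviation tuple_comp :: "nat \<Rightarrow> 't set \<Rightarrow> ('t \<Rightarrow> prel) \<Rightarrow> ('t \<Rightarrow> prel) \<Rightarrow> 't \<Rightarrow> prel" where
  "tuple_comp n T a b \<equiv> \<lambda>t\<in>T. part_comp n (a t) (b t)"

abbreviation tuple_weight :: "nat \<Rightarrow> 't set \<Rightarrow> ('t \<Rightarrow> 'k::field) \<Rightarrow> ('t \<Rightarrow> prel) \<Rightarrow> ('t \<Rightarrow> prel) \<Rightarrow> 'k" where
  "tuple_weight n T Q a b \<equiv> \<Prod>t\<in>T. Q t ^ loops n (a t) (b t)"

lemma tuple_comp_closed: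
  assumes "a \<in> part_tuples n T po" "b \<in> part_tuples n T po"
  shows "tuple_comp n T a b \<in> part_tuples n T po"
  by (intro part_tuplesI part_comp_in_parts part_comp_mono part_tuples_parts[OF assms(1)]
      part_tuples_parts[OF assms(2)] part_tuples_mono[OF assms(1)] part_tuples_mono[OF assms(2)])

lemma twisted_algebra_part_algebra:
  assumes "finite T"
  shows "twisted_algebra (part_tuples n T po) (tuple_comp n T) (tuple_weight n T Q) (\<lambda>t\<in>T. part_one n)
    (part_algebra n T po Q)"
proof (unfold_locales, unfold part_algebra_def)
  fix a b c
  assume abc: "a \<in> part_tuples n T po" "b \<in> part_tuples n T po" "c \<in> part_tuples n T po"
  show "tuple_comp n T (tuple_comp n T a b) c = tuple_comp n T a (tuple_comp n T b c)"
    using abc by (intro restrict_ext) (simp add: part_comp_assoc part_tuples_parts)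
  show "tuple_weight n T Q a b * tuple_weight n T Q (tuple_comp n T a b) c =
      tuple_weight n T Q b c * tuple_weight n T Q a (tuple_comp n T b c)"
    unfolding prod.distrib[symmetric] using abc
    by (intro prod.cong refl) (simp add: part_tuples_parts loops_cocycle flip: power_add)
next
  fix a assume a: "a \<in> part_tuples n T po"
  have *: "loops n (part_one n) (a t) = 0" "part_comp n (part_one n) (a t) = a t"
      "loops n (a t) (part_one n) = 0" "part_comp n (a t) (part_one n) = a t" if "t \<in> T" for t
    using part_one_comp[OF part_tuples_parts[OF a that]] by simp_all
  have "tuple_comp n T (\<lambda>t\<in>T. part_one n) a = (\<lambda>t\<in>T. a t)" "tuple_comp n T a (\<lambda>t\<in>T. part_one n) = (\<lambda>t\<in>T. a t)"
    by (auto intro!: restrict_ext simp: *)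
  then show "tuple_comp n T (\<lambda>t\<in>T. part_one n) a = a" "tuple_comp n T a (\<lambda>t\<in>T. part_one n) = a"
    using a by (simp_all add: part_tuples_restrict)
  show "tuple_weight n T Q (\<lambda>t\<in>T. part_one n) a = 1" "tuple_weight n T Q a (\<lambda>t\<in>T. part_one n) = 1"
    by (auto intro!: prod.neutral simp: *)
qed (simp_all add: finite_part_tuples assms tuple_comp_closed part_tuples_const part_one_in_parts)

lemma part_core_split: "a \<in> parts m \<Longrightarrow> part_core m (part_split (Suc m) a) = a"
  using parts_subset[of a m] by (auto simp: part_core_def part_split_def)

locale part_corner =
  fixes m :: nat and T :: "'t set" and po :: "'t rel" and Q :: "'t \<Rightarrow> 'k::field"
  assumes fin: "finite T" and Q: "(\<Prod>t\<in>T. Q t) \<noteq> 0"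
begin

abbreviation "P \<equiv> part_algebra (Suc m) T po Q"
abbreviation "P' \<equiv> part_algebra m T po Q"
abbreviation "\<phi> \<equiv> part_embed (Suc m) T po :: _ \<Rightarrow> _ \<Rightarrow> 'k"
abbreviation "e \<equiv> eT (Suc m) T :: _ \<Rightarrow> 'k"
abbreviation "q \<equiv> \<Prod>t\<in>T. Q t"
abbreviation "tuples \<equiv> part_tuples (Suc m) T po"
abbreviation "tuples' \<equiv> part_tuples m T po"
abbreviation "extend_tuple \<equiv> \<lambda>a. \<lambda>t\<in>T. part_extend (Suc m) (a t)"
abbreviation "split_tuple \<equiv> \<lambda>a. \<lambda>t\<in>T. part_split (Suc m) (a t)"
abbreviation "A_tuple \<equiv> \<lambda>t\<in>T. part_A (Suc m)"

interpretation P: twisted_algebra tuples "tuple_comp (Suc m) T" "tuple_weight (Suc m) T Q" "\<lambda>t\<in>T. part_one (Suc m)" P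
  by (rule twisted_algebra_part_algebra[OF fin])

interpretation P': twisted_algebra tuples' "tuple_comp m T" "tuple_weight m T Q" "\<lambda>t\<in>T. part_one m" P'
  by (rule twisted_algebra_part_algebra[OF fin])

interpretation R: ring P by (rule P.ring_P)

interpretation R': ring P' by (rule P'.ring_P)

lemma \<phi>_eq: "\<phi> = lin_ext tuples' extend_tuple"
  by (simp add: part_embed_def lin_ext_def fun_eq_iff)

lemma A_tuple: "A_tuple \<in> tuples"
  by (intro part_tuples_const part_A_in_parts)

lemma e_closed: "e \<in> carrier P"
  unfolding eT_def by (intro P.basis_vec_closed A_tuple)

lemma extend_tuples: "extend_tuple ` tuples' \<subseteq> tuples"
  by (intro image_subsetI part_tuples_map part_extend_in_parts) (auto simp: part_extend_def)

lemma \<phi>_closed: "\<phi> y \<in> carrier P"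
  unfolding \<phi>_eq by (intro P.lin_ext_closed extend_tuples)

lemma ring_hom_part_embed: "\<phi> \<in> ring_hom P' P"
proof (rule ring_hom_memI)
  fix x y
  show "\<phi> (x \<otimes>\<^bsub>P'\<^esub> y) = \<phi> x \<otimes>\<^bsub>P\<^esub> \<phi> y"
    unfolding \<phi>_eq
    by (rule twisted_algebra_lin_ext_mult[symmetric, OF P.twisted_algebra_axioms P'.twisted_algebra_axioms extend_tuples])
       (auto intro!: restrict_ext prod.cong simp: part_comp_extend_extend part_tuples_parts)
  show "\<phi> (x \<oplus>\<^bsub>P'\<^esub> y) = \<phi> x \<oplus>\<^bsub>P\<^esub> \<phi> y"
    by (simp add: \<phi>_eq P.P_simps P'.P_simps lin_ext_add)
next
  have "part_extend (Suc m) (part_one m) = part_one (Suc m)"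
    by (auto simp: part_extend_def part_one_def)
  then show "\<phi> \<one>\<^bsub>P'\<^esub> = \<one>\<^bsub>P\<^esub>"
    by (simp add: \<phi>_eq P.P_simps P'.P_simps lin_ext_basis_vec P'.finite_B P'.one_closed cong: restrict_cong)
qed (rule \<phi>_closed)

lemma \<phi>_smult: "\<phi> (x \<odot>\<^bsub>P'\<^esub> y) = x \<odot>\<^bsub>P\<^esub> \<phi> y"
  by (simp add: \<phi>_eq P.P_simps P'.P_simps lin_ext_smult)

text \<open>On either side, multiplication by $A^n$ turns extended partitions into split ones
  without creating loops, so every weight is 1. The common value also shows that the embedded
  subalgebra commutes with e^T.\<close>

lemma \<phi>_e:
  "\<phi> y \<otimes>\<^bsub>P\<^esub> e = lin_ext tuples' split_tuple y" "e \<otimes>\<^bsub>P\<^esub> \<phi> y = lin_ext tuples' split_tuple y"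
proof -
  have "lin_ext tuples' (\<lambda>a. tuple_comp (Suc m) T (extend_tuple a) A_tuple)
      (\<lambda>a. y a * tuple_weight (Suc m) T Q (extend_tuple a) A_tuple) = lin_ext tuples' split_tuple y"
    "lin_ext tuples' (\<lambda>a. tuple_comp (Suc m) T A_tuple (extend_tuple a))
      (\<lambda>a. y a * tuple_weight (Suc m) T Q A_tuple (extend_tuple a)) = lin_ext tuples' split_tuple y"
    by (auto simp: lin_ext_def fun_eq_iff part_comp_extend_A part_tuples_parts
        intro!: sum.cong arg_cong2[of _ _ _ _ "(*)"] arg_cong[of _ _ "\<lambda>x. basis_vec x _"] restrict_ext)
  then show "\<phi> y \<otimes>\<^bsub>P\<^esub> e = lin_ext tuples' split_tuple y" "e \<otimes>\<^bsub>P\<^esub> \<phi> y = lin_ext tuples' split_tuple y"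
    unfolding \<phi>_eq eT_def
    by (simp_all only: P.lin_ext_mult_basis_vec[OF extend_tuples A_tuple] P.basis_vec_mult_lin_ext[OF extend_tuples A_tuple])
qed

lemma e_e: "e \<otimes>\<^bsub>P\<^esub> e = q \<odot>\<^bsub>P\<^esub> e"
proof -
  have "tuple_comp (Suc m) T A_tuple A_tuple = A_tuple" "tuple_weight (Suc m) T Q A_tuple A_tuple = q"
    by (auto intro!: restrict_ext prod.cong simp: part_comp_A_A)
  then show ?thesis
    unfolding eT_def P.basis_vec_mult[OF A_tuple A_tuple] by (simp only:)
qed

text \<open>A basis tuple a yields a scalar multiple of the tuple A a A, which is the split of its
  core. As the core is monotone, these cores form tuples for the smaller algebra.\<close>

lemma e_x_e:
  assumes "x \<in> carrier P"
  shows "\<exists>y\<in>carrier P'. e \<otimes>\<^bsub>P\<^esub> x \<otimes>\<^bsub>P\<^esub> e = \<phi> y \<otimes>\<^bsub>P\<^esub> e"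
proof -
  define F where "F = (\<lambda>a. tuple_comp (Suc m) T (tuple_comp (Suc m) T A_tuple a) A_tuple)"
  define G where "G = (\<lambda>a. \<lambda>t\<in>T. part_core m (F a t))"
  have F1: "(\<lambda>a. tuple_comp (Suc m) T A_tuple a) ` tuples \<subseteq> tuples"
    using A_tuple tuple_comp_closed by blast
  then have F: "F a \<in> tuples" if "a \<in> tuples" for a
    using that A_tuple tuple_comp_closed unfolding F_def by blast
  have G: "G ` tuples \<subseteq> tuples'"
    unfolding G_def by (intro image_subsetI part_tuples_map[OF F] part_core_in_parts part_core_mono)
  have "(\<lambda>a. a) ` tuples \<subseteq> tuples"
    by simp
  note P.basis_vec_mult_lin_ext[OF this A_tuple, of x, unfolded P.lin_ext_id[OF assms]]
  \<comment> \<open>The function \<open>y\<close> consists of the coefficients of \<open>x\<close>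
    multiplied by the two loop weights.\<close>
  then obtain y where y: "e \<otimes>\<^bsub>P\<^esub> x \<otimes>\<^bsub>P\<^esub> e = lin_ext tuples F y"
    unfolding eT_def F_def by (simp only: P.lin_ext_mult_basis_vec[OF F1 A_tuple])
  have FG: "F a = (split_tuple \<circ> G) a" if "a \<in> tuples" for a
    unfolding F_def G_def comp_def
    by (intro restrict_ext) (simp, rule part_comp_A_both, rule part_tuples_parts[OF that])
  have "lin_ext tuples F y = lin_ext tuples (split_tuple \<circ> G) y"
    unfolding lin_ext_def by (intro ext sum.cong refl) (simp only: FG)
  also have "\<dots> = lin_ext tuples' split_tuple (lin_ext tuples G y)"
    by (rule lin_ext_lin_ext[symmetric, OF P'.finite_B G])
  finally have "e \<otimes>\<^bsub>P\<^esub> x \<otimes>\<^bsub>P\<^esub> e = \<phi> (lin_ext tuples G y) \<otimes>\<^bsub>P\<^esub> e"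
    by (simp only: y \<phi>_e)
  then show ?thesis
    using P'.lin_ext_closed[OF G] by blast
qed

text \<open>By \<open>\<phi>_e\<close> both products are push-forwards along splitting, which is
  injective on tuples, so the coefficients can be read off.\<close>

lemma \<phi>_e_inj:
  assumes "y \<in> carrier P'" "z \<in> carrier P'" "\<phi> y \<otimes>\<^bsub>P\<^esub> e = \<phi> z \<otimes>\<^bsub>P\<^esub> e"
  shows "y = z"
proof
  fix a
  have inj: "inj_on split_tuple tuples'"
  proof (rule inj_onI, rule ext)
    fix a b t assume ab: "a \<in> tuples'" "b \<in> tuples'" "split_tuple a = split_tuple b"
    show "a t = b t"
    proof (cases "t \<in> T")
      case True
      then have "part_split (Suc m) (a t) = part_split (Suc m) (b t)"
        using fun_cong[OF ab(3), of t] by simp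
      then show ?thesis
        using ab True part_core_split part_tuples_parts by metis
    next
      case False
      then show ?thesis
        using ab by (auto simp: part_tuples_iff PiE_def extensional_def)
    qed
  qed
  show "y a = z a"
  proof (cases "a \<in> tuples'")
    case True
    then show ?thesis
      using lin_ext_inj[OF P'.finite_B inj True] assms(3) unfolding \<phi>_e by metis
  next
    case False
    then show ?thesis
      using assms(1,2) by (simp add: P'.carrier_P)
  qed
qed

abbreviation "u \<equiv> inverse q \<odot>\<^bsub>P\<^esub> e"

lemma P_smult_smult: "a \<odot>\<^bsub>P\<^esub> (b \<odot>\<^bsub>P\<^esub> x) = (a * b) \<odot>\<^bsub>P\<^esub> x" "1 \<odot>\<^bsub>P\<^esub> x = x"
  by (simp_all add: P.P_simps mult.assoc)

lemma P_smult_closed: "x \<in> carrier P \<Longrightarrow> a \<odot>\<^bsub>P\<^esub> x \<in> carrier P"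
  by (simp add: P.P_simps P.carrier_P)

lemma P'_smult_closed: "x \<in> carrier P' \<Longrightarrow> a \<odot>\<^bsub>P'\<^esub> x \<in> carrier P'"
  by (simp add: P'.P_simps P'.carrier_P)

lemma u_idem: "u \<otimes>\<^bsub>P\<^esub> u = u"
  using Q by (simp add: P.smult_mult_P e_e P_smult_smult)

lemma e_eq: "e = q \<odot>\<^bsub>P\<^esub> u"
  using Q by (simp add: P_smult_smult)

lemma \<phi>_u_inj:
  assumes "y \<in> carrier P'" "z \<in> carrier P'" "\<phi> y \<otimes>\<^bsub>P\<^esub> u = \<phi> z \<otimes>\<^bsub>P\<^esub> u"
  shows "y = z"
proof (rule \<phi>_e_inj[OF assms(1,2)])
  have "q \<odot>\<^bsub>P\<^esub> (\<phi> y \<otimes>\<^bsub>P\<^esub> u) = q \<odot>\<^bsub>P\<^esub> (\<phi> z \<otimes>\<^bsub>P\<^esub> u)"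
    using assms(3) by simp
  then show "\<phi> y \<otimes>\<^bsub>P\<^esub> e = \<phi> z \<otimes>\<^bsub>P\<^esub> e"
    using Q by (simp add: P.smult_mult_P P_smult_smult)
qed

lemma \<phi>_e_eq_u: "\<phi> y \<otimes>\<^bsub>P\<^esub> e = \<phi> (q \<odot>\<^bsub>P'\<^esub> y) \<otimes>\<^bsub>P\<^esub> u"
  using Q by (simp add: \<phi>_smult P.smult_mult_P P_smult_smult)

lemma carrier_corner:
  "carrier (corner_algebra P e u) = {\<phi> y \<otimes>\<^bsub>P\<^esub> e | y. y \<in> carrier P'}"
proof (intro equalityI subsetI)
  fix x assume "x \<in> carrier (corner_algebra P e u)"
  then show "x \<in> {\<phi> y \<otimes>\<^bsub>P\<^esub> e | y. y \<in> carrier P'}"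
    using e_x_e by (auto simp: corner_algebra_simps)
next
  fix x assume "x \<in> {\<phi> y \<otimes>\<^bsub>P\<^esub> e | y. y \<in> carrier P'}"
  then obtain y where y: "x = \<phi> y \<otimes>\<^bsub>P\<^esub> e"
    by blast
  \<comment> \<open>Commuting brings the two factors \<open>e\<close> together, and their product
    contributes \<open>q\<close>; the factor \<open>inverse q\<close> compensates for it.\<close>
  have "e \<otimes>\<^bsub>P\<^esub> (inverse q \<odot>\<^bsub>P\<^esub> \<phi> y) \<otimes>\<^bsub>P\<^esub> e = inverse q \<odot>\<^bsub>P\<^esub> ((e \<otimes>\<^bsub>P\<^esub> \<phi> y) \<otimes>\<^bsub>P\<^esub> e)"
    by (simp add: P.smult_mult_P)
  also have "(e \<otimes>\<^bsub>P\<^esub> \<phi> y) \<otimes>\<^bsub>P\<^esub> e = \<phi> y \<otimes>\<^bsub>P\<^esub> (e \<otimes>\<^bsub>P\<^esub> e)"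
    by (simp only: \<phi>_e(2) \<phi>_e(1)[symmetric] P.mult_assoc_P)
  also have "inverse q \<odot>\<^bsub>P\<^esub> \<dots> = x"
    using Q by (simp add: y e_e P.smult_mult_P P_smult_smult)
  finally have "x = e \<otimes>\<^bsub>P\<^esub> (inverse q \<odot>\<^bsub>P\<^esub> \<phi> y) \<otimes>\<^bsub>P\<^esub> e" ..
  then show "x \<in> carrier (corner_algebra P e u)"
    using P_smult_closed[OF \<phi>_closed] by (auto simp: corner_algebra_simps)
qed

lemma carrier_corner_u:
  "carrier (corner_algebra P e u) = {\<phi> y \<otimes>\<^bsub>P\<^esub> u | y. y \<in> carrier P'}"
proof -
  have "\<phi> y \<otimes>\<^bsub>P\<^esub> u = \<phi> (inverse q \<odot>\<^bsub>P'\<^esub> y) \<otimes>\<^bsub>P\<^esub> e" for y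
    by (simp add: \<phi>_smult P.smult_mult_P)
  then show ?thesis
    unfolding carrier_corner using \<phi>_e_eq_u P'_smult_closed by blast
qed

lemma \<phi>_u_comm: "\<phi> y \<otimes>\<^bsub>P\<^esub> u = u \<otimes>\<^bsub>P\<^esub> \<phi> y"
  by (simp add: P.smult_mult_P \<phi>_e)

text \<open>Multiplying by \<open>u\<close> instead of \<open>e\<close> is what makes the map
  multiplicative: with \<open>e\<close> a product would acquire the factor \<open>q\<close>, and the
  identity would go to \<open>e\<close> instead of \<open>u\<close>.\<close>

lemma algebra_iso_corner: "(\<lambda>y. \<phi> y \<otimes>\<^bsub>P\<^esub> u) \<in> algebra_iso P' (corner_algebra P e u)"
proof -
  have u: "u \<in> carrier P"
    by (rule P_smult_closed[OF e_closed])
  have mult: "\<phi> (x \<otimes>\<^bsub>P'\<^esub> y) \<otimes>\<^bsub>P\<^esub> u = (\<phi> x \<otimes>\<^bsub>P\<^esub> u) \<otimes>\<^bsub>P\<^esub> (\<phi> y \<otimes>\<^bsub>P\<^esub> u)"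
    if "x \<in> carrier P'" "y \<in> carrier P'" for x y
  proof -
    have "(\<phi> x \<otimes>\<^bsub>P\<^esub> u) \<otimes>\<^bsub>P\<^esub> (\<phi> y \<otimes>\<^bsub>P\<^esub> u) = \<phi> x \<otimes>\<^bsub>P\<^esub> (u \<otimes>\<^bsub>P\<^esub> \<phi> y) \<otimes>\<^bsub>P\<^esub> u"
      by (simp only: P.mult_assoc_P)
    also have "\<dots> = \<phi> x \<otimes>\<^bsub>P\<^esub> \<phi> y \<otimes>\<^bsub>P\<^esub> (u \<otimes>\<^bsub>P\<^esub> u)"
      by (simp only: \<phi>_u_comm[symmetric] P.mult_assoc_P)
    also have "\<dots> = \<phi> (x \<otimes>\<^bsub>P'\<^esub> y) \<otimes>\<^bsub>P\<^esub> u"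
      by (simp only: u_idem ring_hom_mult[OF ring_hom_part_embed that])
    finally show ?thesis ..
  qed
  show ?thesis
    unfolding algebra_iso_def ring_iso_def
  proof (intro CollectI conjI allI ballI ring_hom_memI)
    show "bij_betw (\<lambda>y. \<phi> y \<otimes>\<^bsub>P\<^esub> u) (carrier P') (carrier (corner_algebra P e u))"
      unfolding bij_betw_def carrier_corner_u by (auto intro!: inj_onI \<phi>_u_inj)
    show "\<phi> \<one>\<^bsub>P'\<^esub> \<otimes>\<^bsub>P\<^esub> u = \<one>\<^bsub>corner_algebra P e u\<^esub>"
      using u by (simp add: corner_algebra_simps ring_hom_one[OF ring_hom_part_embed])
  next
    fix x y assume *: "x \<in> carrier P'" "y \<in> carrier P'"
    show "\<phi> (x \<oplus>\<^bsub>P'\<^esub> y) \<otimes>\<^bsub>P\<^esub> u = \<phi> x \<otimes>\<^bsub>P\<^esub> u \<oplus>\<^bsub>corner_algebra P e u\<^esub> \<phi> y \<otimes>\<^bsub>P\<^esub> u"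
      using * u by (simp add: corner_algebra_simps ring_hom_add[OF ring_hom_part_embed] R.l_distr \<phi>_closed)
    show "\<phi> (x \<otimes>\<^bsub>P'\<^esub> y) \<otimes>\<^bsub>P\<^esub> u = \<phi> x \<otimes>\<^bsub>P\<^esub> u \<otimes>\<^bsub>corner_algebra P e u\<^esub> (\<phi> y \<otimes>\<^bsub>P\<^esub> u)"
      by (simp only: corner_algebra_simps mult[OF *])
  next
    fix x assume "x \<in> carrier P'"
    then show "\<phi> x \<otimes>\<^bsub>P\<^esub> u \<in> carrier (corner_algebra P e u)"
      unfolding carrier_corner_u by blast
  next
    fix c x
    show "\<phi> (c \<odot>\<^bsub>P'\<^esub> x) \<otimes>\<^bsub>P\<^esub> u = c \<odot>\<^bsub>corner_algebra P e u\<^esub> (\<phi> x \<otimes>\<^bsub>P\<^esub> u)"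
      by (simp only: corner_algebra_simps \<phi>_smult P.smult_mult_P P_smult_smult mult.commute)
  qed
qed

lemma unital_algebra_corner_P: "unital_algebra (corner_algebra P e u)"
  by (rule unital_algebra_corner[OF P.unital_algebra_P e_closed refl e_eq u_idem])

text \<open>The bimodule is defined through \<open>e\<close> and the abstract setting uses
  \<open>u\<close>. Scalars can be moved onto the left factor, so both generate the same left
  ideal.\<close>

lemma idempotent_bimodule_part: "idempotent_bimodule P P' \<phi> u (part_bimodule (Suc m) T po Q)"
proof (rule idempotent_bimodule.intro[OF R.ring_axioms R'.ring_axioms], rule idempotent_bimodule_axioms.intro)
  show "u \<in> carrier P"
    by (rule P_smult_closed[OF e_closed])
  show "\<phi> \<in> ring_hom P' P" "u \<otimes>\<^bsub>P\<^esub> u = u" "\<And>y. \<phi> y \<otimes>\<^bsub>P\<^esub> u = u \<otimes>\<^bsub>P\<^esub> \<phi> y"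
    by (rule ring_hom_part_embed u_idem \<phi>_u_comm)+
  fix x assume "x \<in> carrier P"
  \<comment> \<open>Each factor \<open>u\<close> supplies one \<open>inverse q\<close>, so u x u is
    e times this element times e.\<close>
  then have "inverse q \<odot>\<^bsub>P\<^esub> (inverse q \<odot>\<^bsub>P\<^esub> x) \<in> carrier P" (is "?x \<in> _")
    by (intro P_smult_closed)
  moreover have "u \<otimes>\<^bsub>P\<^esub> x \<otimes>\<^bsub>P\<^esub> u = e \<otimes>\<^bsub>P\<^esub> ?x \<otimes>\<^bsub>P\<^esub> e"
    by (simp add: P.smult_mult_P)
  ultimately have "u \<otimes>\<^bsub>P\<^esub> x \<otimes>\<^bsub>P\<^esub> u \<in> carrier (corner_algebra P e u)"
    by (auto simp: corner_algebra_simps)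
  then show "\<exists>s\<in>carrier P'. u \<otimes>\<^bsub>P\<^esub> x \<otimes>\<^bsub>P\<^esub> u = \<phi> s \<otimes>\<^bsub>P\<^esub> u"
    unfolding carrier_corner_u by blast
next
  fix y z assume "y \<in> carrier P'" "z \<in> carrier P'" "\<phi> y \<otimes>\<^bsub>P\<^esub> u = \<phi> z \<otimes>\<^bsub>P\<^esub> u"
  then show "y = z"
    by (rule \<phi>_u_inj)
next
  have "x \<otimes>\<^bsub>P\<^esub> e = (q \<odot>\<^bsub>P\<^esub> x) \<otimes>\<^bsub>P\<^esub> u" "x \<otimes>\<^bsub>P\<^esub> u = (inverse q \<odot>\<^bsub>P\<^esub> x) \<otimes>\<^bsub>P\<^esub> e" for x
    using Q by (simp_all add: P.smult_mult_P P_smult_smult)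
  then show "carrier (part_bimodule (Suc m) T po Q) = {x \<otimes>\<^bsub>P\<^esub> u | x. x \<in> carrier P}"
    using P_smult_closed unfolding part_bimodule_def Let_def by simp blast
qed (auto simp: part_bimodule_def Let_def)

end

theorem proposition15:
  fixes n d :: nat and po :: "nat rel" and Q :: "nat \<Rightarrow> 'k::field"
  assumes "n \<ge> 1" and "d \<ge> 1"
    and "partial_order_on {1..d} po"
    and "(\<Prod>t\<in>{1..d}. Q t) \<noteq> 0"
  shows "let T = {1..d};
             P = part_algebra n T po Q;
             P' = part_algebra (n - 1) T po Q;
             e = eT n T;
             u = inverse (\<Prod>t\<in>T. Q t) \<odot>\<^bsub>P\<^esub> e;
             C = corner_algebra P e u
         in carrier C = {part_embed n T po y \<otimes>\<^bsub>P\<^esub> e | y. y \<in> carrier P'} \<and>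
            unital_algebra C \<and>
            (\<lambda>y. part_embed n T po y \<otimes>\<^bsub>P\<^esub> u) \<in> algebra_iso P' C \<and>
            fully_faithful_functor P' P
              (\<lambda>M :: ((nat \<Rightarrow> prel) \<Rightarrow> 'k, 'm) module. tensor P' (part_bimodule n T po Q) M)
              (tensor_map P' (part_bimodule n T po Q))"
proof -
  obtain m where n: "n = Suc m"
    using assms(1) by (cases n) auto
  interpret part_corner m "{1..d}" po Q
    using assms(4) by unfold_locales simp_all
  show ?thesis
    unfolding Let_def n diff_Suc_1
    by (intro conjI carrier_corner unital_algebra_corner_P algebra_iso_corner
        idempotent_bimodule.fully_faithful_functor_tensor[OF idempotent_bimodule_part])
qed

end
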